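(* Let $\sigma>0$ be known, let $\alpha_1,\alpha_2>0$, let $X_0\in\mathbb R$, and let $X$ be the solution of $$dX_t=-\alpha_1X_tI(X_t\le 0)\,dt-\alpha_2X_tI(X_t>0)\,dt+\sigma\,dW_t .$$ Fix any real number $n>0$ and any time step size $h>0$. For $N\ge1$ let $$\widehat L_{n,N}=\frac1N\sum_{k=1}^N(-X_{kh})^nI(X_{kh}\le0),\qquad \widehat R_{n,N}=\frac1N\sum_{k=1}^N(X_{kh})^nI(X_{kh}>0),$$ $$\widehat\alpha_{1,n,N}=\left\{\frac{\sigma^n\Gamma\left(\frac{n+1}2\right)}{\sqrt\pi\,\widehat L_{n,N}\left[\left(\frac{\widehat R_{n,N}}{\widehat L_{n,N}}\right)^{\frac1{n+1}}+1\right]}\right\}^{\frac2n},\qquad \widehat\alpha_{2,n,N}=\left\{\frac{\sigma^n\Gamma\left(\frac{n+1}2\right)}{\sqrt\pi\,\widehat R_{n,N}\left[\left(\frac{\widehat L_{n,N}}{\widehat R_{n,N}}\right)^{\frac1{n+1}}+1\right]}\right\}^{\frac2n}.$$ Then $\widehat\alpha_{1,n,N}\to\alpha_1$ and $\widehat\alpha_{2,n,N}\to\alpha_2$ almost surely as $N\to\infty$.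
   Context: $W=(W_t)_{t\ge0}$ is a one-dimensional standard Brownian motion on a filtered probability space; $X_0$ is a given (deterministic) initial condition; $I(\cdot)$ denotes the indicator function; $\Gamma$ is the Gamma function. The stochastic differential equation has a unique solution. *)

theory Defs
  imports "HOL-Probability.Probability"
begin

text \<open>Time is \<^typ>\<open>real\<close>, and only the indices \<open>t \<ge> 0\<close> carry information: a filtration on the
  half-line extends to negative indices by its value at \<open>0\<close>.\<close>

locale filtered_prob_space = prob_space M + filtration "space M" F
  for M :: "'a measure" and F :: "real \<Rightarrow> 'a measure" +
  assumes sets_F_subset: "\<And>t. sets (F t) \<subseteq> sets M"

definition adapted_process :: "(real \<Rightarrow> 'a measure) \<Rightarrow> (real \<Rightarrow> 'a \<Rightarrow> real) \<Rightarrow> bool" where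
  "adapted_process F Y \<longleftrightarrow> (\<forall>t\<ge>0. Y t \<in> borel_measurable (F t))"

definition ae_continuous_paths :: "'a measure \<Rightarrow> (real \<Rightarrow> 'a \<Rightarrow> real) \<Rightarrow> bool" where
  "ae_continuous_paths M Y \<longleftrightarrow> (AE \<omega> in M. continuous_on {0..} (\<lambda>t. Y t \<omega>))"

text \<open>The second argument of \<^const>\<open>normal_density\<close> is the standard deviation.\<close>

definition standard_brownian_motion ::
    "'a measure \<Rightarrow> (real \<Rightarrow> 'a measure) \<Rightarrow> (real \<Rightarrow> 'a \<Rightarrow> real) \<Rightarrow> bool" where
  "standard_brownian_motion M F W \<longleftrightarrow>
     adapted_process F W \<and>
     ae_continuous_paths M W \<and>
     (AE \<omega> in M. W 0 \<omega> = 0) \<and>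
     (\<forall>s t. 0 \<le> s \<and> s < t \<longrightarrow>
        distributed M lborel (\<lambda>\<omega>. W t \<omega> - W s \<omega>) (normal_density 0 (sqrt (t - s))) \<and>
        prob_space.indep_set M (sets (F s))
          (sets (vimage_algebra (space M) (\<lambda>\<omega>. W t \<omega> - W s \<omega>) borel)))"

text \<open>Solutions of \<open>dX\<^sub>t = b (X\<^sub>t) dt + \<sigma> dW\<^sub>t\<close> with deterministic initial value \<open>x0\<close>.  The diffusion
  coefficient is constant, so its stochastic integral over \<open>[0, t]\<close> is that of an elementary
  integrand, namely \<open>\<sigma> (W\<^sub>t - W\<^sub>0)\<close>.\<close>

definition sde_solution ::
    "'a measure \<Rightarrow> (real \<Rightarrow> 'a measure) \<Rightarrow> (real \<Rightarrow> 'a \<Rightarrow> real) \<Rightarrow> (real \<Rightarrow> real) \<Rightarrow> real \<Rightarrow> real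
      \<Rightarrow> (real \<Rightarrow> 'a \<Rightarrow> real) \<Rightarrow> bool" where
  "sde_solution M F W b \<sigma> x0 X \<longleftrightarrow>
     adapted_process F X \<and>
     ae_continuous_paths M X \<and>
     (AE \<omega> in M. X 0 \<omega> = x0) \<and>
     (AE \<omega> in M. \<forall>t\<ge>0.
        set_integrable lborel {0..t} (\<lambda>s. b (X s \<omega>)) \<and>
        X t \<omega> = X 0 \<omega> + (LINT s:{0..t}|lborel. b (X s \<omega>)) + \<sigma> * (W t \<omega> - W 0 \<omega>))"

definition threshold_drift :: "real \<Rightarrow> real \<Rightarrow> real \<Rightarrow> real" where
  "threshold_drift \<alpha>1 \<alpha>2 x = - \<alpha>1 * x * indicator {..0} x - \<alpha>2 * x * indicator {0<..} x"

text \<open>The exponent \<open>n\<close> is real.  The base of each \<open>powr\<close> below is nonnegative wherever the indicator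
  does not vanish, and \<open>0 powr n = 0\<close> is the usual value for \<open>n > 0\<close>.\<close>

definition L_hat :: "real \<Rightarrow> real \<Rightarrow> (real \<Rightarrow> 'a \<Rightarrow> real) \<Rightarrow> nat \<Rightarrow> 'a \<Rightarrow> real" where
  "L_hat n h X N \<omega> =
     1 / real N * (\<Sum>k=1..N. (- X (real k * h) \<omega>) powr n * indicator {..0} (X (real k * h) \<omega>))"

definition R_hat :: "real \<Rightarrow> real \<Rightarrow> (real \<Rightarrow> 'a \<Rightarrow> real) \<Rightarrow> nat \<Rightarrow> 'a \<Rightarrow> real" where
  "R_hat n h X N \<omega> =
     1 / real N * (\<Sum>k=1..N. (X (real k * h) \<omega>) powr n * indicator {0<..} (X (real k * h) \<omega>))"

text \<open>When \<^const>\<open>L_hat\<close> or \<^const>\<open>R_hat\<close> is zero the quotients below take the value given by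
  \<open>x / 0 = 0\<close>; the estimators are then mathematically undefined.\<close>

definition alpha1_hat ::
    "real \<Rightarrow> real \<Rightarrow> real \<Rightarrow> (real \<Rightarrow> 'a \<Rightarrow> real) \<Rightarrow> nat \<Rightarrow> 'a \<Rightarrow> real" where
  "alpha1_hat \<sigma> n h X N \<omega> =
     (\<sigma> powr n * Gamma ((n + 1) / 2) /
       (sqrt pi * L_hat n h X N \<omega> *
         ((R_hat n h X N \<omega> / L_hat n h X N \<omega>) powr (1 / (n + 1)) + 1))) powr (2 / n)"

definition alpha2_hat ::
    "real \<Rightarrow> real \<Rightarrow> real \<Rightarrow> (real \<Rightarrow> 'a \<Rightarrow> real) \<Rightarrow> nat \<Rightarrow> 'a \<Rightarrow> real" where
  "alpha2_hat \<sigma> n h X N \<omega> =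
     (\<sigma> powr n * Gamma ((n + 1) / 2) /
       (sqrt pi * R_hat n h X N \<omega> *
         ((L_hat n h X N \<omega> / R_hat n h X N \<omega>) powr (1 / (n + 1)) + 1))) powr (2 / n)"

end

theory Submission
  imports Defs "HOL-Real_Asymp.Real_Asymp"
begin

text \<open>
  The drift \<open>b\<close> of the equation is Lipschitz and dissipative: \<open>b x - b y \<le> - c (x - y)\<close> for \<open>y \<le> x\<close>, with
  \<open>c = min \<alpha>1 \<alpha>2 > 0\<close>.  Two solutions driven by the same Brownian motion therefore approach each other
  exponentially fast, so the samples \<open>X (k h)\<close> forget the past exponentially fast and obey a strong law
  of large numbers.  Its limit is integration against the invariant law, whose density is proportional
  to \<open>exp B\<close> with \<open>B' = 2 b / \<sigma>\<^sup>2\<close>: a pair of half-Gaussians glued at \<open>0\<close>.  The limits of \<open>L_hat\<close> and \<open>R_hat\<close>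
  are then half-line Gaussian moments, expressed by the Gamma function, and the two estimators are the
  two components of a continuous inverse of the resulting map \<open>(\<alpha>1, \<alpha>2) \<mapsto> (L, R)\<close>.

  No flow of the stochastic equation, no Markov semigroup and no Ito formula is constructed.  Everything
  is read off the Euler chain \<open>Y (j + 1) = Y j + \<delta> b (Y j) + \<sigma> (W ((j + 1) \<delta>) - W (j \<delta>))\<close> with step
  \<open>\<delta> = h / m\<close>, whose one-step averages are explicit Gaussian integrals, with estimates uniform in \<open>m\<close>.

  \<^item> Noise being additive, a path of the chain converges to the path of the solution at the sampling
    times (\<open>euler_path_convergence\<close>).

  \<^item> The transition operator \<open>Q\<close> contracts, by \<open>1 - c \<delta> / 2\<close>, a Lipschitz seminorm weighted by a hyperbolic
    cosine (\<open>wlip_Q\<close>), and cosh moments stay bounded (\<open>wt_euler\<close>).  This gives covariances that decay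
    geometrically in time (\<open>covariance_decay\<close>) and means that depend little on the starting point
    (\<open>expectation_shift\<close>).

  \<^item> If \<open>v\<close> has compact support and \<open>\<integral> v exp B = 0\<close>, then \<open>v\<close> is the generator applied to a bounded
    function \<open>\<phi>\<close> (\<open>Poisson_equation\<close>).  The increments of \<open>E \<phi> (Y j)\<close> are, to leading order in \<open>\<delta>\<close>, equal to
    \<open>\<delta> E v (Y j)\<close> (\<open>generator_estimate\<close>); they telescope to something bounded, so the means of \<open>v\<close> must vanish in the
    limit (\<open>centred_mean_decay\<close>).  This identifies the invariant law.

  \<^item> Fatou's lemma carries a one-sided variance bound from the chain to the solution, and Chebyshev's
    inequality along the squares with monotonicity in between gives the almost sure bound
    (\<open>AE_eventually_average_le\<close>).

  \<^item> A continuous function of smaller growth than the weight, such as \<open>(max 0 x) powr n\<close>, is approximated by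
    compactly supported Lipschitz functions up to a small multiple of the weight (\<open>ergodic_average\<close>).
\<close>

section \<open>Dissipative drifts and weights of exponential growth\<close>

lemma convex_on_cosh: "convex_on UNIV (cosh :: real \<Rightarrow> real)"
  by (rule f''_ge0_imp_convex[where f' = sinh and f'' = cosh]) (auto intro!: derivative_eq_intros)

locale dissipative_drift =
  fixes b :: "real \<Rightarrow> real" and c C \<sigma> :: real
  assumes c_pos: "0 < c" and sigma_pos: "0 < \<sigma>" and b_0: "b 0 = 0"
    and b_upper: "\<And>x y. y \<le> x \<Longrightarrow> b x - b y \<le> - c * (x - y)"
    and b_lower: "\<And>x y. y \<le> x \<Longrightarrow> - C * (x - y) \<le> b x - b y"
begin

lemma c_le_C: "c \<le> C"
  using b_upper[of 0 1] b_lower[of 0 1] by simp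

lemma C_pos: "0 < C"
  using c_pos c_le_C by simp

lemma c_step_le_1:
  assumes "0 < \<delta>" "C * \<delta> \<le> 1"
  shows "c * \<delta> \<le> 1"
proof -
  have "c * \<delta> \<le> C * \<delta>" using c_le_C assms by (intro mult_right_mono) auto
  then show ?thesis using assms by linarith
qed

lemma b_Lipschitz: "\<bar>b x - b y\<bar> \<le> C * \<bar>x - y\<bar>"
proof -
  have *: "\<bar>b x - b y\<bar> \<le> C * \<bar>x - y\<bar>" if "y \<le> x" for x y
  proof -
    have "0 \<le> c * (x - y)" using c_pos that by simp
    then show ?thesis using b_upper[OF that] b_lower[OF that] that by simp
  qed
  show ?thesis using *[of x y] *[of y x] by (cases "y \<le> x") (auto simp: abs_minus_commute)
qed

lemma b_bound: "\<bar>b x\<bar> \<le> C * \<bar>x\<bar>"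
  using b_Lipschitz[of x 0] b_0 by simp

lemma continuous_b: "continuous_on A b"
proof -
  have "C-lipschitz_on A b"
    using b_Lipschitz C_pos by (intro lipschitz_onI) (auto simp: dist_real_def)
  then show ?thesis by (rule lipschitz_on_continuous_on)
qed

lemma measurable_b [measurable]: "b \<in> borel_measurable borel"
  by (rule borel_measurable_continuous_onI[OF continuous_b])

definition step :: "real \<Rightarrow> real \<Rightarrow> real" where
  "step \<delta> x = x + \<delta> * b x"

lemma measurable_step [measurable]: "step \<delta> \<in> borel_measurable borel"
  unfolding step_def[abs_def] by measurable

text \<open>The reason why the Euler chain inherits the contraction of the equation: the slopes of \<^const>\<open>step\<close> lie in \<open>[1 - C \<delta>, 1 - c \<delta>]\<close>, and the first of these is nonnegative.\<close>

lemma step_contraction: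
  assumes "0 < \<delta>" "C * \<delta> \<le> 1"
  shows "\<bar>step \<delta> x - step \<delta> y\<bar> \<le> (1 - c * \<delta>) * \<bar>x - y\<bar>"
proof -
  have *: "\<bar>step \<delta> x - step \<delta> y\<bar> \<le> (1 - c * \<delta>) * \<bar>x - y\<bar>" if "y \<le> x" for x y
  proof -
    have "\<delta> * (- C * (x - y)) \<le> \<delta> * (b x - b y)"
      using b_lower[OF that] assms by (intro mult_left_mono) auto
    moreover have "\<delta> * (b x - b y) \<le> \<delta> * (- c * (x - y))"
      using b_upper[OF that] assms by (intro mult_left_mono) auto
    moreover have "0 \<le> (1 - C * \<delta>) * (x - y)" using assms that by simp
    ultimately show ?thesis using that
      by (simp add: step_def algebra_simps abs_le_iff)
  qed
  show ?thesis using *[of x y] *[of y x] by (cases "y \<le> x") (auto simp: abs_minus_commute)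
qed

lemma step_abs_le:
  assumes "0 < \<delta>" "C * \<delta> \<le> 1"
  shows "\<bar>step \<delta> x\<bar> \<le> (1 - c * \<delta>) * \<bar>x\<bar>"
  using step_contraction[OF assms, of x 0] by (simp add: step_def b_0)

text \<open>The choice \<open>(4 scale \<sigma>)\<^sup>2 = c\<close> means that the noise, acting on \<open>cosh (4 scale x)\<close>, takes away half of what
  the dissipation gains.\<close>

definition scale :: real where
  "scale = sqrt c / (4 * \<sigma>)"

lemma scale_pos: "0 < scale"
  using c_pos sigma_pos by (simp add: scale_def)

definition wt :: "real \<Rightarrow> real \<Rightarrow> real" where
  "wt k x = cosh (k * scale * x)"

lemma wt_ge_1: "1 \<le> wt k x"
  by (simp add: wt_def cosh_real_ge_1)

lemma wt_nonneg: "0 \<le> wt k x"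
  using wt_ge_1[of k x] by linarith

lemma wt_0 [simp]: "wt k 0 = 1"
  by (simp add: wt_def)

lemma continuous_wt: "continuous_on A (wt k)"
  unfolding wt_def[abs_def] by (intro continuous_intros)

lemma measurable_wt [measurable]: "wt k \<in> borel_measurable borel"
  by (rule borel_measurable_continuous_onI[OF continuous_wt])

lemma wt_square_le: "(wt k x)\<^sup>2 \<le> wt (2 * k) x"
proof -
  define y where "y = k * scale * x"
  have "cosh (2 * y) = 2 * (cosh y)\<^sup>2 - 1"
    using cosh_double_cosh[of y] by simp
  moreover have "1 \<le> (cosh y)\<^sup>2" using cosh_real_ge_1[of y] by simp
  ultimately have "(cosh y)\<^sup>2 \<le> cosh (2 * y)" by simp
  moreover have "cosh (2 * y) = wt (2 * k) x" "cosh y = wt k x" by (simp_all add: wt_def y_def mult_ac)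
  ultimately show ?thesis by simp
qed

lemma abs_le_wt: "\<bar>x\<bar> \<le> (1 / scale) * wt 1 x"
proof -
  define y where "y = scale * x"
  have "\<bar>y\<bar> \<le> cosh \<bar>y\<bar>"
  proof -
    have "0 \<le> (\<bar>y\<bar> - 1)\<^sup>2" by simp
    then have "2 * \<bar>y\<bar> \<le> 1 + \<bar>y\<bar> + \<bar>y\<bar>\<^sup>2 / 2"
      unfolding power2_diff by simp
    also have "\<dots> \<le> exp \<bar>y\<bar>" by (rule exp_lower_Taylor_quadratic) simp
    also have "\<dots> \<le> 2 * cosh \<bar>y\<bar>" unfolding cosh_field_def by simp
    finally show ?thesis by linarith
  qed
  then have "(1 / scale) * \<bar>y\<bar> \<le> (1 / scale) * cosh y"
    using scale_pos by (intro mult_left_mono) auto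
  moreover have "(1 / scale) * \<bar>y\<bar> = \<bar>x\<bar>"
    using scale_pos by (simp add: y_def abs_mult)
  ultimately show ?thesis by (simp add: wt_def y_def)
qed

lemma wt_2_le_4: "wt 2 x \<le> wt 4 x"
  using wt_square_le[of 2 x] wt_ge_1[of 2 x] power_increasing[of 1 2 "wt 2 x"] by simp

section \<open>One step of the Euler chain as an operator on functions\<close>

definition gauss :: "real \<Rightarrow> real measure" where
  "gauss \<delta> = density lborel (normal_density 0 (sqrt \<delta>))"

lemma sets_gauss [simp, measurable_cong]: "sets (gauss \<delta>) = sets borel"
  by (simp add: gauss_def)

lemma space_gauss [simp]: "space (gauss \<delta>) = UNIV"
  by (simp add: gauss_def)

lemma prob_space_gauss: "0 < \<delta> \<Longrightarrow> prob_space (gauss \<delta>)"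
  unfolding gauss_def by (intro prob_space_normal_density) simp

lemma gauss_integrable_iff:
  assumes "f \<in> borel_measurable borel"
  shows "integrable (gauss \<delta>) f \<longleftrightarrow> integrable lborel (\<lambda>z. normal_density 0 (sqrt \<delta>) z * f z)"
  using assms unfolding gauss_def by (subst integrable_real_density) auto

lemma gauss_integral:
  assumes "f \<in> borel_measurable borel"
  shows "integral\<^sup>L (gauss \<delta>) f = integral\<^sup>L lborel (\<lambda>z. normal_density 0 (sqrt \<delta>) z * f z)"
  using assms unfolding gauss_def by (subst integral_real_density) auto

text \<open>Completing the square turns \<open>exp (t z)\<close> times the density into a shifted normal density.\<close>

lemma gauss_mgf:
  assumes "0 < \<delta>"
  shows "integrable (gauss \<delta>) (\<lambda>z. exp (t * z))"
    and "integral\<^sup>L (gauss \<delta>) (\<lambda>z. exp (t * z)) = exp (t\<^sup>2 * \<delta> / 2)"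
proof -
  have "normal_density 0 (sqrt \<delta>) z * exp (t * z)
      = exp (t\<^sup>2 * \<delta> / 2) * normal_density (t * \<delta>) (sqrt \<delta>) z" for z
  proof -
    have "- (z - 0)\<^sup>2 / (2 * (sqrt \<delta>)\<^sup>2) + t * z
        = t\<^sup>2 * \<delta> / 2 + (- (z - t * \<delta>)\<^sup>2 / (2 * (sqrt \<delta>)\<^sup>2))"
      using assms by (simp add: power2_eq_square field_simps)
    then have "exp (- (z - 0)\<^sup>2 / (2 * (sqrt \<delta>)\<^sup>2)) * exp (t * z)
        = exp (t\<^sup>2 * \<delta> / 2) * exp (- (z - t * \<delta>)\<^sup>2 / (2 * (sqrt \<delta>)\<^sup>2))"
      unfolding exp_add[symmetric] by simp
    then show ?thesis unfolding normal_density_def by simp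
  qed
  note * = this
  show "integrable (gauss \<delta>) (\<lambda>z. exp (t * z))"
    using assms by (subst gauss_integrable_iff) (auto simp: * intro!: integrable_normal_density)
  show "integral\<^sup>L (gauss \<delta>) (\<lambda>z. exp (t * z)) = exp (t\<^sup>2 * \<delta> / 2)"
    using assms by (subst gauss_integral) (auto simp: * integral_normal_density)
qed

lemma gauss_cosh:
  assumes "0 < \<delta>"
  shows "integrable (gauss \<delta>) (\<lambda>z. cosh (u + t * z))"
    and "integral\<^sup>L (gauss \<delta>) (\<lambda>z. cosh (u + t * z)) = cosh u * exp (t\<^sup>2 * \<delta> / 2)"
proof -
  have *: "(\<lambda>z. cosh (u + t * z)) = (\<lambda>z. (exp u / 2) * exp (t * z) + (exp (- u) / 2) * exp ((- t) * z))"
    by (simp add: cosh_field_def exp_add[symmetric] fun_eq_iff algebra_simps)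
  show "integrable (gauss \<delta>) (\<lambda>z. cosh (u + t * z))"
    unfolding * using assms by (intro Bochner_Integration.integrable_add integrable_mult_right gauss_mgf)
  have "integral\<^sup>L (gauss \<delta>) (\<lambda>z. cosh (u + t * z))
      = (exp u / 2) * exp (t\<^sup>2 * \<delta> / 2) + (exp (- u) / 2) * exp ((- t)\<^sup>2 * \<delta> / 2)"
    unfolding * by (subst Bochner_Integration.integral_add) (simp_all only: integral_mult_right_zero
        gauss_mgf(2)[OF assms] integrable_mult_right gauss_mgf(1)[OF assms])
  then show "integral\<^sup>L (gauss \<delta>) (\<lambda>z. cosh (u + t * z)) = cosh u * exp (t\<^sup>2 * \<delta> / 2)"
    by (simp add: cosh_field_def field_simps)
qed

text \<open>The transition operator of the Euler chain with step \<open>\<delta>\<close>.\<close>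

definition Q :: "real \<Rightarrow> (real \<Rightarrow> real) \<Rightarrow> real \<Rightarrow> real" where
  "Q \<delta> g x = integral\<^sup>L (gauss \<delta>) (\<lambda>z. g (step \<delta> x + \<sigma> * z))"

lemma wt_integrable:
  assumes "0 < \<delta>"
  shows "integrable (gauss \<delta>) (\<lambda>z. wt k (u + \<sigma> * z))"
  using gauss_cosh(1)[OF assms, of "k * scale * u" "k * scale * \<sigma>"]
  by (simp add: wt_def algebra_simps)

text \<open>Exponential moments are kept under control by the drift: averaging the noise multiplies \<open>cosh\<close> by \<open>exp (c \<delta> / 2)\<close> at most, while the contraction
  towards \<open>0\<close> together with convexity gains a factor \<open>1 - c \<delta>\<close>.  The scale in \<^const>\<open>wt\<close> is chosen to
  make the gain win for all \<open>k \<le> 4\<close>.\<close>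

lemma Q_wt_le:
  assumes "0 < \<delta>" "C * \<delta> \<le> 1" "0 \<le> k" "k \<le> 4"
  shows "Q \<delta> (wt k) x \<le> (1 - c * \<delta> / 2) * wt k x + 2 * c * \<delta>"
proof -
  define e where "e = c * \<delta>"
  have e: "0 < e" "e \<le> 1"
    using assms c_pos c_step_le_1 by (auto simp: e_def)
  define K where "K = k * scale"
  have K: "0 \<le> K" using assms scale_pos by (simp add: K_def)
  have Ks: "(K * \<sigma>)\<^sup>2 \<le> c"
  proof -
    have "(K * \<sigma>)\<^sup>2 = k\<^sup>2 * c / 16"
      using sigma_pos c_pos by (simp add: K_def scale_def power_mult_distrib power_divide)
    moreover have "k\<^sup>2 \<le> 4\<^sup>2" using assms by (intro power_mono) auto
    then have "k\<^sup>2 * c \<le> 16 * c" using c_pos by (intro mult_right_mono) auto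
    ultimately show ?thesis by linarith
  qed
  have "Q \<delta> (wt k) x = cosh (K * step \<delta> x) * exp ((K * \<sigma>)\<^sup>2 * \<delta> / 2)"
    using gauss_cosh(2)[OF assms(1), of "K * step \<delta> x" "K * \<sigma>"]
    by (simp add: Q_def wt_def K_def algebra_simps)
  also have "\<dots> \<le> ((1 - e) * wt k x + e) * exp (e / 2)"
  proof (intro mult_mono)
    have "cosh (K * step \<delta> x) = cosh \<bar>K * step \<delta> x\<bar>" by simp
    also have "\<dots> \<le> cosh ((1 - e) * (K * \<bar>x\<bar>))"
    proof (subst cosh_real_nonneg_le_iff)
      show "\<bar>K * step \<delta> x\<bar> \<le> (1 - e) * (K * \<bar>x\<bar>)"
        using mult_left_mono[OF step_abs_le[OF assms(1,2), of x] K] K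
        by (simp add: abs_mult e_def mult_ac)
    qed (use e K in auto)
    also have "\<dots> \<le> (1 - e) * cosh (K * \<bar>x\<bar>) + e * cosh 0"
      using convex_onD[OF convex_on_cosh, of e "K * \<bar>x\<bar>" 0] e by simp
    also have "cosh (K * \<bar>x\<bar>) = wt k x"
    proof -
      have "K * \<bar>x\<bar> = \<bar>K * x\<bar>" using K by (simp add: abs_mult)
      then show ?thesis by (simp add: wt_def K_def)
    qed
    finally show "cosh (K * step \<delta> x) \<le> (1 - e) * wt k x + e" by simp
    show "exp ((K * \<sigma>)\<^sup>2 * \<delta> / 2) \<le> exp (e / 2)"
      using mult_right_mono[OF Ks, of \<delta>] assms(1) by (simp add: e_def)
    show "0 \<le> (1 - e) * wt k x + e" using e wt_nonneg by simp
  qed simp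
  also have "\<dots> \<le> (1 - e / 2) * wt k x + 2 * e"
  proof -
    have ex: "exp (e / 2) \<le> 1 + e / 2 + (e / 2)\<^sup>2"
      using exp_bound[of "e / 2"] e by simp
    have "(1 - e) * exp (e / 2) \<le> (1 - e) * (1 + e / 2 + (e / 2)\<^sup>2)"
      using ex e by (intro mult_left_mono) auto
    also have "\<dots> = 1 - e / 2 - (e\<^sup>2 / 4 + e * e\<^sup>2 / 4)"
      by (simp add: power2_eq_square field_simps)
    also have "\<dots> \<le> 1 - e / 2"
    proof -
      have "0 \<le> e\<^sup>2" "0 \<le> e * e\<^sup>2" using e by auto
      then show ?thesis by linarith
    qed
    finally have "(1 - e) * exp (e / 2) * wt k x \<le> (1 - e / 2) * wt k x"
      using wt_nonneg by (intro mult_right_mono) auto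
    moreover have "e\<^sup>2 \<le> 1" using e by (simp add: power_le_one)
    then have "exp (e / 2) \<le> 2" using ex e by (simp add: power_divide)
    then have "e * exp (e / 2) \<le> e * 2" using e by (intro mult_left_mono) auto
    ultimately show ?thesis by (simp add: algebra_simps)
  qed
  finally show ?thesis by (simp add: e_def)
qed

definition wdist :: "real \<Rightarrow> real \<Rightarrow> real" where
  "wdist x y = \<bar>x - y\<bar> * (8 + wt 1 x + wt 1 y)"

text \<open>Both Lipschitz functions and the weight \<open>wt 1\<close> itself have a finite constant \<open>A\<close>, so that estimates
  in terms of \<open>A\<close> yield a law of large numbers for test functions and a bound on their tails at once.\<close>

definition wlip :: "real \<Rightarrow> (real \<Rightarrow> real) \<Rightarrow> bool" where
  "wlip A g \<longleftrightarrow> 0 \<le> A \<and> (\<forall>x y. \<bar>g x - g y\<bar> \<le> A * wdist x y)"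

lemma wlipD: "wlip A g \<Longrightarrow> \<bar>g x - g y\<bar> \<le> A * wdist x y"
  by (simp add: wlip_def)

lemma wlip_nonneg: "wlip A g \<Longrightarrow> 0 \<le> A"
  by (simp add: wlip_def)

lemma wlip_Lipschitz:
  assumes "\<And>x y. \<bar>g x - g y\<bar> \<le> A * \<bar>x - y\<bar>" "0 \<le> A"
  shows "wlip A g"
  unfolding wlip_def
proof (intro conjI allI)
  fix x y
  have "\<bar>x - y\<bar> * 1 \<le> wdist x y"
    unfolding wdist_def using wt_ge_1[of 1 x] wt_ge_1[of 1 y] by (intro mult_left_mono) auto
  then have "A * \<bar>x - y\<bar> \<le> A * wdist x y" using assms(2) by (intro mult_left_mono) auto
  then show "\<bar>g x - g y\<bar> \<le> A * wdist x y" using assms(1)[of x y] by linarith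
qed (use assms in auto)

lemma wlip_continuous:
  assumes "wlip A g"
  shows "continuous_on S g"
proof -
  have "isCont g x" for x
  proof -
    have "((\<lambda>y. A * wdist y x) \<longlongrightarrow> A * wdist x x) (at x)"
      unfolding wdist_def wt_def by (intro tendsto_intros)
    then have *: "((\<lambda>y. A * wdist y x) \<longlongrightarrow> 0) (at x)" by (simp add: wdist_def)
    have "((\<lambda>y. g y - g x) \<longlongrightarrow> 0) (at x)"
      by (rule Lim_null_comparison[OF _ *]) (use wlipD[OF assms] in auto)
    then show ?thesis by (simp add: isCont_def LIM_zero_iff)
  qed
  then show ?thesis by (simp add: continuous_at_imp_continuous_on)
qed

lemma wlip_measurable: "wlip A g \<Longrightarrow> g \<in> borel_measurable borel"
  by (intro borel_measurable_continuous_onI wlip_continuous)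

lemma wdist_le: "wdist x y \<le> (10 / scale) * (wt 2 x + wt 2 y)"
proof -
  define s where "s = 1 / scale"
  define p where "p = wt 1 x"
  define q where "q = wt 1 y"
  have s: "0 < s" using scale_pos by (simp add: s_def)
  have pq: "1 \<le> p" "1 \<le> q" by (auto simp: p_def q_def wt_ge_1)
  have "\<bar>x - y\<bar> \<le> s * (p + q)"
    using abs_le_wt[of x] abs_le_wt[of y] by (simp add: s_def p_def q_def algebra_simps)
  then have "wdist x y \<le> (s * (p + q)) * (5 * (p + q))"
    unfolding wdist_def p_def[symmetric] q_def[symmetric] using pq s by (intro mult_mono) auto
  also have "\<dots> = s * (5 * (p + q)\<^sup>2)" by (simp add: power2_eq_square)
  also have "\<dots> \<le> s * (10 * (p\<^sup>2 + q\<^sup>2))"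
  proof -
    have "0 \<le> (p - q)\<^sup>2" by simp
    then have "(p + q)\<^sup>2 \<le> 2 * (p\<^sup>2 + q\<^sup>2)" unfolding power2_diff power2_sum by simp
    then show ?thesis using s by (intro mult_left_mono) auto
  qed
  also have "\<dots> \<le> s * (10 * (wt 2 x + wt 2 y))"
    using wt_square_le[of 1 x] wt_square_le[of 1 y] s unfolding p_def q_def
    by (intro mult_left_mono add_mono) auto
  finally show ?thesis by (simp add: s_def algebra_simps)
qed

lemma wdist_0_le: "wdist x 0 \<le> (20 / scale) * wt 2 x"
proof -
  have "(10 / scale) * (wt 2 x + wt 2 0) \<le> (10 / scale) * (2 * wt 2 x)"
    using wt_ge_1[of 2 x] scale_pos by (intro mult_left_mono) auto
  then show ?thesis using wdist_le[of x 0] by simp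
qed

lemma wlip_growth:
  assumes "wlip A g"
  shows "\<bar>g x\<bar> \<le> (\<bar>g 0\<bar> + A * (20 / scale)) * wt 2 x"
proof -
  have "\<bar>g x\<bar> \<le> \<bar>g 0\<bar> + A * wdist x 0" using wlipD[OF assms, of x 0] by linarith
  also have "\<dots> \<le> \<bar>g 0\<bar> * wt 2 x + A * ((20 / scale) * wt 2 x)"
    using wdist_0_le[of x] wlip_nonneg[OF assms] wt_ge_1[of 2 x]
    by (intro add_mono mult_left_mono) (auto simp: mult_le_cancel_left1)
  finally show ?thesis by (simp add: algebra_simps)
qed

lemma growth_integrable:
  assumes "0 < \<delta>" "g \<in> borel_measurable borel" "\<And>x. \<bar>g x\<bar> \<le> B * wt k x"
  shows "integrable (gauss \<delta>) (\<lambda>z. g (u + \<sigma> * z))"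
proof (rule Bochner_Integration.integrable_bound)
  show "integrable (gauss \<delta>) (\<lambda>z. B * wt k (u + \<sigma> * z))"
    using wt_integrable[OF assms(1)] by simp
  show "(\<lambda>z. g (u + \<sigma> * z)) \<in> borel_measurable (gauss \<delta>)"
    using assms(2) by measurable
  show "AE z in gauss \<delta>. norm (g (u + \<sigma> * z)) \<le> norm (B * wt k (u + \<sigma> * z))"
    using assms(3) by (auto intro!: always_eventually order_trans[OF assms(3)])
qed

lemma wlip_integrable:
  assumes "0 < \<delta>" "wlip A g"
  shows "integrable (gauss \<delta>) (\<lambda>z. g (u + \<sigma> * z))"
  using growth_integrable[OF assms(1) wlip_measurable[OF assms(2)] wlip_growth[OF assms(2)]] .

text \<open>Two points moved by the same noise come closer by the factor \<open>1 - c \<delta>\<close>, whatever the noise, and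
  the averaged weight grows by at most \<open>4 c \<delta>\<close>.  The summand \<open>8\<close> in \<^const>\<open>wdist\<close> is there to absorb
  this growth into half of the gain.\<close>

lemma wlip_Q:
  assumes \<delta>: "0 < \<delta>" "C * \<delta> \<le> 1" and g: "wlip A g"
  shows "wlip (A * (1 - c * \<delta> / 2)) (Q \<delta> g)"
proof -
  define e where "e = c * \<delta>"
  have e: "0 < e" "e \<le> 1"
    using \<delta> c_pos c_step_le_1 by (auto simp: e_def)
  interpret prob_space "gauss \<delta>" by (rule prob_space_gauss[OF \<delta>(1)])
  have "\<bar>Q \<delta> g x - Q \<delta> g y\<bar> \<le> A * (1 - e / 2) * wdist x y" for x y
  proof -
    let ?x = "\<lambda>z. step \<delta> x + \<sigma> * z" and ?y = "\<lambda>z. step \<delta> y + \<sigma> * z"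
    define D where "D = (1 - e) * \<bar>x - y\<bar>"
    define w where "w = wt 1 x + wt 1 y"
    have w: "0 \<le> w" unfolding w_def using wt_nonneg by (intro add_nonneg_nonneg)
    have D: "0 \<le> D" using e by (simp add: D_def)
    have A: "0 \<le> A" by (rule wlip_nonneg[OF g])
    have int: "integrable (gauss \<delta>) (\<lambda>z. wt 1 (?x z))" "integrable (gauss \<delta>) (\<lambda>z. wt 1 (?y z))"
      using wt_integrable[OF \<delta>(1)] by auto
    have "\<bar>Q \<delta> g x - Q \<delta> g y\<bar> = \<bar>\<integral>z. g (?x z) - g (?y z) \<partial>gauss \<delta>\<bar>"
      unfolding Q_def using wlip_integrable[OF \<delta>(1) g] by (subst Bochner_Integration.integral_diff) auto
    also have "\<dots> \<le> (\<integral>z. \<bar>g (?x z) - g (?y z)\<bar> \<partial>gauss \<delta>)" by (rule integral_abs_bound)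
    also have "\<dots> \<le> (\<integral>z. A * (D * (8 + wt 1 (?x z) + wt 1 (?y z))) \<partial>gauss \<delta>)"
    proof (rule integral_mono)
      show "integrable (gauss \<delta>) (\<lambda>z. \<bar>g (?x z) - g (?y z)\<bar>)"
        using wlip_integrable[OF \<delta>(1) g] by auto
      show "integrable (gauss \<delta>) (\<lambda>z. A * (D * (8 + wt 1 (?x z) + wt 1 (?y z))))"
        using int by auto
      fix z
      have "wdist (?x z) (?y z) \<le> D * (8 + wt 1 (?x z) + wt 1 (?y z))"
        unfolding wdist_def using step_contraction[OF \<delta>, of x y] wt_nonneg
        by (intro mult_right_mono) (auto simp: D_def e_def intro!: add_nonneg_nonneg)
      then show "\<bar>g (?x z) - g (?y z)\<bar> \<le> A * (D * (8 + wt 1 (?x z) + wt 1 (?y z)))"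
        using wlipD[OF g, of "?x z" "?y z"] mult_left_mono[OF _ A] by (meson order_trans)
    qed
    also have "\<dots> = A * (D * (8 + Q \<delta> (wt 1) x + Q \<delta> (wt 1) y))"
      unfolding Q_def using int prob_space by simp
    also have "\<dots> \<le> A * (D * (8 + 4 * e + w))"
    proof -
      have "Q \<delta> (wt 1) u \<le> wt 1 u + 2 * e" for u
      proof -
        have "(1 - e / 2) * wt 1 u \<le> 1 * wt 1 u" using e wt_nonneg by (intro mult_right_mono) auto
        then show ?thesis using Q_wt_le[OF \<delta>, of 1 u] by (simp add: e_def)
      qed
      from this[of x] this[of y] show ?thesis
        using A D by (intro mult_left_mono) (auto simp: w_def)
    qed
    also have "\<dots> \<le> A * ((1 - e / 2) * wdist x y)"
    proof (intro mult_left_mono A)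
      have "(1 - e) * (8 + 4 * e + w) \<le> (1 - e / 2) * (8 + w)"
      proof -
        have "0 \<le> e * w" "0 \<le> e * e" using e w by auto
        then show ?thesis by (simp add: algebra_simps)
      qed
      then have "\<bar>x - y\<bar> * ((1 - e) * (8 + 4 * e + w)) \<le> \<bar>x - y\<bar> * ((1 - e / 2) * (8 + w))"
        by (intro mult_left_mono) auto
      then show "D * (8 + 4 * e + w) \<le> (1 - e / 2) * wdist x y"
        by (simp add: D_def wdist_def w_def mult_ac add_ac)
    qed
    finally show ?thesis by simp
  qed
  moreover have "0 \<le> A * (1 - e / 2)" using e wlip_nonneg[OF g] by simp
  ultimately show ?thesis by (auto simp: wlip_def e_def)
qed

lemma wlip_Q_iterate:
  assumes "0 < \<delta>" "C * \<delta> \<le> 1" and "wlip A g"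
  shows "wlip (A * (1 - c * \<delta> / 2) ^ k) ((Q \<delta> ^^ k) g)"
proof (induction k)
  case (Suc k)
  show ?case using wlip_Q[OF assms(1,2) Suc] by (simp add: mult_ac)
qed (use assms in auto)

text \<open>The derivative of \<open>cosh\<close> is bounded by \<open>cosh\<close> itself, which by convexity is bounded between two
  points by the sum of its values there.\<close>

lemma wlip_wt: "wlip scale (wt 1)"
  unfolding wlip_def
proof (intro conjI allI)
  define K where "K = scale"
  have K: "0 < K" using scale_pos by (simp add: K_def)
  fix x y
  have "\<bar>cosh s - cosh t\<bar> \<le> \<bar>s - t\<bar> * (cosh s + cosh t)" for s t :: real
  proof -
    have *: "\<bar>cosh s - cosh t\<bar> \<le> \<bar>s - t\<bar> * (cosh s + cosh t)" if st: "s < t" for s t :: real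
    proof -
      have "\<exists>z>s. z < t \<and> cosh t - cosh s = (t - s) * sinh z"
        using st by (intro MVT2) (auto intro!: derivative_eq_intros)
      then obtain z where z: "s < z" "z < t" "cosh t - cosh s = (t - s) * sinh z" by blast
      have "\<bar>sinh z\<bar> \<le> cosh z"
        using sinh_less_cosh_real[of z] sinh_less_cosh_real[of "- z"] by (simp add: abs_le_iff)
      also have "cosh z \<le> cosh s + cosh t"
      proof (cases "0 \<le> z")
        case True
        then have "cosh z \<le> cosh t" using z by (subst cosh_real_nonneg_le_iff) auto
        then show ?thesis using cosh_real_pos[of s] by linarith
      next
        case False
        then have "cosh (- z) \<le> cosh (- s)" using z by (subst cosh_real_nonneg_le_iff) auto
        then show ?thesis using cosh_real_pos[of t] unfolding cosh_minus by linarith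
      qed
      finally have "(t - s) * \<bar>sinh z\<bar> \<le> (t - s) * (cosh s + cosh t)"
        using st by (intro mult_left_mono) auto
      moreover have "\<bar>cosh t - cosh s\<bar> = (t - s) * \<bar>sinh z\<bar>"
        using z st by (simp add: abs_mult)
      ultimately show ?thesis using st by (simp add: abs_minus_commute)
    qed
    show ?thesis
      using *[of s t] *[of t s] by (cases s t rule: linorder_cases) (auto simp: abs_minus_commute add.commute)
  qed
  from this[of "K * x" "K * y"]
  have "\<bar>wt 1 x - wt 1 y\<bar> \<le> \<bar>K * (x - y)\<bar> * (wt 1 x + wt 1 y)"
    by (simp add: wt_def K_def right_diff_distrib)
  also have "\<dots> \<le> K * wdist x y"
  proof -
    have "\<bar>x - y\<bar> * (wt 1 x + wt 1 y) \<le> wdist x y" 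
      unfolding wdist_def by (intro mult_left_mono) auto
    then have "K * (\<bar>x - y\<bar> * (wt 1 x + wt 1 y)) \<le> K * wdist x y"
      using K by (intro mult_left_mono) auto
    then show ?thesis using K by (simp add: abs_mult mult_ac)
  qed
  finally show "\<bar>wt 1 x - wt 1 y\<bar> \<le> scale * wdist x y" by (simp add: K_def)
qed (use scale_pos in simp)

end

section \<open>The generator and its Poisson equation\<close>

lemma Lipschitz_mult_cutoff:
  fixes u w :: "real \<Rightarrow> real"
  assumes u: "\<And>x y. x \<in> S \<Longrightarrow> y \<in> S \<Longrightarrow> \<bar>u x - u y\<bar> \<le> A * \<bar>x - y\<bar>" "\<And>x. x \<in> S \<Longrightarrow> \<bar>u x\<bar> \<le> U"
    and w: "\<And>x y. \<bar>w x - w y\<bar> \<le> B * \<bar>x - y\<bar>" "\<And>x. \<bar>w x\<bar> \<le> D" "\<And>x. x \<notin> S \<Longrightarrow> w x = 0"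
    and nonneg: "0 \<le> A" "0 \<le> B" "0 \<le> D" "0 \<le> U"
  shows "\<bar>u x * w x - u y * w y\<bar> \<le> (A * D + U * B) * \<bar>x - y\<bar>"
proof -
  have *: "\<bar>u x * w x - u y * w y\<bar> \<le> (A * D + U * B) * \<bar>x - y\<bar>" if "x \<in> S" for x y
  proof -
    have 1: "\<bar>u x * (w x - w y)\<bar> \<le> U * (B * \<bar>x - y\<bar>)"
      unfolding abs_mult using u(2)[OF that] w(1)[of x y] nonneg by (intro mult_mono) auto
    have 2: "\<bar>(u x - u y) * w y\<bar> \<le> (A * \<bar>x - y\<bar>) * D"
    proof (cases "y \<in> S")
      case True
      then show ?thesis
        unfolding abs_mult using u(1)[OF that] w(2)[of y] nonneg by (intro mult_mono) auto
    next
      case False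
      then show ?thesis using w(3) nonneg by simp
    qed
    have "u x * w x - u y * w y = u x * (w x - w y) + (u x - u y) * w y" by (simp add: algebra_simps)
    then have "\<bar>u x * w x - u y * w y\<bar> \<le> \<bar>u x * (w x - w y)\<bar> + \<bar>(u x - u y) * w y\<bar>" by linarith
    also have "\<dots> \<le> (A * D + U * B) * \<bar>x - y\<bar>" using 1 2 by (simp add: algebra_simps)
    finally show ?thesis .
  qed
  consider "x \<in> S" | "y \<in> S" | "x \<notin> S" "y \<notin> S" by blast
  then show ?thesis
  proof cases
    case 2
    then show ?thesis using *[of y x] by (simp add: abs_minus_commute)
  next
    case 3
    then show ?thesis using w(3) nonneg by simp
  qed (rule *)
qed

lemma bounded_if_constant_outside:
  fixes f :: "real \<Rightarrow> real"
  assumes "continuous_on {-R..R} f" "\<And>x. x \<le> - R \<Longrightarrow> f x = p" "\<And>x. R \<le> x \<Longrightarrow> f x = q"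
  obtains M where "0 \<le> M" "\<And>x. \<bar>f x\<bar> \<le> M"
proof -
  have "bounded (f ` {-R..R})"
    by (intro compact_imp_bounded compact_continuous_image assms) simp
  then obtain m where m: "\<And>x. x \<in> {-R..R} \<Longrightarrow> \<bar>f x\<bar> \<le> m"
    unfolding bounded_iff by (metis image_eqI real_norm_def)
  have "\<bar>f x\<bar> \<le> \<bar>m\<bar> + \<bar>p\<bar> + \<bar>q\<bar>" for x
    using m[of x] assms(2)[of x] assms(3)[of x] by (cases "x \<le> - R"; cases "R \<le> x") auto
  then show thesis by (intro that[of "\<bar>m\<bar> + \<bar>p\<bar> + \<bar>q\<bar>"]) auto
qed

lemma antiderivative_real:
  fixes f :: "real \<Rightarrow> real"
  assumes "continuous_on UNIV f"
  obtains F where "\<And>x. (F has_real_derivative f x) (at x)"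
proof -
  have "\<exists>F. \<forall>x::real. (-\<infinity> :: ereal) < x \<longrightarrow> x < (\<infinity> :: ereal) \<longrightarrow> (F has_vector_derivative f x) (at x)"
    using assms by (intro einterval_antiderivative) (auto simp: continuous_on_eq_continuous_at)
  then show thesis
    using that by (auto simp: has_real_derivative_iff_has_vector_derivative)
qed

lemma constant_if_derivative_0_on_convex:
  fixes f :: "real \<Rightarrow> real"
  assumes "convex S" "\<And>x. x \<in> S \<Longrightarrow> (f has_real_derivative 0) (at x)" "x \<in> S" "y \<in> S"
  shows "f x = f y"
  using has_field_derivative_zero_constant[of S f] assms
  by (metis has_field_derivative_at_within)

lemma Lipschitz_if_derivative_bounded:
  fixes f :: "real \<Rightarrow> real"
  assumes "convex S" "\<And>x. x \<in> S \<Longrightarrow> (f has_real_derivative f' x) (at x)" "\<And>x. x \<in> S \<Longrightarrow> \<bar>f' x\<bar> \<le> K"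
    "x \<in> S" "y \<in> S"
  shows "\<bar>f x - f y\<bar> \<le> K * \<bar>x - y\<bar>"
  using field_differentiable_bound[OF assms(1), of f f' K x y] assms
  by (auto intro: has_field_derivative_at_within)

lemma Taylor2_remainder:
  fixes \<phi> \<psi> \<xi> :: "real \<Rightarrow> real"
  assumes d: "\<And>x. (\<phi> has_real_derivative \<psi> x) (at x)" "\<And>x. (\<psi> has_real_derivative \<xi> x) (at x)"
    and L: "\<And>x y. \<bar>\<xi> x - \<xi> y\<bar> \<le> L * \<bar>x - y\<bar>"
  shows "\<bar>\<phi> (x + u) - \<phi> x - u * \<psi> x - u\<^sup>2 / 2 * \<xi> x\<bar> \<le> L * \<bar>u\<bar> ^ 3"
proof (cases "u = 0")
  case False
  define di where "di m = (if m = 0 then \<phi> else if m = 1 then \<psi> else \<xi>)" for m :: nat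
  have "\<exists>t. (if x + u < x then x + u < t \<and> t < x else x < t \<and> t < x + u) \<and>
    \<phi> (x + u) = (\<Sum>m<2. (di m x / fact m) * (x + u - x)^m) + (di 2 t / fact 2) * (x + u - x)^2"
    by (rule Taylor[where a = "x - \<bar>u\<bar>" and b = "x + \<bar>u\<bar>"])
      (use False in \<open>auto simp: di_def d less_2_cases_iff\<close>)
  then obtain t where "if x + u < x then x + u < t \<and> t < x else x < t \<and> t < x + u"
    and t2: "\<phi> (x + u) = (\<Sum>m<2. (di m x / fact m) * (x + u - x)^m) + (di 2 t / fact 2) * (x + u - x)^2"
    by blast
  then have t: "\<bar>t - x\<bar> \<le> \<bar>u\<bar>" "\<phi> (x + u) = \<phi> x + \<psi> x * u + \<xi> t / 2 * u\<^sup>2"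
    by (auto simp: di_def numeral_2_eq_2 split: if_splits)
  have L0: "0 \<le> L" using L[of 1 0] by simp
  have "\<phi> (x + u) - \<phi> x - u * \<psi> x - u\<^sup>2 / 2 * \<xi> x = u\<^sup>2 / 2 * (\<xi> t - \<xi> x)"
    using t(2) by (simp add: algebra_simps)
  then have "\<bar>\<phi> (x + u) - \<phi> x - u * \<psi> x - u\<^sup>2 / 2 * \<xi> x\<bar> = \<bar>u\<bar>\<^sup>2 / 2 * \<bar>\<xi> t - \<xi> x\<bar>"
    by (simp only: abs_mult) simp
  also have "\<dots> \<le> \<bar>u\<bar>\<^sup>2 * (L * \<bar>u\<bar>)"
  proof (intro mult_mono)
    show "\<bar>\<xi> t - \<xi> x\<bar> \<le> L * \<bar>u\<bar>" using L[of t x] t(1) L0 by (meson mult_left_mono order_trans)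
  qed auto
  finally show ?thesis by (simp add: power2_eq_square power3_eq_cube mult_ac)
qed simp

context dissipative_drift
begin

lemma gauss_moments:
  assumes "0 < \<delta>"
  shows "integrable (gauss \<delta>) (\<lambda>z. z)" "integral\<^sup>L (gauss \<delta>) (\<lambda>z. z) = 0"
    and "integrable (gauss \<delta>) (\<lambda>z. z\<^sup>2)" "integral\<^sup>L (gauss \<delta>) (\<lambda>z. z\<^sup>2) = \<delta>"
    and "integrable (gauss \<delta>) (\<lambda>z. \<bar>z\<bar> ^ 3)" "integral\<^sup>L (gauss \<delta>) (\<lambda>z. \<bar>z\<bar> ^ 3) \<le> 2 * (\<delta> * sqrt \<delta>)"
proof -
  have s: "0 < sqrt \<delta>" using assms by simp
  note m1 = normal_moment_odd[OF s, of 0 0]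
  note m2 = normal_moment_even[OF s, of 0 1]
  note m3 = normal_moment_abs_odd[OF s, of 0 1]
  show "integrable (gauss \<delta>) (\<lambda>z. z)" "integral\<^sup>L (gauss \<delta>) (\<lambda>z. z) = 0"
    using m1 by (simp_all add: gauss_integrable_iff gauss_integral has_bochner_integral_iff)
  show "integrable (gauss \<delta>) (\<lambda>z. z\<^sup>2)" "integral\<^sup>L (gauss \<delta>) (\<lambda>z. z\<^sup>2) = \<delta>"
    using m2 assms by (simp_all add: gauss_integrable_iff gauss_integral has_bochner_integral_iff)
  have "sqrt (2 / pi) \<le> 1" using pi_gt3 by simp
  then have "2 * (\<delta> * sqrt \<delta>) * sqrt (2 / pi) \<le> 2 * (\<delta> * sqrt \<delta>) * 1"
    using assms by (intro mult_left_mono) auto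
  moreover have "sqrt \<delta> ^ 3 = \<delta> * sqrt \<delta>" using assms by (simp add: power3_eq_cube)
  then have "has_bochner_integral lborel (\<lambda>z. normal_density 0 (sqrt \<delta>) z * \<bar>z\<bar> ^ 3)
      (2 * (\<delta> * sqrt \<delta>) * sqrt (2 / pi))"
    using m3 by (simp add: numeral_3_eq_3 flip: power_Suc)
  ultimately show "integrable (gauss \<delta>) (\<lambda>z. \<bar>z\<bar> ^ 3)"
    "integral\<^sup>L (gauss \<delta>) (\<lambda>z. \<bar>z\<bar> ^ 3) \<le> 2 * (\<delta> * sqrt \<delta>)"
    by (simp_all only: gauss_integrable_iff gauss_integral has_bochner_integral_iff borel_measurable_power
        borel_measurable_abs measurable_ident_sets[OF refl])
qed

lemma b_powers_le_wt: "(b x)\<^sup>2 \<le> (C / scale)\<^sup>2 * wt 4 x" "\<bar>b x\<bar> ^ 3 \<le> (C / scale) ^ 3 * wt 4 x"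
proof -
  have "C * \<bar>x\<bar> \<le> C * ((1 / scale) * wt 1 x)"
    using abs_le_wt[of x] C_pos by (intro mult_left_mono) auto
  then have b: "\<bar>b x\<bar> \<le> (C / scale) * wt 1 x" using b_bound[of x] by simp
  have C: "0 \<le> C / scale" using C_pos scale_pos by simp
  have w2: "(wt 1 x)\<^sup>2 \<le> wt 4 x" using wt_square_le[of 1 x] wt_2_le_4[of x] by simp
  have "wt 1 x ^ 3 \<le> wt 1 x ^ 4" using wt_ge_1 by (intro power_increasing) auto
  also have "\<dots> = ((wt 1 x)\<^sup>2)\<^sup>2" by simp
  also have "\<dots> \<le> (wt 2 x)\<^sup>2" using wt_square_le[of 1 x] by (intro power_mono) auto
  also have "\<dots> \<le> wt 4 x" using wt_square_le[of 2 x] by simp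
  finally have w3: "wt 1 x ^ 3 \<le> wt 4 x" .
  have "\<bar>b x\<bar>\<^sup>2 \<le> ((C / scale) * wt 1 x)\<^sup>2" by (intro power_mono b) simp
  also have "\<dots> \<le> (C / scale)\<^sup>2 * wt 4 x"
    unfolding power_mult_distrib by (intro mult_left_mono w2) simp
  finally show "(b x)\<^sup>2 \<le> (C / scale)\<^sup>2 * wt 4 x" by simp
  have "\<bar>b x\<bar> ^ 3 \<le> ((C / scale) * wt 1 x) ^ 3" by (intro power_mono b) simp
  also have "\<dots> \<le> (C / scale) ^ 3 * wt 4 x"
    unfolding power_mult_distrib using C by (intro mult_left_mono w3) simp
  finally show "\<bar>b x\<bar> ^ 3 \<le> (C / scale) ^ 3 * wt 4 x" .
qed

text \<open>The counterpart of Ito's formula for one Euler step is a second order Taylor expansion, whose remainder is cubic in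
  an increment of size \<open>sqrt \<delta>\<close>.\<close>

lemma generator_estimate:
  assumes d: "\<And>x. (\<phi> has_real_derivative \<psi> x) (at x)" "\<And>x. (\<psi> has_real_derivative \<xi> x) (at x)"
    and L: "\<And>x y. \<bar>\<xi> x - \<xi> y\<bar> \<le> L * \<bar>x - y\<bar>" and K: "\<And>x. \<bar>\<xi> x\<bar> \<le> K"
    and M: "\<And>x. \<bar>\<phi> x\<bar> \<le> M"
  obtains D where "0 \<le> D" "\<And>\<delta> x. 0 < \<delta> \<Longrightarrow> \<delta> \<le> 1 \<Longrightarrow>
    \<bar>Q \<delta> \<phi> x - \<phi> x - \<delta> * (b x * \<psi> x + \<sigma>\<^sup>2 / 2 * \<xi> x)\<bar> \<le> D * (\<delta> * sqrt \<delta>) * wt 4 x"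
proof -
  define D where "D = (C / scale)\<^sup>2 * K / 2 + L * (4 * (C / scale) ^ 3 + 8 * \<sigma> ^ 3)"
  have L0: "0 \<le> L" using L[of 1 0] by simp
  have K0: "0 \<le> K" using K[of 0] by simp
  have M0: "0 \<le> M" using M[of 0] by simp
  have CS: "0 \<le> C / scale" using C_pos scale_pos by simp
  have D0: "0 \<le> D" using L0 K0 CS sigma_pos by (simp add: D_def)
  have meas [measurable]: "\<phi> \<in> borel_measurable borel"
    by (intro borel_measurable_continuous_onI continuous_at_imp_continuous_on ballI DERIV_isCont[OF d(1)])
  \<comment> \<open>The first two moments of the increment \<open>u\<close> produce the generator, up to the term \<open>\<delta>\<^sup>2 (b x)\<^sup>2\<close>.\<close>
  have "\<bar>Q \<delta> \<phi> x - \<phi> x - \<delta> * (b x * \<psi> x + \<sigma>\<^sup>2 / 2 * \<xi> x)\<bar> \<le> D * (\<delta> * sqrt \<delta>) * wt 4 x"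
    if \<delta>: "0 < \<delta>" "\<delta> \<le> 1" for \<delta> x
  proof -
    interpret prob_space "gauss \<delta>" by (rule prob_space_gauss[OF \<delta>(1)])
    note mom = gauss_moments[OF \<delta>(1)]
    define u where "u z = \<delta> * b x + \<sigma> * z" for z
    define rem where "rem z = \<phi> (x + u z) - \<phi> x - u z * \<psi> x - (u z)\<^sup>2 / 2 * \<xi> x" for z
    have u2: "(u z)\<^sup>2 = (\<delta> * b x)\<^sup>2 + 2 * \<delta> * b x * \<sigma> * z + \<sigma>\<^sup>2 * z\<^sup>2" for z
      by (simp add: u_def power2_eq_square algebra_simps)
    have iu: "integrable (gauss \<delta>) u" "integral\<^sup>L (gauss \<delta>) u = \<delta> * b x"
      using mom prob_space by (simp_all add: u_def[abs_def])
    have iu2: "integrable (gauss \<delta>) (\<lambda>z. (u z)\<^sup>2)" "integral\<^sup>L (gauss \<delta>) (\<lambda>z. (u z)\<^sup>2) = (\<delta> * b x)\<^sup>2 + \<sigma>\<^sup>2 * \<delta>"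
      using mom prob_space by (simp_all add: u2)
    have i\<phi>: "integrable (gauss \<delta>) (\<lambda>z. \<phi> (x + u z))"
      by (rule integrable_const_bound[of _ M]) (auto simp: M u_def)
    have irem: "integrable (gauss \<delta>) rem"
      unfolding rem_def[abs_def] using i\<phi> iu iu2 by (auto intro!: integrable_mult_left Bochner_Integration.integrable_diff)
    have "Q \<delta> \<phi> x = (\<integral>z. \<phi> x + u z * \<psi> x + (u z)\<^sup>2 / 2 * \<xi> x + rem z \<partial>gauss \<delta>)"
      unfolding Q_def rem_def step_def u_def by (intro Bochner_Integration.integral_cong) (auto simp: add_ac)
    also have "\<dots> = \<phi> x + \<delta> * b x * \<psi> x + ((\<delta> * b x)\<^sup>2 + \<sigma>\<^sup>2 * \<delta>) / 2 * \<xi> x + integral\<^sup>L (gauss \<delta>) rem"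
      using iu iu2 irem prob_space by simp
    finally have eq: "Q \<delta> \<phi> x - \<phi> x - \<delta> * (b x * \<psi> x + \<sigma>\<^sup>2 / 2 * \<xi> x)
        = \<delta>\<^sup>2 * ((b x)\<^sup>2 / 2 * \<xi> x) + integral\<^sup>L (gauss \<delta>) rem"
      by (simp add: power_mult_distrib add_divide_distrib algebra_simps)
    have sq: "\<delta> \<le> sqrt \<delta>"
    proof -
      have "sqrt \<delta> * sqrt \<delta> \<le> 1 * sqrt \<delta>" using \<delta> by (intro mult_right_mono) auto
      then show ?thesis using \<delta> by simp
    qed
    have d2: "\<delta>\<^sup>2 \<le> \<delta> * sqrt \<delta>" unfolding power2_eq_square using \<delta> sq by (intro mult_left_mono) auto
    have "\<delta> ^ 3 \<le> \<delta>\<^sup>2" using \<delta> by (intro power_decreasing) auto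
    then have d3: "\<delta> ^ 3 \<le> \<delta> * sqrt \<delta>" using d2 by linarith
    have "\<bar>integral\<^sup>L (gauss \<delta>) rem\<bar> \<le> (\<integral>z. \<bar>rem z\<bar> \<partial>gauss \<delta>)" by (rule integral_abs_bound)
    also have "\<dots> \<le> (\<integral>z. L * (4 * (\<delta> ^ 3 * \<bar>b x\<bar> ^ 3 + \<sigma> ^ 3 * \<bar>z\<bar> ^ 3)) \<partial>gauss \<delta>)"
    proof (rule integral_mono)
      show "integrable (gauss \<delta>) (\<lambda>z. \<bar>rem z\<bar>)" using irem by auto
      show "integrable (gauss \<delta>) (\<lambda>z. L * (4 * (\<delta> ^ 3 * \<bar>b x\<bar> ^ 3 + \<sigma> ^ 3 * \<bar>z\<bar> ^ 3)))"
        using mom by auto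
      fix z
      have cube: "(p + q) ^ 3 \<le> 4 * (p ^ 3 + q ^ 3)" if "0 \<le> p" "0 \<le> q" for p q :: real
      proof -
        have "0 \<le> 3 * (p + q) * (p - q)\<^sup>2" using that by simp
        then show ?thesis by (simp add: power2_eq_square power3_eq_cube algebra_simps)
      qed
      have "\<bar>u z\<bar> \<le> \<delta> * \<bar>b x\<bar> + \<sigma> * \<bar>z\<bar>"
        unfolding u_def using abs_triangle_ineq[of "\<delta> * b x" "\<sigma> * z"] \<delta> sigma_pos by (simp add: abs_mult)
      then have "\<bar>u z\<bar> ^ 3 \<le> (\<delta> * \<bar>b x\<bar> + \<sigma> * \<bar>z\<bar>) ^ 3" by (intro power_mono) auto
      also have "\<dots> \<le> 4 * ((\<delta> * \<bar>b x\<bar>) ^ 3 + (\<sigma> * \<bar>z\<bar>) ^ 3)" using \<delta> sigma_pos by (intro cube) auto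
      finally have "L * \<bar>u z\<bar> ^ 3 \<le> L * (4 * (\<delta> ^ 3 * \<bar>b x\<bar> ^ 3 + \<sigma> ^ 3 * \<bar>z\<bar> ^ 3))"
        using L0 by (intro mult_left_mono) (auto simp: power_mult_distrib)
      then show "\<bar>rem z\<bar> \<le> L * (4 * (\<delta> ^ 3 * \<bar>b x\<bar> ^ 3 + \<sigma> ^ 3 * \<bar>z\<bar> ^ 3))"
        unfolding rem_def using Taylor2_remainder[OF d L, of x "u z"] by linarith
    qed
    also have "\<dots> = L * (4 * (\<delta> ^ 3 * \<bar>b x\<bar> ^ 3 + \<sigma> ^ 3 * (\<integral>z. \<bar>z\<bar> ^ 3 \<partial>gauss \<delta>)))"
      using mom prob_space by simp
    also have "\<dots> \<le> L * (4 * ((\<delta> * sqrt \<delta>) * ((C / scale) ^ 3 * wt 4 x) + \<sigma> ^ 3 * (2 * (\<delta> * sqrt \<delta>) * wt 4 x)))"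
    proof (intro mult_left_mono add_mono L0)
      show "\<delta> ^ 3 * \<bar>b x\<bar> ^ 3 \<le> \<delta> * sqrt \<delta> * ((C / scale) ^ 3 * wt 4 x)"
        using d3 b_powers_le_wt(2)[of x] \<delta> by (intro mult_mono) auto
      have "2 * (\<delta> * sqrt \<delta>) * 1 \<le> 2 * (\<delta> * sqrt \<delta>) * wt 4 x"
        using \<delta> wt_ge_1[of 4 x] by (intro mult_left_mono) auto
      then show "(\<integral>z. \<bar>z\<bar> ^ 3 \<partial>gauss \<delta>) \<le> 2 * (\<delta> * sqrt \<delta>) * wt 4 x" using mom(6) by linarith
    qed (use sigma_pos in auto)
    finally have rem: "\<bar>integral\<^sup>L (gauss \<delta>) rem\<bar>
        \<le> (L * (4 * (C / scale) ^ 3 + 8 * \<sigma> ^ 3)) * (\<delta> * sqrt \<delta>) * wt 4 x"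
      by (simp add: algebra_simps)
    have "\<bar>\<delta>\<^sup>2 * ((b x)\<^sup>2 / 2 * \<xi> x)\<bar> = \<delta>\<^sup>2 * ((b x)\<^sup>2 / 2 * \<bar>\<xi> x\<bar>)"
      by (simp add: abs_mult)
    also have "\<dots> \<le> (\<delta> * sqrt \<delta>) * (((C / scale)\<^sup>2 * wt 4 x) / 2 * K)"
      using d2 b_powers_le_wt(1)[of x] K[of x] \<delta> wt_nonneg[of 4 x] by (intro mult_mono) auto
    finally have "\<bar>\<delta>\<^sup>2 * ((b x)\<^sup>2 / 2 * \<xi> x)\<bar> \<le> ((C / scale)\<^sup>2 * K / 2) * (\<delta> * sqrt \<delta>) * wt 4 x"
      by (simp add: algebra_simps)
    moreover have "D * (\<delta> * sqrt \<delta>) * wt 4 x = ((C / scale)\<^sup>2 * K / 2) * (\<delta> * sqrt \<delta>) * wt 4 x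
        + (L * (4 * (C / scale) ^ 3 + 8 * \<sigma> ^ 3)) * (\<delta> * sqrt \<delta>) * wt 4 x"
      unfolding D_def by (simp only: distrib_right)
    ultimately show ?thesis unfolding eq using rem abs_triangle_ineq[of "\<delta>\<^sup>2 * ((b x)\<^sup>2 / 2 * \<xi> x)" "integral\<^sup>L (gauss \<delta>) rem"]
      by linarith
  qed
  then show thesis using that D0 by blast
qed

text \<open>The adjoint form of the generator: for \<open>p = exp B\<close> one has
  \<open>p (b \<psi> + \<sigma>\<^sup>2 \<psi>' / 2) = (\<sigma>\<^sup>2 / 2) (p \<psi>)'\<close>, so \<open>b \<phi>' + \<sigma>\<^sup>2 \<phi>'' / 2 = v\<close> is solved for \<open>\<psi> = \<phi>'\<close> by one
  integration.  The function \<open>\<psi>\<close> has compact support exactly because \<open>v\<close> integrates to \<open>0\<close> against \<open>p\<close>, and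
  this is what makes \<open>\<phi>\<close> bounded.\<close>

lemma Poisson_equation:
  assumes B: "\<And>x. (B has_real_derivative 2 * b x / \<sigma>\<^sup>2) (at x)"
    and v: "\<And>x y. \<bar>v x - v y\<bar> \<le> A * \<bar>x - y\<bar>" "\<And>x. R \<le> \<bar>x\<bar> \<Longrightarrow> v x = 0"
    and R: "0 < R" and v0: "(LINT x|lborel. v x * exp (B x)) = 0"
  shows "\<exists>\<phi> \<psi> \<xi> L K M. (\<forall>x. (\<phi> has_real_derivative \<psi> x) (at x)) \<and>
    (\<forall>x. (\<psi> has_real_derivative \<xi> x) (at x)) \<and> (\<forall>x y. \<bar>\<xi> x - \<xi> y\<bar> \<le> L * \<bar>x - y\<bar>) \<and>
    (\<forall>x. \<bar>\<xi> x\<bar> \<le> K) \<and> (\<forall>x. \<bar>\<phi> x\<bar> \<le> M) \<and> (\<forall>x. b x * \<psi> x + \<sigma>\<^sup>2 / 2 * \<xi> x = v x)"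
proof -
  have A0: "0 \<le> A" using v(1)[of 1 0] by simp
  have cv: "continuous_on S v" for S
    by (rule lipschitz_on_continuous_on[of A]) (use v(1) A0 in \<open>auto intro!: lipschitz_onI simp: dist_real_def\<close>)
  have cB: "continuous_on S B" for S
    by (intro continuous_at_imp_continuous_on ballI DERIV_isCont[OF B])
  note v0R = v(2)
  have supp: "v x = 0" if "x \<notin> {-R..R}" for x
    using v0R[of x] that by auto
  obtain G0 where G0: "\<And>x. (G0 has_real_derivative v x * exp (B x)) (at x)"
    by (rule antiderivative_real[of "\<lambda>x. v x * exp (B x)"]) (auto intro!: continuous_intros cv cB)
  \<comment> \<open>The primitive of \<open>v p\<close> that vanishes to the left of the support of \<open>v\<close>.\<close>
  define G where "G x = G0 x - G0 (- R)" for x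
  have dG: "(G has_real_derivative v x * exp (B x)) (at x)" for x
    unfolding G_def[abs_def] using G0 by (auto intro!: derivative_eq_intros)
  have dG0: "(G has_real_derivative 0) (at x)" if "R \<le> \<bar>x\<bar>" for x
    using dG[of x] v0R[OF that] by simp
  have Gleft: "G x = 0" if "x \<le> - R" for x
  proof -
    have "G x = G (- R)"
      by (rule constant_if_derivative_0_on_convex[of "{..-R}" G]) (use that R in \<open>auto intro!: dG0\<close>)
    then show ?thesis by (simp add: G_def)
  qed
  have "((\<lambda>x. v x * exp (B x)) has_integral (G R - G (- R))) {-R..R}"
    using R dG by (intro fundamental_theorem_of_calculus)
      (auto simp: has_real_derivative_iff_has_vector_derivative intro: has_vector_derivative_at_within)
  then have "((\<lambda>x. v x * exp (B x)) has_integral (G R - G (- R))) UNIV"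
    by (rule has_integral_on_superset) (use supp in auto)
  moreover have "integrable lborel (\<lambda>x. v x * exp (B x))"
  proof -
    have "integrable lborel (\<lambda>x. indicator {-R..R} x *\<^sub>R (v x * exp (B x)))"
      by (intro borel_integrable_compact continuous_intros cv cB) auto
    moreover have "(\<lambda>x. indicator {-R..R} x *\<^sub>R (v x * exp (B x))) = (\<lambda>x. v x * exp (B x))"
      using supp by (auto simp: fun_eq_iff indicator_def)
    ultimately show ?thesis by simp
  qed
  then have "((\<lambda>x. v x * exp (B x)) has_integral 0) UNIV"
    using has_integral_integral_lborel[of "\<lambda>x. v x * exp (B x)"] v0 by simp
  ultimately have GR: "G R = 0" using Gleft[of "- R"] by (auto dest: has_integral_unique)
  have Gright: "G x = 0" if "R \<le> x" for x
  proof -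
    have "G x = G R"
      by (rule constant_if_derivative_0_on_convex[of "{R..}" G]) (use that R in \<open>auto intro!: dG0\<close>)
    then show ?thesis by (simp add: GR)
  qed
  define \<psi> where "\<psi> x = 2 / \<sigma>\<^sup>2 * G x * exp (- B x)" for x
  define \<xi> where "\<xi> x = 2 / \<sigma>\<^sup>2 * (v x - b x * \<psi> x)" for x
  have d\<psi>: "(\<psi> has_real_derivative \<xi> x) (at x)" for x
    unfolding \<psi>_def[abs_def] \<xi>_def using sigma_pos
    by (auto intro!: derivative_eq_intros dG B simp: field_simps exp_minus)
  have \<psi>0: "\<psi> x = 0" if "R \<le> \<bar>x\<bar>" for x
    using Gleft[of x] Gright[of x] that by (cases "0 \<le> x") (auto simp: \<psi>_def)
  have c\<psi>: "continuous_on S \<psi>" for S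
    by (intro continuous_at_imp_continuous_on ballI DERIV_isCont[OF d\<psi>])
  have c\<xi>: "continuous_on S \<xi>" for S
    unfolding \<xi>_def[abs_def] by (intro continuous_intros cv c\<psi> continuous_b)
  have \<xi>0: "\<xi> x = 0" if "R \<le> \<bar>x\<bar>" for x
    using \<psi>0[OF that] v0R[OF that] by (simp add: \<xi>_def)
  obtain K where K: "0 \<le> K" "\<And>x. \<bar>\<xi> x\<bar> \<le> K"
    by (rule bounded_if_constant_outside[OF c\<xi>[of "{-R..R}"], of 0 0]) (use \<xi>0 R in auto)
  obtain D where D: "0 \<le> D" "\<And>x. \<bar>\<psi> x\<bar> \<le> D"
    by (rule bounded_if_constant_outside[OF c\<psi>[of "{-R..R}"], of 0 0]) (use \<psi>0 R in auto)
  obtain \<phi> where \<phi>: "\<And>x. (\<phi> has_real_derivative \<psi> x) (at x)"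
    by (rule antiderivative_real[OF c\<psi>]) blast
  have \<phi>0: "(\<phi> has_real_derivative 0) (at x)" if "R \<le> \<bar>x\<bar>" for x
    using \<phi>[of x] \<psi>0[OF that] by simp
  have c\<phi>: "continuous_on {-R..R} \<phi>"
    by (intro continuous_at_imp_continuous_on ballI DERIV_isCont[OF \<phi>])
  obtain M where M: "0 \<le> M" "\<And>x. \<bar>\<phi> x\<bar> \<le> M"
  proof (rule bounded_if_constant_outside[OF c\<phi>])
    show "\<phi> x = \<phi> (- R)" if "x \<le> - R" for x
      by (rule constant_if_derivative_0_on_convex[of "{..-R}" \<phi>]) (use that R in \<open>auto intro!: \<phi>0\<close>)
    show "\<phi> x = \<phi> R" if "R \<le> x" for x
      by (rule constant_if_derivative_0_on_convex[of "{R..}" \<phi>]) (use that R in \<open>auto intro!: \<phi>0\<close>)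
  qed blast
  have L\<psi>: "\<bar>\<psi> x - \<psi> y\<bar> \<le> K * \<bar>x - y\<bar>" for x y
    by (rule Lipschitz_if_derivative_bounded[of UNIV]) (auto intro: d\<psi> K)
  have Lb\<psi>: "\<bar>b x * \<psi> x - b y * \<psi> y\<bar> \<le> (C * D + (C * R) * K) * \<bar>x - y\<bar>" for x y
  proof (rule Lipschitz_mult_cutoff[of "{-R..R}"])
    show "\<bar>b z\<bar> \<le> C * R" if "z \<in> {-R..R}" for z
    proof -
      have "C * \<bar>z\<bar> \<le> C * R" using that C_pos by (intro mult_left_mono) auto
      then show ?thesis using b_bound[of z] by linarith
    qed
    show "\<psi> z = 0" if "z \<notin> {-R..R}" for z using that by (intro \<psi>0) auto
  qed (use b_Lipschitz L\<psi> D K C_pos R in auto)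
  have "\<bar>\<xi> x - \<xi> y\<bar> \<le> 2 / \<sigma>\<^sup>2 * (A + (C * D + (C * R) * K)) * \<bar>x - y\<bar>" for x y
  proof -
    have "\<xi> x - \<xi> y = 2 / \<sigma>\<^sup>2 * ((v x - v y) - (b x * \<psi> x - b y * \<psi> y))"
      unfolding \<xi>_def right_diff_distrib by linarith
    then have "\<bar>\<xi> x - \<xi> y\<bar> = 2 / \<sigma>\<^sup>2 * \<bar>(v x - v y) - (b x * \<psi> x - b y * \<psi> y)\<bar>"
      by (simp only: abs_mult) simp
    also have "\<dots> \<le> 2 / \<sigma>\<^sup>2 * ((A + (C * D + (C * R) * K)) * \<bar>x - y\<bar>)"
      using v(1)[of x y] Lb\<psi>[of x y] by (intro mult_left_mono) (auto simp: algebra_simps)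
    finally show ?thesis by (simp only: mult.assoc)
  qed
  moreover have "b x * \<psi> x + \<sigma>\<^sup>2 / 2 * \<xi> x = v x" for x
    using sigma_pos by (simp add: \<xi>_def field_simps)
  ultimately show ?thesis using \<phi> d\<psi> K M by blast
qed

end

section \<open>The Euler chain driven by a Brownian motion\<close>

lemma (in prob_space) abs_expectation_le:
  fixes f :: "'a \<Rightarrow> real"
  assumes "integrable M f" "\<And>x. \<bar>f x\<bar> \<le> U"
  shows "\<bar>expectation f\<bar> \<le> U"
proof -
  have "\<bar>expectation f\<bar> \<le> expectation (\<lambda>x. \<bar>f x\<bar>)" by (rule integral_abs_bound)
  also have "\<dots> \<le> expectation (\<lambda>_. U)" using assms by (intro integral_mono) auto
  finally show ?thesis by (simp add: prob_space)
qed

locale driven_chain = dissipative_drift b c C \<sigma> + filtered_prob_space M F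
  for b :: "real \<Rightarrow> real" and c C \<sigma> :: real and M :: "'a measure" and F :: "real \<Rightarrow> 'a measure" +
  fixes W :: "real \<Rightarrow> 'a \<Rightarrow> real" and x0 :: real
  assumes bm: "standard_brownian_motion M F W"
begin

lemma F_mono: "f \<in> borel_measurable (F s) \<Longrightarrow> s \<le> t \<Longrightarrow> f \<in> borel_measurable (F t)"
  using measurable_mono[of borel borel "F s" "F t"] sets_F_mono[of s t] space_F by auto

lemma F_measurable: "f \<in> measurable (F s) N \<Longrightarrow> f \<in> measurable M N"
  using measurable_mono[of N N "F s" M] sets_F_subset[of s] space_F by auto

lemma W_adapted: "0 \<le> t \<Longrightarrow> W t \<in> borel_measurable (F t)"
  using bm by (auto simp: standard_brownian_motion_def adapted_process_def)

text \<open>All distributional properties of the Brownian motion are used through this product law: a new increment is Gaussian and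
  independent of everything known so far.\<close>

lemma joint_law:
  assumes t: "0 \<le> t" "0 < \<delta>" and Z: "Z \<in> measurable (F t) S"
  shows "distr M (S \<Otimes>\<^sub>M borel) (\<lambda>\<omega>. (Z \<omega>, W (t + \<delta>) \<omega> - W t \<omega>)) = distr M S Z \<Otimes>\<^sub>M gauss \<delta>"
proof -
  define D where "D \<omega> = W (t + \<delta>) \<omega> - W t \<omega>" for \<omega>
  have dist: "distributed M lborel D (normal_density 0 (sqrt \<delta>))"
    and indep: "indep_set (sets (F t)) (sets (vimage_algebra (space M) D borel))"
  proof -
    have "\<forall>s u. 0 \<le> s \<and> s < u \<longrightarrow>
        distributed M lborel (\<lambda>\<omega>. W u \<omega> - W s \<omega>) (normal_density 0 (sqrt (u - s))) \<and>
        indep_set (sets (F s)) (sets (vimage_algebra (space M) (\<lambda>\<omega>. W u \<omega> - W s \<omega>) borel))"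
      using bm unfolding standard_brownian_motion_def by blast
    from this[rule_format, of t "t + \<delta>"] t
    show "distributed M lborel D (normal_density 0 (sqrt \<delta>))"
      "indep_set (sets (F t)) (sets (vimage_algebra (space M) D borel))"
      by (simp_all add: D_def[abs_def])
  qed
  have ZM: "Z \<in> measurable M S" by (rule F_measurable[OF Z])
  have DM: "D \<in> borel_measurable M" using distributed_measurable[OF dist] by simp
  have [measurable]: "(\<lambda>\<omega>. (Z \<omega>, D \<omega>)) \<in> measurable M (S \<Otimes>\<^sub>M borel)" using ZM DM by measurable
  have "distr M lborel D = gauss \<delta>"
    using distributed_distr_eq_density[OF dist] by (simp add: gauss_def)
  then have lawD: "distr M borel D = gauss \<delta>"
    by (metis distr_cong sets_lborel)
  have "distr M S Z \<Otimes>\<^sub>M gauss \<delta> = distr M (S \<Otimes>\<^sub>M borel) (\<lambda>\<omega>. (Z \<omega>, D \<omega>))"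
  proof (rule pair_measure_eqI)
    show "sigma_finite_measure (distr M S Z)"
      by (intro prob_space_imp_sigma_finite prob_space_distr ZM)
    show "sigma_finite_measure (gauss \<delta>)"
      by (intro prob_space_imp_sigma_finite prob_space_gauss t)
    show "sets (distr M S Z \<Otimes>\<^sub>M gauss \<delta>) = sets (distr M (S \<Otimes>\<^sub>M borel) (\<lambda>\<omega>. (Z \<omega>, D \<omega>)))"
      by (simp cong: sets_pair_measure_cong)
    fix A E assume "A \<in> sets (distr M S Z)" "E \<in> sets (gauss \<delta>)"
    then have A: "A \<in> sets S" and E: "E \<in> sets borel" by auto
    have ZA: "Z -` A \<inter> space M \<in> sets (F t)" using measurable_sets[OF Z A] by (simp add: space_F)
    have DE: "D -` E \<inter> space M \<in> sets (vimage_algebra (space M) D borel)"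
      unfolding sets_vimage_algebra using E by (intro sigma_sets.Basic) auto
    have "emeasure (distr M (S \<Otimes>\<^sub>M borel) (\<lambda>\<omega>. (Z \<omega>, D \<omega>))) (A \<times> E)
        = emeasure M ((Z -` A \<inter> space M) \<inter> (D -` E \<inter> space M))"
      using A E by (subst emeasure_distr) (auto intro!: arg_cong[where f = "emeasure M"])
    also have "\<dots> = emeasure M (Z -` A \<inter> space M) * emeasure M (D -` E \<inter> space M)"
      using indep_setD[OF indep ZA DE] by (simp add: emeasure_eq_measure ennreal_mult)
    also have "\<dots> = emeasure (distr M S Z) A * emeasure (distr M borel D) E"
      using A E ZM DM by (simp add: emeasure_distr)
    finally show "emeasure (distr M S Z) A * emeasure (gauss \<delta>) E
        = emeasure (distr M (S \<Otimes>\<^sub>M borel) (\<lambda>\<omega>. (Z \<omega>, D \<omega>))) (A \<times> E)"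
      by (simp add: lawD)
  qed
  then show ?thesis by (simp add: D_def)
qed

text \<open>The Markov property, in the form in which conditional expectations are never formed: the factor
  \<open>Z\<close> stands for an arbitrary observable of the past.\<close>

lemma expectation_step:
  fixes Z Y :: "'a \<Rightarrow> real"
  assumes t: "0 \<le> t" "0 < \<delta>" and Z: "Z \<in> borel_measurable (F t)" "Y \<in> borel_measurable (F t)"
    and g: "g \<in> borel_measurable borel"
    and int: "integrable M (\<lambda>\<omega>. Z \<omega> * g (Y \<omega> + \<sigma> * (W (t + \<delta>) \<omega> - W t \<omega>)))"
  shows "expectation (\<lambda>\<omega>. Z \<omega> * g (Y \<omega> + \<sigma> * (W (t + \<delta>) \<omega> - W t \<omega>)))
    = expectation (\<lambda>\<omega>. Z \<omega> * (\<integral>z. g (Y \<omega> + \<sigma> * z) \<partial>gauss \<delta>))"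
proof -
  let ?B = "borel \<Otimes>\<^sub>M borel :: (real \<times> real) measure"
  have ZY: "(\<lambda>\<omega>. (Z \<omega>, Y \<omega>)) \<in> measurable (F t) ?B" using Z by measurable
  have ZYM [measurable]: "(\<lambda>\<omega>. (Z \<omega>, Y \<omega>)) \<in> measurable M ?B" by (rule F_measurable[OF ZY])
  have [measurable]: "W t \<in> borel_measurable M" "W (t + \<delta>) \<in> borel_measurable M"
    using F_measurable W_adapted t by (auto intro!: F_measurable W_adapted)
  note [measurable] = g
  note law = joint_law[OF t ZY]
  define f where "f p = fst (fst p) * g (snd (fst p) + \<sigma> * snd p)" for p :: "(real \<times> real) \<times> real"
  have f [measurable]: "f \<in> borel_measurable (?B \<Otimes>\<^sub>M borel)" unfolding f_def[abs_def] by measurable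
  interpret P: prob_space "distr M ?B (\<lambda>\<omega>. (Z \<omega>, Y \<omega>))" by (rule prob_space_distr) simp
  interpret G: prob_space "gauss \<delta>" by (rule prob_space_gauss[OF t(2)])
  interpret PG: pair_sigma_finite "distr M ?B (\<lambda>\<omega>. (Z \<omega>, Y \<omega>))" "gauss \<delta>" ..
  have eq: "Z \<omega> * g (Y \<omega> + \<sigma> * (W (t + \<delta>) \<omega> - W t \<omega>))
      = f ((Z \<omega>, Y \<omega>), W (t + \<delta>) \<omega> - W t \<omega>)" for \<omega> by (simp add: f_def)
  have "integrable (distr M (?B \<Otimes>\<^sub>M borel) (\<lambda>\<omega>. ((Z \<omega>, Y \<omega>), W (t + \<delta>) \<omega> - W t \<omega>))) f"
    using int by (subst integrable_distr_eq) (auto simp: eq)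
  then have intf: "integrable (distr M ?B (\<lambda>\<omega>. (Z \<omega>, Y \<omega>)) \<Otimes>\<^sub>M gauss \<delta>) f" unfolding law .
  have "expectation (\<lambda>\<omega>. Z \<omega> * g (Y \<omega> + \<sigma> * (W (t + \<delta>) \<omega> - W t \<omega>)))
      = integral\<^sup>L (distr M (?B \<Otimes>\<^sub>M borel) (\<lambda>\<omega>. ((Z \<omega>, Y \<omega>), W (t + \<delta>) \<omega> - W t \<omega>))) f"
    by (subst integral_distr) (auto simp: eq)
  also have "\<dots> = (\<integral>p. (\<integral>z. f (p, z) \<partial>gauss \<delta>) \<partial>distr M ?B (\<lambda>\<omega>. (Z \<omega>, Y \<omega>)))"
    unfolding law by (rule PG.integral_fst'[OF intf, symmetric])
  also have "\<dots> = expectation (\<lambda>\<omega>. \<integral>z. f ((Z \<omega>, Y \<omega>), z) \<partial>gauss \<delta>)"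
    by (subst integral_distr) auto
  finally show ?thesis by (simp add: f_def)
qed

lemma nn_expectation_step:
  assumes t: "0 \<le> t" "0 < \<delta>" and Y: "Y \<in> borel_measurable (F t)"
    and f [measurable]: "f \<in> borel_measurable borel"
  shows "(\<integral>\<^sup>+\<omega>. f (Y \<omega> + \<sigma> * (W (t + \<delta>) \<omega> - W t \<omega>)) \<partial>M)
    = (\<integral>\<^sup>+\<omega>. (\<integral>\<^sup>+z. f (Y \<omega> + \<sigma> * z) \<partial>gauss \<delta>) \<partial>M)"
proof -
  have [measurable]: "Y \<in> borel_measurable M" by (rule F_measurable[OF Y])
  have [measurable]: "W t \<in> borel_measurable M" "W (t + \<delta>) \<in> borel_measurable M"
    using t by (auto intro!: F_measurable W_adapted)
  interpret G: prob_space "gauss \<delta>" by (rule prob_space_gauss[OF t(2)])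
  have "(\<integral>\<^sup>+\<omega>. f (Y \<omega> + \<sigma> * (W (t + \<delta>) \<omega> - W t \<omega>)) \<partial>M)
      = (\<integral>\<^sup>+p. f (fst p + \<sigma> * snd p) \<partial>distr M (borel \<Otimes>\<^sub>M borel) (\<lambda>\<omega>. (Y \<omega>, W (t + \<delta>) \<omega> - W t \<omega>)))"
    by (subst nn_integral_distr) auto
  also have "\<dots> = (\<integral>\<^sup>+y. (\<integral>\<^sup>+z. f (y + \<sigma> * z) \<partial>gauss \<delta>) \<partial>distr M borel Y)"
    unfolding joint_law[OF t Y] by (subst G.nn_integral_fst[symmetric]) auto
  also have "\<dots> = (\<integral>\<^sup>+\<omega>. (\<integral>\<^sup>+z. f (Y \<omega> + \<sigma> * z) \<partial>gauss \<delta>) \<partial>M)"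
    by (subst nn_integral_distr) auto
  finally show ?thesis .
qed

primrec euler :: "real \<Rightarrow> nat \<Rightarrow> 'a \<Rightarrow> real" where
  "euler \<delta> 0 \<omega> = x0"
| "euler \<delta> (Suc j) \<omega> = step \<delta> (euler \<delta> j \<omega>) + \<sigma> * (W (real j * \<delta> + \<delta>) \<omega> - W (real j * \<delta>) \<omega>)"

lemma euler_adapted: "0 < \<delta> \<Longrightarrow> euler \<delta> j \<in> borel_measurable (F (real j * \<delta>))"
proof (induction j)
  case 0
  show ?case by (simp add: measurable_cong[of _ "euler \<delta> 0" "\<lambda>_. x0"])
next
  case (Suc j)
  let ?t = "real j * \<delta>" and ?u = "real (Suc j) * \<delta>"
  have u: "?u = ?t + \<delta>" by (simp add: algebra_simps)
  have [measurable]: "euler \<delta> j \<in> borel_measurable (F ?u)" "W ?t \<in> borel_measurable (F ?u)"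
    "W ?u \<in> borel_measurable (F ?u)"
    using Suc.prems F_mono[OF Suc.IH, of ?u] F_mono[OF W_adapted[of ?t], of ?u] W_adapted[of ?u]
    by (simp_all add: u)
  have "(\<lambda>\<omega>. step \<delta> (euler \<delta> j \<omega>) + \<sigma> * (W ?u \<omega> - W ?t \<omega>)) \<in> borel_measurable (F ?u)" by measurable
  moreover have "euler \<delta> (Suc j) = (\<lambda>\<omega>. step \<delta> (euler \<delta> j \<omega>) + \<sigma> * (W ?u \<omega> - W ?t \<omega>))"
    by (simp only: u fun_eq_iff euler.simps) simp
  ultimately show ?case by metis
qed

lemma euler_measurable [measurable]: "0 < \<delta> \<Longrightarrow> euler \<delta> j \<in> borel_measurable M"
  by (rule F_measurable[OF euler_adapted])

lemma euler_adapted_later: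
  "0 < \<delta> \<Longrightarrow> i \<le> j \<Longrightarrow> euler \<delta> i \<in> borel_measurable (F (real j * \<delta>))"
  by (rule F_mono[OF euler_adapted]) (auto intro: mult_right_mono)

text \<open>The number \<open>4\<close> is the fixed point of \<open>m \<mapsto> (1 - c \<delta> / 2) m + 2 c \<delta>\<close>, the recursion that bounds the mean
  weights of the chain; it is the same for all step sizes.\<close>

definition wt_bound :: "real \<Rightarrow> real" where
  "wt_bound k = wt k x0 + 4"

lemma wt_bound_ge: "5 \<le> wt_bound k"
  using wt_ge_1[of k x0] by (simp add: wt_bound_def)

lemma nn_wt_euler:
  assumes \<delta>: "0 < \<delta>" "C * \<delta> \<le> 1" and k: "0 \<le> k" "k \<le> 4"
  shows "(\<integral>\<^sup>+\<omega>. wt k (euler \<delta> j \<omega>) \<partial>M) \<le> wt_bound k"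
proof (induction j)
  case 0
  show ?case by (auto simp: emeasure_space_1 wt_bound_def intro!: ennreal_leI)
next
  case (Suc j)
  let ?t = "real j * \<delta>"
  have e: "0 < c * \<delta>" "c * \<delta> \<le> 1" using c_pos \<delta> c_step_le_1 by auto
  have meas: "(\<lambda>\<omega>. step \<delta> (euler \<delta> j \<omega>)) \<in> borel_measurable (F ?t)"
    by (rule measurable_compose[OF euler_adapted[OF \<delta>(1)] measurable_step])
  have "(\<integral>\<^sup>+\<omega>. wt k (euler \<delta> (Suc j) \<omega>) \<partial>M)
      = (\<integral>\<^sup>+\<omega>. (\<integral>\<^sup>+z. wt k (step \<delta> (euler \<delta> j \<omega>) + \<sigma> * z) \<partial>gauss \<delta>) \<partial>M)"
    using nn_expectation_step[OF _ \<delta>(1) meas, of "\<lambda>x. ennreal (wt k x)"] \<delta> by simp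
  also have "\<dots> = (\<integral>\<^sup>+\<omega>. Q \<delta> (wt k) (euler \<delta> j \<omega>) \<partial>M)"
    unfolding Q_def using wt_nonneg wt_integrable[OF \<delta>(1)]
    by (intro nn_integral_cong nn_integral_eq_integral) auto
  also have "\<dots> \<le> (\<integral>\<^sup>+\<omega>. ennreal (1 - c * \<delta> / 2) * wt k (euler \<delta> j \<omega>) + ennreal (2 * c * \<delta>) \<partial>M)"
  proof (intro nn_integral_mono)
    fix \<omega>
    have "ennreal (1 - c * \<delta> / 2) * wt k (euler \<delta> j \<omega>) + ennreal (2 * c * \<delta>)
        = ennreal ((1 - c * \<delta> / 2) * wt k (euler \<delta> j \<omega>) + 2 * c * \<delta>)"
      using e wt_nonneg c_pos \<delta> by (subst ennreal_plus) (auto simp: ennreal_mult)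
    then show "ennreal (Q \<delta> (wt k) (euler \<delta> j \<omega>))
        \<le> ennreal (1 - c * \<delta> / 2) * wt k (euler \<delta> j \<omega>) + ennreal (2 * c * \<delta>)"
      using Q_wt_le[OF \<delta> k] by (simp add: ennreal_leI)
  qed
  also have "\<dots> = ennreal (1 - c * \<delta> / 2) * (\<integral>\<^sup>+\<omega>. wt k (euler \<delta> j \<omega>) \<partial>M) + ennreal (2 * c * \<delta>)"
    using \<delta> by (subst nn_integral_add) (auto simp: nn_integral_cmult emeasure_space_1)
  also have "\<dots> \<le> ennreal (1 - c * \<delta> / 2) * ennreal (wt_bound k) + ennreal (2 * c * \<delta>)"
    using Suc by (intro add_mono mult_left_mono) auto
  also have "\<dots> = ennreal ((1 - c * \<delta> / 2) * wt_bound k + 2 * c * \<delta>)"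
    using e wt_bound_ge[of k] c_pos \<delta> by (subst ennreal_plus) (auto simp: ennreal_mult)
  also have "\<dots> \<le> wt_bound k"
  proof (intro ennreal_leI)
    have "(c * \<delta>) * 4 \<le> (c * \<delta>) * wt_bound k" using e wt_bound_ge[of k] by (intro mult_left_mono) auto
    then show "(1 - c * \<delta> / 2) * wt_bound k + 2 * c * \<delta> \<le> wt_bound k" by (simp add: algebra_simps)
  qed
  finally show ?case .
qed

lemma wt_euler:
  assumes \<delta>: "0 < \<delta>" "C * \<delta> \<le> 1" and k: "0 \<le> k" "k \<le> 4"
  shows "integrable M (\<lambda>\<omega>. wt k (euler \<delta> j \<omega>))"
    and "expectation (\<lambda>\<omega>. wt k (euler \<delta> j \<omega>)) \<le> wt_bound k"
proof -
  have nn: "(\<integral>\<^sup>+\<omega>. wt k (euler \<delta> j \<omega>) \<partial>M) \<le> wt_bound k" by (rule nn_wt_euler[OF assms])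
  show int: "integrable M (\<lambda>\<omega>. wt k (euler \<delta> j \<omega>))"
    using \<delta> nn wt_nonneg by (intro integrableI_nonneg) (auto simp: le_less_trans)
  have "ennreal (expectation (\<lambda>\<omega>. wt k (euler \<delta> j \<omega>))) \<le> ennreal (wt_bound k)"
    using nn nn_integral_eq_integral[OF int] wt_nonneg by simp
  then show "expectation (\<lambda>\<omega>. wt k (euler \<delta> j \<omega>)) \<le> wt_bound k"
    using wt_bound_ge[of k] by (simp add: ennreal_le_iff)
qed

lemma growth_euler_integrable:
  assumes \<delta>: "0 < \<delta>" "C * \<delta> \<le> 1" and k: "0 \<le> k" "k \<le> 4"
    and g [measurable]: "g \<in> borel_measurable borel" and B: "\<And>x. \<bar>g x\<bar> \<le> B * wt k x"
  shows "integrable M (\<lambda>\<omega>. g (euler \<delta> j \<omega>))"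
proof (rule Bochner_Integration.integrable_bound)
  show "integrable M (\<lambda>\<omega>. B * wt k (euler \<delta> j \<omega>))" using wt_euler(1)[OF \<delta> k] by simp
  show "(\<lambda>\<omega>. g (euler \<delta> j \<omega>)) \<in> borel_measurable M" using \<delta> by measurable
  show "AE \<omega> in M. norm (g (euler \<delta> j \<omega>)) \<le> norm (B * wt k (euler \<delta> j \<omega>))"
    by (auto intro!: always_eventually order_trans[OF B])
qed

lemma growth_mult_integrable:
  assumes \<delta>: "0 < \<delta>" "C * \<delta> \<le> 1"
    and f [measurable]: "f \<in> borel_measurable borel" and A: "\<And>x. \<bar>f x\<bar> \<le> A * wt 2 x"
    and g [measurable]: "g \<in> borel_measurable borel" and B: "\<And>x. \<bar>g x\<bar> \<le> B * wt 2 x"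
  shows "integrable M (\<lambda>\<omega>. f (euler \<delta> i \<omega>) * g (euler \<delta> j \<omega>))"
proof (rule Bochner_Integration.integrable_bound)
  show "integrable M (\<lambda>\<omega>. (A * B) * (wt 4 (euler \<delta> i \<omega>) + wt 4 (euler \<delta> j \<omega>)))"
    using wt_euler(1)[OF \<delta>, of 4] by simp
  show "(\<lambda>\<omega>. f (euler \<delta> i \<omega>) * g (euler \<delta> j \<omega>)) \<in> borel_measurable M" using \<delta> by measurable
  have AB: "0 \<le> A" "0 \<le> B" using A[of 0] B[of 0] by auto
  show "AE \<omega> in M. norm (f (euler \<delta> i \<omega>) * g (euler \<delta> j \<omega>))
      \<le> norm ((A * B) * (wt 4 (euler \<delta> i \<omega>) + wt 4 (euler \<delta> j \<omega>)))"
  proof (rule AE_I2)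
    fix \<omega>
    let ?x = "euler \<delta> i \<omega>" and ?y = "euler \<delta> j \<omega>"
    have "\<bar>f ?x\<bar> * \<bar>g ?y\<bar> \<le> (A * wt 2 ?x) * (B * wt 2 ?y)"
      using A B AB wt_nonneg by (intro mult_mono) auto
    also have "\<dots> = (A * B) * (wt 2 ?x * wt 2 ?y)" by simp
    also have "\<dots> \<le> (A * B) * (wt 4 ?x + wt 4 ?y)"
    proof (intro mult_left_mono)
      have "wt 2 ?x * wt 2 ?y \<le> (wt 2 ?x)\<^sup>2 + (wt 2 ?y)\<^sup>2"
      proof -
        have "0 \<le> (wt 2 ?x - wt 2 ?y)\<^sup>2" by simp
        then have "2 * (wt 2 ?x * wt 2 ?y) \<le> (wt 2 ?x)\<^sup>2 + (wt 2 ?y)\<^sup>2" by (simp add: power2_diff)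
        moreover have "0 \<le> wt 2 ?x * wt 2 ?y" using wt_nonneg by simp
        ultimately show ?thesis by linarith
      qed
      then show "wt 2 ?x * wt 2 ?y \<le> wt 4 ?x + wt 4 ?y"
        using wt_square_le[of 2 ?x] wt_square_le[of 2 ?y] by simp
    qed (use AB in auto)
    finally show "norm (f ?x * g ?y) \<le> norm ((A * B) * (wt 4 ?x + wt 4 ?y))"
      using AB wt_nonneg[of 4 ?x] wt_nonneg[of 4 ?y] by (simp add: abs_mult)
  qed
qed

text \<open>The latest noise is integrated out first, so the operators act on the test function \<open>g\<close> one by
  one while the earlier observable \<open>f\<close> is carried along.\<close>

lemma expectation_iterate:
  assumes \<delta>: "0 < \<delta>" "C * \<delta> \<le> 1"
    and f [measurable]: "f \<in> borel_measurable borel" and B: "\<And>x. \<bar>f x\<bar> \<le> B * wt 2 x"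
  shows "wlip A g \<Longrightarrow> expectation (\<lambda>\<omega>. f (euler \<delta> i \<omega>) * g (euler \<delta> (i + k) \<omega>))
    = expectation (\<lambda>\<omega>. f (euler \<delta> i \<omega>) * (Q \<delta> ^^ k) g (euler \<delta> i \<omega>))"
proof (induction k arbitrary: g A)
  case (Suc k)
  let ?t = "real (i + k) * \<delta>"
  have t: "0 \<le> ?t" using \<delta> by simp
  have m1: "(\<lambda>\<omega>. f (euler \<delta> i \<omega>)) \<in> borel_measurable (F ?t)"
    using euler_adapted_later[OF \<delta>(1), of i "i + k"] by measurable
  have m2: "(\<lambda>\<omega>. step \<delta> (euler \<delta> (i + k) \<omega>)) \<in> borel_measurable (F ?t)"
    using euler_adapted[OF \<delta>(1), of "i + k"] by measurable
  have "expectation (\<lambda>\<omega>. f (euler \<delta> i \<omega>) * g (euler \<delta> (i + Suc k) \<omega>))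
      = expectation (\<lambda>\<omega>. f (euler \<delta> i \<omega>) * Q \<delta> g (euler \<delta> (i + k) \<omega>))"
    unfolding Q_def
    using expectation_step[OF t \<delta>(1) m1 m2 wlip_measurable[OF Suc.prems]]
      growth_mult_integrable[OF \<delta> f B wlip_measurable[OF Suc.prems] wlip_growth[OF Suc.prems], of i "i + Suc k"]
    by simp
  also have "\<dots> = expectation (\<lambda>\<omega>. f (euler \<delta> i \<omega>) * (Q \<delta> ^^ k) (Q \<delta> g) (euler \<delta> i \<omega>))"
    by (rule Suc.IH[OF wlip_Q[OF \<delta> Suc.prems]])
  finally show ?case by (simp add: funpow_swap1)
qed simp

lemma expectation_euler_iterate:
  assumes \<delta>: "0 < \<delta>" "C * \<delta> \<le> 1" and g: "wlip A g"
  shows "expectation (\<lambda>\<omega>. g (euler \<delta> (i + k) \<omega>)) = expectation (\<lambda>\<omega>. (Q \<delta> ^^ k) g (euler \<delta> i \<omega>))"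
  using expectation_iterate[OF \<delta>, of "\<lambda>_. 1" 1 A g i k] g wt_ge_1 by simp

lemma wlip_euler_integrable:
  assumes \<delta>: "0 < \<delta>" "C * \<delta> \<le> 1" and g: "wlip A g"
  shows "integrable M (\<lambda>\<omega>. g (euler \<delta> j \<omega>))"
  using growth_euler_integrable[OF \<delta> _ _ wlip_measurable[OF g] wlip_growth[OF g]] by simp

text \<open>Both means are values of \<open>(Q \<delta> ^^ i) g\<close>, averaged over the law at time \<open>l\<close> and taken at \<open>x0\<close>
  respectively, and this function varies little because its constant has shrunk to
  \<open>A (1 - c \<delta> / 2) ^ i\<close>.\<close>

lemma expectation_shift:
  assumes \<delta>: "0 < \<delta>" "C * \<delta> \<le> 1" and g: "wlip A g"
  shows "\<bar>expectation (\<lambda>\<omega>. g (euler \<delta> (l + i) \<omega>)) - expectation (\<lambda>\<omega>. g (euler \<delta> i \<omega>))\<bar>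
    \<le> A * (1 - c * \<delta> / 2) ^ i * (20 / scale * wt_bound 2)"
proof -
  define r where "r = (1 - c * \<delta> / 2) ^ i"
  define u where "u = (Q \<delta> ^^ i) g"
  have u: "wlip (A * r) u" unfolding u_def r_def by (rule wlip_Q_iterate[OF \<delta> g])
  have Ar: "0 \<le> A * r" by (rule wlip_nonneg[OF u])
  have "expectation (\<lambda>\<omega>. g (euler \<delta> i \<omega>)) = u x0"
    using expectation_euler_iterate[OF \<delta> g, of 0 i] by (simp add: u_def prob_space)
  then have "\<bar>expectation (\<lambda>\<omega>. g (euler \<delta> (l + i) \<omega>)) - expectation (\<lambda>\<omega>. g (euler \<delta> i \<omega>))\<bar>
      = \<bar>expectation (\<lambda>\<omega>. u (euler \<delta> l \<omega>) - u x0)\<bar>"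
    using expectation_euler_iterate[OF \<delta> g, of l i] wlip_euler_integrable[OF \<delta> u]
    by (simp add: u_def prob_space)
  also have "\<dots> \<le> expectation (\<lambda>\<omega>. \<bar>u (euler \<delta> l \<omega>) - u x0\<bar>)" by (rule integral_abs_bound)
  also have "\<dots> \<le> expectation (\<lambda>\<omega>. (A * r) * (10 / scale * (wt 2 (euler \<delta> l \<omega>) + wt 2 x0)))"
  proof (rule integral_mono)
    show "integrable M (\<lambda>\<omega>. \<bar>u (euler \<delta> l \<omega>) - u x0\<bar>)" using wlip_euler_integrable[OF \<delta> u] by auto
    show "integrable M (\<lambda>\<omega>. (A * r) * (10 / scale * (wt 2 (euler \<delta> l \<omega>) + wt 2 x0)))"
      using wt_euler(1)[OF \<delta>, of 2] by auto
    fix \<omega>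
    show "\<bar>u (euler \<delta> l \<omega>) - u x0\<bar> \<le> (A * r) * (10 / scale * (wt 2 (euler \<delta> l \<omega>) + wt 2 x0))"
      using wlipD[OF u, of "euler \<delta> l \<omega>" x0] mult_left_mono[OF wdist_le[of "euler \<delta> l \<omega>" x0] Ar] by linarith
  qed
  also have "\<dots> = (A * r) * (10 / scale * (expectation (\<lambda>\<omega>. wt 2 (euler \<delta> l \<omega>)) + wt 2 x0))"
    using wt_euler(1)[OF \<delta>, of 2] by (simp add: prob_space)
  also have "\<dots> \<le> (A * r) * (10 / scale * (2 * wt_bound 2))"
    using wt_euler(2)[OF \<delta>, of 2 l] Ar scale_pos
    by (intro mult_left_mono) (auto simp: wt_bound_def)
  finally show ?thesis by (simp add: r_def)
qed

definition cov_const :: "real \<Rightarrow> real \<Rightarrow> real" where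
  "cov_const A B = B * (1 + wt_bound 2) * A * (20 / scale) * wt_bound 4"

text \<open>The covariance is the mean of \<open>g (Y i) - \<mu> i\<close> times \<open>(Q \<delta> ^^ k) g (Y i)\<close>.  Since the first factor has mean
  \<open>0\<close>, the value of the second at \<open>0\<close> may be subtracted, and what remains is of the order of the
  contracted constant.\<close>

lemma covariance_decay:
  assumes \<delta>: "0 < \<delta>" "C * \<delta> \<le> 1" and g: "wlip A g" and B: "\<And>x. \<bar>g x\<bar> \<le> B * wt 2 x"
    and \<mu>: "\<And>j. \<mu> j = expectation (\<lambda>\<omega>. g (euler \<delta> j \<omega>))"
  shows "integrable M (\<lambda>\<omega>. (g (euler \<delta> i \<omega>) - \<mu> i) * (g (euler \<delta> j \<omega>) - \<mu> j))"
    and "expectation (\<lambda>\<omega>. (g (euler \<delta> i \<omega>) - \<mu> i) * (g (euler \<delta> (i + k) \<omega>) - \<mu> (i + k)))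
      \<le> cov_const A B * (1 - c * \<delta> / 2) ^ k"
proof -
  note gm [measurable] = wlip_measurable[OF g]
  note gi = wlip_euler_integrable[OF \<delta> g]
  have B0: "0 \<le> B" using B[of 0] by simp
  have \<mu>_bound: "\<bar>\<mu> j\<bar> \<le> B * wt_bound 2" for j
  proof -
    have "\<bar>\<mu> j\<bar> \<le> expectation (\<lambda>\<omega>. \<bar>g (euler \<delta> j \<omega>)\<bar>)" unfolding \<mu> by (rule integral_abs_bound)
    also have "\<dots> \<le> expectation (\<lambda>\<omega>. B * wt 2 (euler \<delta> j \<omega>))"
      using gi wt_euler(1)[OF \<delta>, of 2] B by (intro integral_mono) auto
    also have "\<dots> \<le> B * wt_bound 2"
      using wt_euler[OF \<delta>, of 2 j] B0 by (auto intro!: mult_left_mono)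
    finally show ?thesis .
  qed
  have fb: "\<bar>g x - \<mu> j\<bar> \<le> (B * (1 + wt_bound 2)) * wt 2 x" for x j
  proof -
    have "B * wt_bound 2 * 1 \<le> B * wt_bound 2 * wt 2 x"
      using B0 wt_bound_ge[of 2] wt_ge_1[of 2 x] by (intro mult_left_mono) auto
    then show ?thesis using B[of x] \<mu>_bound[of j] by (simp add: algebra_simps)
  qed
  have fm: "(\<lambda>x. g x - \<mu> j) \<in> borel_measurable borel" for j by measurable
  show "integrable M (\<lambda>\<omega>. (g (euler \<delta> i \<omega>) - \<mu> i) * (g (euler \<delta> j \<omega>) - \<mu> j))"
    by (rule growth_mult_integrable[OF \<delta> fm fb fm fb])
  define r where "r = (1 - c * \<delta> / 2) ^ k"
  define u where "u = (Q \<delta> ^^ k) g"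
  have u: "wlip (A * r) u" unfolding u_def r_def by (rule wlip_Q_iterate[OF \<delta> g])
  have Ar: "0 \<le> A * r" by (rule wlip_nonneg[OF u])
  note um [measurable] = wlip_measurable[OF u]
  have mean0: "expectation (\<lambda>\<omega>. g (euler \<delta> i \<omega>) - \<mu> i) = 0"
    using gi by (simp add: \<mu> prob_space)
  have i1: "integrable M (\<lambda>\<omega>. (g (euler \<delta> i \<omega>) - \<mu> i) * g (euler \<delta> (i + k) \<omega>))"
    by (rule growth_mult_integrable[OF \<delta> fm fb gm B])
  have i2: "integrable M (\<lambda>\<omega>. (g (euler \<delta> i \<omega>) - \<mu> i) * u (euler \<delta> i \<omega>))"
    by (rule growth_mult_integrable[OF \<delta> fm fb um wlip_growth[OF u]])
  have "expectation (\<lambda>\<omega>. (g (euler \<delta> i \<omega>) - \<mu> i) * (g (euler \<delta> (i + k) \<omega>) - \<mu> (i + k)))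
      = expectation (\<lambda>\<omega>. (g (euler \<delta> i \<omega>) - \<mu> i) * g (euler \<delta> (i + k) \<omega>) - (g (euler \<delta> i \<omega>) - \<mu> i) * \<mu> (i + k))"
    by (simp add: algebra_simps)
  also have "\<dots> = expectation (\<lambda>\<omega>. (g (euler \<delta> i \<omega>) - \<mu> i) * g (euler \<delta> (i + k) \<omega>))"
    using i1 gi mean0 by (subst Bochner_Integration.integral_diff) auto
  also have "\<dots> = expectation (\<lambda>\<omega>. (g (euler \<delta> i \<omega>) - \<mu> i) * u (euler \<delta> i \<omega>))"
    unfolding u_def by (rule expectation_iterate[OF \<delta> fm fb g])
  also have "\<dots> = expectation (\<lambda>\<omega>. (g (euler \<delta> i \<omega>) - \<mu> i) * u (euler \<delta> i \<omega>) - (g (euler \<delta> i \<omega>) - \<mu> i) * u 0)"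
    using i2 gi mean0 by (subst Bochner_Integration.integral_diff) auto
  also have "\<dots> \<le> expectation (\<lambda>\<omega>. (B * (1 + wt_bound 2) * (A * r) * (20 / scale)) * wt 4 (euler \<delta> i \<omega>))"
  proof (rule integral_mono)
    show "integrable M (\<lambda>\<omega>. (g (euler \<delta> i \<omega>) - \<mu> i) * u (euler \<delta> i \<omega>) - (g (euler \<delta> i \<omega>) - \<mu> i) * u 0)"
      using i2 gi by auto
    show "integrable M (\<lambda>\<omega>. (B * (1 + wt_bound 2) * (A * r) * (20 / scale)) * wt 4 (euler \<delta> i \<omega>))"
      using wt_euler(1)[OF \<delta>, of 4] by simp
    fix \<omega>
    let ?x = "euler \<delta> i \<omega>"
    have "(g ?x - \<mu> i) * u ?x - (g ?x - \<mu> i) * u 0 \<le> \<bar>g ?x - \<mu> i\<bar> * \<bar>u ?x - u 0\<bar>"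
      by (simp flip: abs_mult right_diff_distrib)
    also have "\<dots> \<le> ((B * (1 + wt_bound 2)) * wt 2 ?x) * ((A * r) * (20 / scale * wt 2 ?x))"
    proof (intro mult_mono fb)
      show "\<bar>u ?x - u 0\<bar> \<le> (A * r) * (20 / scale * wt 2 ?x)"
        using wlipD[OF u, of ?x 0] mult_left_mono[OF wdist_0_le[of ?x] Ar] by linarith
      show "0 \<le> B * (1 + wt_bound 2) * wt 2 ?x"
        using order_trans[OF abs_ge_zero fb[of ?x i]] .
    qed simp
    also have "\<dots> = (B * (1 + wt_bound 2) * (A * r) * (20 / scale)) * (wt 2 ?x)\<^sup>2"
      by (simp add: power2_eq_square)
    also have "\<dots> \<le> (B * (1 + wt_bound 2) * (A * r) * (20 / scale)) * wt 4 ?x"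
      using wt_square_le[of 2 ?x] B0 Ar scale_pos wt_bound_ge[of 2] by (intro mult_left_mono) auto
    finally show "(g ?x - \<mu> i) * u ?x - (g ?x - \<mu> i) * u 0
        \<le> (B * (1 + wt_bound 2) * (A * r) * (20 / scale)) * wt 4 ?x" .
  qed
  also have "\<dots> \<le> (B * (1 + wt_bound 2) * (A * r) * (20 / scale)) * wt_bound 4"
  proof -
    have "0 \<le> B * (1 + wt_bound 2) * (A * r) * (20 / scale)"
      using B0 Ar scale_pos wt_bound_ge[of 2] by simp
    from mult_left_mono[OF wt_euler(2)[OF \<delta>, of 4 i] this] show ?thesis by simp
  qed
  finally show "expectation (\<lambda>\<omega>. (g (euler \<delta> i \<omega>) - \<mu> i) * (g (euler \<delta> (i + k) \<omega>) - \<mu> (i + k)))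
      \<le> cov_const A B * (1 - c * \<delta> / 2) ^ k"
    by (simp only: r_def cov_const_def mult_ac)
qed

text \<open>Telescoping the Poisson equation over \<open>J\<close> steps shows that the time averages of the means
  vanish up to \<open>sqrt \<delta>\<close>; the forgetting estimate then turns averages over the future of step \<open>i\<close> into
  the mean at step \<open>i\<close> itself.\<close>

lemma centred_mean_decay:
  assumes B: "\<And>x. (B has_real_derivative 2 * b x / \<sigma>\<^sup>2) (at x)"
    and v: "\<And>x y. \<bar>v x - v y\<bar> \<le> A * \<bar>x - y\<bar>" "\<And>x. R \<le> \<bar>x\<bar> \<Longrightarrow> v x = 0"
    and R: "0 < R" and v0: "(LINT x|lborel. v x * exp (B x)) = 0"
  shows "\<exists>D\<ge>0. \<forall>\<delta> i. 0 < \<delta> \<longrightarrow> \<delta> \<le> 1 \<longrightarrow> C * \<delta> \<le> 1 \<longrightarrow>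
    \<bar>expectation (\<lambda>\<omega>. v (euler \<delta> i \<omega>))\<bar> \<le> D * sqrt \<delta> + D * (1 - c * \<delta> / 2) ^ i"
proof -
  obtain \<phi> \<psi> \<xi> L K U where
    d: "\<And>x. (\<phi> has_real_derivative \<psi> x) (at x)" "\<And>x. (\<psi> has_real_derivative \<xi> x) (at x)"
    and L: "\<And>x y. \<bar>\<xi> x - \<xi> y\<bar> \<le> L * \<bar>x - y\<bar>" and K: "\<And>x. \<bar>\<xi> x\<bar> \<le> K" and U: "\<And>x. \<bar>\<phi> x\<bar> \<le> U"
    and eq: "\<And>x. b x * \<psi> x + \<sigma>\<^sup>2 / 2 * \<xi> x = v x"
    using Poisson_equation[OF B v R v0] by blast
  obtain D0 where D0: "0 \<le> D0" and gen: "\<And>\<delta> x. 0 < \<delta> \<Longrightarrow> \<delta> \<le> 1 \<Longrightarrow>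
    \<bar>Q \<delta> \<phi> x - \<phi> x - \<delta> * v x\<bar> \<le> D0 * (\<delta> * sqrt \<delta>) * wt 4 x"
    by (rule generator_estimate[OF d L K U, unfolded eq]) blast
  have A0: "0 \<le> A" using v(1)[of 1 0] by simp
  have vw: "wlip A v" by (rule wlip_Lipschitz[OF v(1) A0])
  have \<phi>m [measurable]: "\<phi> \<in> borel_measurable borel"
    by (intro borel_measurable_continuous_onI continuous_at_imp_continuous_on ballI DERIV_isCont[OF d(1)])
  define D where "D = D0 * wt_bound 4 + A * (20 / scale * wt_bound 2)"
  have D: "0 \<le> D" using D0 A0 scale_pos wt_bound_ge[of 2] wt_bound_ge[of 4] by (simp add: D_def)
  have "\<bar>expectation (\<lambda>\<omega>. v (euler \<delta> i \<omega>))\<bar> \<le> D * sqrt \<delta> + D * (1 - c * \<delta> / 2) ^ i"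
    if \<delta>: "0 < \<delta>" "\<delta> \<le> 1" "C * \<delta> \<le> 1" for \<delta> i
  proof -
    define E where "E j = expectation (\<lambda>\<omega>. v (euler \<delta> j \<omega>))" for j
    define P where "P j = expectation (\<lambda>\<omega>. \<phi> (euler \<delta> j \<omega>))" for j
    define r where "r = (1 - c * \<delta> / 2) ^ i"
    have r: "0 \<le> r" using c_step_le_1[OF \<delta>(1,3)] by (simp add: r_def)
    note vi = wlip_euler_integrable[OF \<delta>(1,3) vw]
    have \<phi>i: "integrable M (\<lambda>\<omega>. \<phi> (euler \<delta> j \<omega>))" for j
      by (rule integrable_const_bound[of _ U]) (use \<delta> U in auto)
    have PU: "\<bar>P j\<bar> \<le> U" for j
      unfolding P_def by (rule abs_expectation_le[OF \<phi>i U])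
    have stepP: "\<bar>P (Suc j) - P j - \<delta> * E j\<bar> \<le> D0 * (\<delta> * sqrt \<delta>) * wt_bound 4" for j
    proof -
      have PQ: "P (Suc j) = expectation (\<lambda>\<omega>. Q \<delta> \<phi> (euler \<delta> j \<omega>))"
      proof -
        have m: "(\<lambda>\<omega>. step \<delta> (euler \<delta> j \<omega>)) \<in> borel_measurable (F (real j * \<delta>))"
          using euler_adapted[OF \<delta>(1), of j] by measurable
        show ?thesis
          unfolding P_def Q_def
          using expectation_step[of "real j * \<delta>" \<delta> "\<lambda>_. 1", OF _ \<delta>(1) _ m \<phi>m] \<phi>i[of "Suc j"] \<delta> by simp
      qed
      have Qi: "integrable M (\<lambda>\<omega>. Q \<delta> \<phi> (euler \<delta> j \<omega>))"
      proof (rule integrable_const_bound[of _ U])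
        interpret G: prob_space "gauss \<delta>" by (rule prob_space_gauss[OF \<delta>(1)])
        have "\<bar>Q \<delta> \<phi> x\<bar> \<le> U" for x
        proof -
          have "integrable (gauss \<delta>) (\<lambda>z. \<phi> (step \<delta> x + \<sigma> * z))"
            by (rule G.integrable_const_bound[of _ U]) (use U in auto)
          then show ?thesis unfolding Q_def by (rule G.abs_expectation_le[OF _ U])
        qed
        then show "AE \<omega> in M. norm (Q \<delta> \<phi> (euler \<delta> j \<omega>)) \<le> U" by simp
        have "(\<lambda>x. Q \<delta> \<phi> x) \<in> borel_measurable borel" unfolding Q_def by measurable
        then show "(\<lambda>\<omega>. Q \<delta> \<phi> (euler \<delta> j \<omega>)) \<in> borel_measurable M" using \<delta> by measurable
      qed
      have "\<bar>P (Suc j) - P j - \<delta> * E j\<bar>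
          = \<bar>expectation (\<lambda>\<omega>. Q \<delta> \<phi> (euler \<delta> j \<omega>) - \<phi> (euler \<delta> j \<omega>) - \<delta> * v (euler \<delta> j \<omega>))\<bar>"
        unfolding PQ using Qi \<phi>i vi by (simp add: P_def E_def)
      also have "\<dots> \<le> expectation (\<lambda>\<omega>. \<bar>Q \<delta> \<phi> (euler \<delta> j \<omega>) - \<phi> (euler \<delta> j \<omega>) - \<delta> * v (euler \<delta> j \<omega>)\<bar>)"
        by (rule integral_abs_bound)
      also have "\<dots> \<le> expectation (\<lambda>\<omega>. D0 * (\<delta> * sqrt \<delta>) * wt 4 (euler \<delta> j \<omega>))"
        using Qi \<phi>i vi wt_euler(1)[OF \<delta>(1,3), of 4] gen[OF \<delta>(1,2)] by (intro integral_mono) auto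
      also have "\<dots> \<le> D0 * (\<delta> * sqrt \<delta>) * wt_bound 4"
        using wt_euler[OF \<delta>(1,3), of 4 j] D0 \<delta> by (auto intro!: mult_left_mono)
      finally show ?thesis .
    qed
    have shift: "\<bar>E (j + i) - E i\<bar> \<le> A * r * (20 / scale * wt_bound 2)" for j
      unfolding E_def r_def by (rule expectation_shift[OF \<delta>(1,3) vw])
    have tele: "\<bar>P (J + i) - P i - \<delta> * J * E i\<bar>
        \<le> J * (D0 * (\<delta> * sqrt \<delta>) * wt_bound 4 + \<delta> * (A * r * (20 / scale * wt_bound 2)))" for J :: nat
    proof (induction J)
      case (Suc J)
      have "\<bar>\<delta> * (E (J + i) - E i)\<bar> \<le> \<delta> * (A * r * (20 / scale * wt_bound 2))"
        using mult_left_mono[OF shift[of J], of \<delta>] \<delta> by (simp add: abs_mult)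
      then show ?case using Suc stepP[of "J + i"] by (simp add: algebra_simps add_divide_distrib)
    qed simp
    \<comment> \<open>Dividing by \<open>\<delta> J\<close> and letting \<open>J\<close> tend to infinity removes the bounded telescoped term.\<close>
    define q where "q = D0 * wt_bound 4 * sqrt \<delta> + A * r * (20 / scale * wt_bound 2)"
    have "\<bar>E i\<bar> \<le> q + (2 * U / \<delta>) / real (Suc J)" for J
    proof -
      define n where "n = real (Suc J)"
      have n: "0 < n" by (simp add: n_def)
      have "\<delta> * n * \<bar>E i\<bar> = \<bar>\<delta> * n * E i\<bar>" using \<delta> n by (simp add: abs_mult)
      also have "\<dots> \<le> 2 * U + n * (D0 * (\<delta> * sqrt \<delta>) * wt_bound 4 + \<delta> * (A * r * (20 / scale * wt_bound 2)))"
        using tele[of "Suc J"] PU[of "Suc J + i"] PU[of i] unfolding n_def by linarith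
      also have "\<dots> = \<delta> * n * (q + (2 * U / \<delta>) / n)"
        using \<delta> n by (simp add: q_def distrib_left)
      finally show ?thesis using \<delta> n unfolding n_def[symmetric] by (subst (asm) mult_le_cancel_left_pos) auto
    qed
    moreover have "(\<lambda>J. q + (2 * U / \<delta>) / real (Suc J)) \<longlonglongrightarrow> q + 0"
      by (intro tendsto_intros LIMSEQ_Suc[OF lim_const_over_n])
    ultimately have "\<bar>E i\<bar> \<le> q" by (intro LIMSEQ_le_const[of _ q]) auto
    also have "\<dots> \<le> D * sqrt \<delta> + D * r"
      unfolding q_def
    proof (intro add_mono)
      show "D0 * wt_bound 4 * sqrt \<delta> \<le> D * sqrt \<delta>"
        using A0 scale_pos wt_bound_ge[of 2] \<delta> by (intro mult_right_mono) (auto simp: D_def)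
      have "A * (20 / scale * wt_bound 2) * r \<le> D * r"
        using D0 wt_bound_ge[of 4] r by (intro mult_right_mono) (auto simp: D_def)
      then show "A * r * (20 / scale * wt_bound 2) \<le> D * r" by (simp add: mult_ac)
    qed
    finally show ?thesis by (simp add: E_def r_def)
  qed
  then show ?thesis using D by blast
qed

end

section \<open>Convergence of the Euler chain to the solution\<close>

context driven_chain
begin

text \<open>This is a statement about a single path.  Since the noise is additive, the error of the scheme only collects the oscillation of the drift
  along the path over one step, and the contraction of \<^const>\<open>step\<close> keeps it from accumulating.\<close>

lemma euler_path_convergence:
  assumes cont: "continuous_on {0..} x" and x0: "x 0 = x0"
    and eq: "\<And>t. 0 \<le> t \<Longrightarrow> set_integrable lborel {0..t} (\<lambda>s. b (x s)) \<and>
      x t = x 0 + (LINT s:{0..t}|lborel. b (x s)) + \<sigma> * (W t \<omega> - W 0 \<omega>)"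
    and h: "0 < h"
  shows "(\<lambda>m. euler (h / real (Suc m)) (k * Suc m) \<omega>) \<longlonglongrightarrow> x (real k * h)"
proof -
  have cb: "continuous_on {s..t} (\<lambda>u. b (x u))" if "0 \<le> s" for s t
    by (rule continuous_on_compose2[OF continuous_b[of UNIV] continuous_on_subset[OF cont]]) (use that in auto)
  have incr: "x (t + \<delta>) = x t + integral {t..t+\<delta>} (\<lambda>u. b (x u)) + \<sigma> * (W (t + \<delta>) \<omega> - W t \<omega>)"
    if t: "0 \<le> t" "0 < \<delta>" for t \<delta>
  proof -
    have "integral {0..t} (\<lambda>u. b (x u)) + integral {t..t+\<delta>} (\<lambda>u. b (x u)) = integral {0..t+\<delta>} (\<lambda>u. b (x u))"
      using t by (intro Henstock_Kurzweil_Integration.integral_combine integrable_continuous_real cb) auto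
    moreover have "(LINT s:{0..u}|lborel. b (x s)) = integral {0..u} (\<lambda>u. b (x u))" if "0 \<le> u" for u
      using eq[OF that] by (intro set_borel_integral_eq_integral) simp
    ultimately show ?thesis using eq[of t] eq[of "t + \<delta>"] t by (simp add: algebra_simps)
  qed
  have euler_error: "\<bar>x (real j * \<delta>) - euler \<delta> j \<omega>\<bar> \<le> C * e / c"
    if \<delta>: "0 < \<delta>" "C * \<delta> \<le> 1" and j: "real j * \<delta> \<le> T" and e: "0 \<le> e"
      and osc: "\<And>s t. 0 \<le> s \<Longrightarrow> s \<le> t \<Longrightarrow> t \<le> T \<Longrightarrow> t \<le> s + \<delta> \<Longrightarrow> \<bar>x t - x s\<bar> \<le> e"
    for \<delta> j T e
    using j
  proof (induction j)
    case 0
    show ?case using x0 e C_pos c_pos by simp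
  next
    case (Suc j)
    define t where "t = real j * \<delta>"
    have t: "0 \<le> t" "t + \<delta> \<le> T" "real (Suc j) * \<delta> = t + \<delta>"
      using \<delta> Suc.prems by (auto simp: t_def algebra_simps)
    have IH: "\<bar>x t - euler \<delta> j \<omega>\<bar> \<le> C * e / c"
      unfolding t_def using Suc.IH t \<delta> by (simp add: t_def)
    define I where "I = integral {t..t+\<delta>} (\<lambda>u. b (x u)) - \<delta> * b (x t)"
    have "I = integral {t..t+\<delta>} (\<lambda>u. b (x u) - b (x t))"
      unfolding I_def using \<delta> t
      by (subst Henstock_Kurzweil_Integration.integral_diff) (auto intro!: integrable_continuous_real cb)
    moreover have "norm (integral {t..t+\<delta>} (\<lambda>u. b (x u) - b (x t))) \<le> C * e * (t + \<delta> - t)"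
    proof (rule integral_bound)
      show "continuous_on {t..t+\<delta>} (\<lambda>u. b (x u) - b (x t))" using t by (intro continuous_intros cb)
      fix u assume u: "u \<in> {t..t+\<delta>}"
      have "\<bar>b (x u) - b (x t)\<bar> \<le> C * \<bar>x u - x t\<bar>" by (rule b_Lipschitz)
      also have "\<dots> \<le> C * e" using osc[of t u] u t C_pos by (intro mult_left_mono) auto
      finally show "norm (b (x u) - b (x t)) \<le> C * e" by simp
    qed (use \<delta> in auto)
    ultimately have I: "\<bar>I\<bar> \<le> C * e * \<delta>" by simp
    have "x (t + \<delta>) - euler \<delta> (Suc j) \<omega> = (step \<delta> (x t) - step \<delta> (euler \<delta> j \<omega>)) + I"
      using incr[OF t(1) \<delta>(1)] by (simp add: step_def I_def t_def[symmetric])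
    then have "\<bar>x (t + \<delta>) - euler \<delta> (Suc j) \<omega>\<bar> \<le> (1 - c * \<delta>) * \<bar>x t - euler \<delta> j \<omega>\<bar> + C * e * \<delta>"
      using step_contraction[OF \<delta>, of "x t" "euler \<delta> j \<omega>"] I by linarith
    also have "\<dots> \<le> (1 - c * \<delta>) * (C * e / c) + C * e * \<delta>"
      using IH c_step_le_1[OF \<delta>] by (intro add_right_mono mult_left_mono) auto
    also have "\<dots> = C * e / c" using c_pos by (simp add: field_simps)
    finally show ?case unfolding t(3) .
  qed
  show ?thesis
  proof (rule LIMSEQ_I)
    fix r :: real assume r: "0 < r"
    define T where "T = real k * h"
    define e where "e = r * c / (2 * C)"
    have e: "0 < e" using r c_pos C_pos by (simp add: e_def)
    have "uniformly_continuous_on {0..T} x"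
      by (intro compact_uniformly_continuous continuous_on_subset[OF cont]) auto
    then obtain d where d: "0 < d" "\<And>s t. s \<in> {0..T} \<Longrightarrow> t \<in> {0..T} \<Longrightarrow> dist s t < d \<Longrightarrow> dist (x s) (x t) < e"
      unfolding uniformly_continuous_on_def using e by metis
    have "(\<lambda>m. h / real (Suc m)) \<longlonglongrightarrow> 0" by (intro LIMSEQ_Suc[OF lim_const_over_n])
    moreover have "0 < min d (1 / C)" using d C_pos by simp
    ultimately have "eventually (\<lambda>m. h / real (Suc m) < min d (1 / C)) sequentially"
      by (rule order_tendstoD)
    then obtain m0 where m0: "\<And>m. m0 \<le> m \<Longrightarrow> h / real (Suc m) < min d (1 / C)"
      unfolding eventually_sequentially by blast
    show "\<exists>m0. \<forall>m\<ge>m0. norm (euler (h / real (Suc m)) (k * Suc m) \<omega> - x (real k * h)) < r"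
    proof (intro exI[of _ m0] allI impI)
      fix m assume "m0 \<le> m"
      define \<delta> where "\<delta> = h / real (Suc m)"
      have \<delta>: "0 < \<delta>" "\<delta> < d" "C * \<delta> \<le> 1"
        using m0[OF \<open>m0 \<le> m\<close>] h C_pos
        by (auto simp: \<delta>_def field_simps simp del: of_nat_Suc)
      have \<delta>T: "real (k * Suc m) * \<delta> = T"
        unfolding \<delta>_def T_def of_nat_mult by (simp del: of_nat_Suc)
      have "\<bar>x (real (k * Suc m) * \<delta>) - euler \<delta> (k * Suc m) \<omega>\<bar> \<le> C * e / c"
      proof (rule euler_error)
        fix s t assume "0 \<le> s" "s \<le> t" "t \<le> T" "t \<le> s + \<delta>"
        then show "\<bar>x t - x s\<bar> \<le> e" using d(2)[of t s] \<delta> by (auto simp: dist_real_def)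
      qed (use \<delta> \<delta>T e in auto)
      also have "C * e / c = r / 2" using C_pos c_pos by (simp add: e_def)
      finally show "norm (euler (h / real (Suc m)) (k * Suc m) \<omega> - x (real k * h)) < r"
        unfolding \<delta>T using r by (simp add: \<delta>_def T_def abs_minus_commute)
    qed
  qed
qed

end

section \<open>A strong law from exponentially decaying covariances\<close>

text \<open>Adding one more variable increases the second moment by at most twice a geometric series, so the
  growth is linear.\<close>

lemma (in prob_space) sum_square_le:
  fixes \<xi> :: "nat \<Rightarrow> 'a \<Rightarrow> real"
  assumes int: "\<And>i j. integrable M (\<lambda>\<omega>. \<xi> i \<omega> * \<xi> j \<omega>)"
    and cov: "\<And>i k. expectation (\<lambda>\<omega>. \<xi> i \<omega> * \<xi> (i + k) \<omega>) \<le> D * q ^ k"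
    and D: "0 \<le> D" and q: "0 \<le> q" "q < 1"
  shows "integrable M (\<lambda>\<omega>. (\<Sum>k=1..N. \<xi> k \<omega>)\<^sup>2)"
    and "expectation (\<lambda>\<omega>. (\<Sum>k=1..N. \<xi> k \<omega>)\<^sup>2) \<le> 2 * D / (1 - q) * real N"
proof -
  have sq: "(\<Sum>k=1..n. \<xi> k \<omega>)\<^sup>2 = (\<Sum>i=1..n. \<Sum>j=1..n. \<xi> i \<omega> * \<xi> j \<omega>)" for n \<omega>
    by (simp add: power2_eq_square sum_product)
  show int2: "integrable M (\<lambda>\<omega>. (\<Sum>k=1..n. \<xi> k \<omega>)\<^sup>2)" for n
    unfolding sq by (intro Bochner_Integration.integrable_sum int)
  have geo: "(\<Sum>i=1..n. q ^ (Suc n - i)) + 1 \<le> 1 / (1 - q)" for n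
  proof (induction n)
    case 0
    show ?case using q by (simp add: field_simps)
  next
    case (Suc n)
    have "(\<Sum>i=1..n. q ^ (Suc (Suc n) - i)) = (\<Sum>i=1..n. q * q ^ (Suc n - i))"
      by (intro sum.cong refl) (simp add: Suc_diff_le flip: power_Suc)
    then have "(\<Sum>i=1..Suc n. q ^ (Suc (Suc n) - i)) + 1 = q * ((\<Sum>i=1..n. q ^ (Suc n - i)) + 1) + 1"
      by (simp add: sum_distrib_left algebra_simps)
    also have "\<dots> \<le> q * (1 / (1 - q)) + 1" using Suc q by (intro add_mono mult_left_mono) auto
    also have "\<dots> = 1 / (1 - q)" using q by (simp add: field_simps)
    finally show ?case .
  qed
  show "expectation (\<lambda>\<omega>. (\<Sum>k=1..N. \<xi> k \<omega>)\<^sup>2) \<le> 2 * D / (1 - q) * real N"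
  proof (induction N)
    case (Suc n)
    have eq: "(\<Sum>k=1..Suc n. \<xi> k \<omega>)\<^sup>2 = (\<Sum>k=1..n. \<xi> k \<omega>)\<^sup>2 + 2 * (\<Sum>i=1..n. \<xi> i \<omega> * \<xi> (Suc n) \<omega>)
        + \<xi> (Suc n) \<omega> * \<xi> (Suc n) \<omega>" for \<omega>
      by (simp add: power2_eq_square sum_distrib_right[symmetric] algebra_simps)
    have "expectation (\<lambda>\<omega>. \<xi> i \<omega> * \<xi> (Suc n) \<omega>) \<le> D * q ^ (Suc n - i)" if "i \<in> {1..n}" for i
      using cov[of i "Suc n - i"] that by simp
    then have "(\<Sum>i=1..n. expectation (\<lambda>\<omega>. \<xi> i \<omega> * \<xi> (Suc n) \<omega>)) \<le> D * (\<Sum>i=1..n. q ^ (Suc n - i))"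
      unfolding sum_distrib_left by (intro sum_mono)
    moreover have "expectation (\<lambda>\<omega>. (\<Sum>k=1..Suc n. \<xi> k \<omega>)\<^sup>2) = expectation (\<lambda>\<omega>. (\<Sum>k=1..n. \<xi> k \<omega>)\<^sup>2)
        + 2 * (\<Sum>i=1..n. expectation (\<lambda>\<omega>. \<xi> i \<omega> * \<xi> (Suc n) \<omega>)) + expectation (\<lambda>\<omega>. \<xi> (Suc n) \<omega> * \<xi> (Suc n) \<omega>)"
      unfolding eq using int int2 by simp
    ultimately have "expectation (\<lambda>\<omega>. (\<Sum>k=1..Suc n. \<xi> k \<omega>)\<^sup>2)
        \<le> 2 * D / (1 - q) * real n + 2 * (D * (\<Sum>i=1..n. q ^ (Suc n - i))) + D"
      using Suc cov[of "Suc n" 0] by simp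
    also have "\<dots> \<le> 2 * D / (1 - q) * real n + 2 * (D * ((\<Sum>i=1..n. q ^ (Suc n - i)) + 1))"
      using D by (simp add: algebra_simps)
    also have "\<dots> \<le> 2 * D / (1 - q) * real n + 2 * (D * (1 / (1 - q)))"
      using geo[of n] D by (intro add_left_mono mult_left_mono) auto
    also have "\<dots> = 2 * D / (1 - q) * real (Suc n)" by (simp add: algebra_simps add_divide_distrib)
    finally show ?case .
  qed simp
qed

text \<open>Consecutive squares have ratio tending to \<open>1\<close>, so monotone partial sums cannot escape between
  them.\<close>

lemma eventually_sum_le_from_squares:
  fixes a :: "nat \<Rightarrow> real"
  assumes nonneg: "\<And>k. 0 \<le> a k" and \<kappa>: "0 \<le> \<kappa>" "\<kappa> < \<kappa>'"
    and sq: "eventually (\<lambda>m. (\<Sum>k=1..m\<^sup>2. a k) \<le> \<kappa> * real (m\<^sup>2)) sequentially"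
  shows "eventually (\<lambda>N. (\<Sum>k=1..N. a k) \<le> \<kappa>' * real N) sequentially"
proof -
  obtain m0 where m0: "\<And>m. m0 \<le> m \<Longrightarrow> (\<Sum>k=1..m\<^sup>2. a k) \<le> \<kappa> * real (m\<^sup>2)"
    using sq unfolding eventually_sequentially by blast
  obtain m1 :: nat where m1: "3 * \<kappa> / (\<kappa>' - \<kappa>) \<le> real m1" using real_arch_simple by blast
  have "(\<Sum>k=1..N. a k) \<le> \<kappa>' * real N" if N: "(Suc m0 + m1)\<^sup>2 \<le> N" for N
  proof -
    define m where "m = nat \<lfloor>sqrt (real N)\<rfloor>"
    have m: "real m \<le> sqrt N" "sqrt N < real m + 1"
      unfolding m_def by (simp_all add: of_nat_nat)
    have "(real m)\<^sup>2 \<le> (sqrt N)\<^sup>2" using m(1) by (intro power_mono) auto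
    then have mN: "(real m)\<^sup>2 \<le> real N" by simp
    have "(sqrt N)\<^sup>2 < (real m + 1)\<^sup>2" using m(2) by (intro power_strict_mono) auto
    then have "real N < real ((Suc m)\<^sup>2)" by (simp add: add.commute)
    then have Nm: "N \<le> (Suc m)\<^sup>2" by linarith
    have "sqrt (real ((Suc m0 + m1)\<^sup>2)) \<le> sqrt (real N)" using N by (intro real_sqrt_le_mono) linarith
    then have "real (Suc m0 + m1) < real m + 1" using m(2) by simp
    then have mm: "m0 \<le> Suc m" "m1 \<le> m" "1 \<le> m" by linarith+
    have "(\<Sum>k=1..N. a k) \<le> (\<Sum>k=1..(Suc m)\<^sup>2. a k)"
      using Nm nonneg by (intro sum_mono2) auto
    also have "\<dots> \<le> \<kappa> * real ((Suc m)\<^sup>2)" by (rule m0[OF mm(1)])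
    also have "\<dots> \<le> \<kappa> * ((real m)\<^sup>2 + 3 * real m)"
      using mm \<kappa> by (intro mult_left_mono) (auto simp: power2_eq_square algebra_simps)
    also have "\<dots> \<le> \<kappa>' * (real m)\<^sup>2"
    proof -
      have "3 * \<kappa> / (\<kappa>' - \<kappa>) \<le> real m" using m1 mm by linarith
      then have "3 * \<kappa> \<le> real m * (\<kappa>' - \<kappa>)" using \<kappa> by (simp add: field_simps)
      then have "3 * \<kappa> * real m \<le> (real m * (\<kappa>' - \<kappa>)) * real m" by (intro mult_right_mono) auto
      then show ?thesis by (simp add: power2_eq_square algebra_simps)
    qed
    also have "\<dots> \<le> \<kappa>' * real N" using mN \<kappa> by (intro mult_left_mono) auto
    finally show ?thesis .
  qed
  then show ?thesis unfolding eventually_sequentially by blast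
qed

text \<open>Chebyshev's inequality leaves probabilities of order \<open>1 / N\<close>, which are summable along \<open>N = m\<^sup>2\<close>; the
  remaining \<open>N\<close> are covered by monotonicity.  The constant \<open>E\<close> allows for means that are only
  asymptotically bounded by \<open>\<mu>\<close>.\<close>

lemma (in prob_space) AE_eventually_sum_le:
  fixes \<xi> :: "nat \<Rightarrow> 'a \<Rightarrow> real"
  assumes meas [measurable]: "\<And>k. \<xi> k \<in> borel_measurable M" and nonneg: "\<And>k \<omega>. 0 \<le> \<xi> k \<omega>"
    and \<mu>: "0 \<le> \<mu>" "0 < \<epsilon>" and E: "0 \<le> E" and K: "0 \<le> K"
    and bound: "\<And>N. (\<integral>\<^sup>+\<omega>. (max 0 ((\<Sum>k=1..N. \<xi> k \<omega>) - real N * \<mu> - E))\<^sup>2 \<partial>M) \<le> ennreal (K * real N)"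
  shows "AE \<omega> in M. eventually (\<lambda>N. (\<Sum>k=1..N. \<xi> k \<omega>) \<le> (\<mu> + \<epsilon>) * real N) sequentially"
proof -
  define \<eta> where "\<eta> = \<epsilon> / 2"
  have \<eta>: "0 < \<eta>" using \<mu> by (simp add: \<eta>_def)
  define A where "A m = {\<omega> \<in> space M. (\<mu> + \<eta>) * real (m\<^sup>2) < (\<Sum>k=1..m\<^sup>2. \<xi> k \<omega>)}" for m :: nat
  have A [measurable]: "A m \<in> sets M" for m unfolding A_def by measurable
  have "eventually (\<lambda>m. measure M (A m) \<le> (4 * K / \<eta>\<^sup>2) * (1 / real m ^ 2)) sequentially"
  proof -
    obtain m0 :: nat where m0: "2 * E / \<eta> \<le> real m0" using real_arch_simple by blast
    have "measure M (A m) \<le> (4 * K / \<eta>\<^sup>2) * (1 / real m ^ 2)" if m: "Suc m0 \<le> m" for m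
    proof -
      define N where "N = m\<^sup>2"
      have "m * 1 \<le> m * m" using m by (intro mult_le_mono2) linarith
      then have "m0 \<le> N" "0 < N" unfolding N_def power2_eq_square using m by linarith+
      then have N: "real m0 \<le> real N" "0 < real N" by simp_all
      have EN: "2 * E \<le> \<eta> * real N"
      proof -
        have "2 * E / \<eta> \<le> real N" using m0 N by linarith
        then show ?thesis using \<eta> by (simp add: field_simps)
      qed
      define a where "a = (\<eta> * real N / 2)\<^sup>2"
      have a: "0 < a" using \<eta> N by (simp add: a_def)
      define u where "u \<omega> = ennreal ((max 0 ((\<Sum>k=1..N. \<xi> k \<omega>) - real N * \<mu> - E))\<^sup>2)" for \<omega>
      have [measurable]: "u \<in> borel_measurable M" unfolding u_def[abs_def] by measurable
      have "A m \<subseteq> {\<omega> \<in> space M. 1 \<le> ennreal (1 / a) * u \<omega>}"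
      proof
        fix \<omega> assume "\<omega> \<in> A m"
        then have w: "\<omega> \<in> space M" "(\<mu> + \<eta>) * real N < (\<Sum>k=1..N. \<xi> k \<omega>)" by (auto simp: A_def N_def)
        have "\<eta> * real N / 2 \<le> max 0 ((\<Sum>k=1..N. \<xi> k \<omega>) - real N * \<mu> - E)"
          using w(2) EN by (simp add: algebra_simps max_def)
        then have "a \<le> (max 0 ((\<Sum>k=1..N. \<xi> k \<omega>) - real N * \<mu> - E))\<^sup>2"
          unfolding a_def using \<eta> N by (intro power_mono) auto
        then have "1 \<le> (1 / a) * (max 0 ((\<Sum>k=1..N. \<xi> k \<omega>) - real N * \<mu> - E))\<^sup>2"
          using a by (simp add: field_simps)
        then have "1 \<le> ennreal (1 / a) * u \<omega>"
          unfolding u_def using a by (subst ennreal_mult[symmetric]) (auto simp: ennreal_leI simp flip: ennreal_1)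
        then show "\<omega> \<in> {\<omega> \<in> space M. 1 \<le> ennreal (1 / a) * u \<omega>}" using w by simp
      qed
      then have "emeasure M (A m) \<le> emeasure M {\<omega> \<in> space M. 1 \<le> ennreal (1 / a) * u \<omega>}"
        by (intro emeasure_mono) measurable
      also have "\<dots> \<le> ennreal (1 / a) * (\<integral>\<^sup>+\<omega>. u \<omega> * indicator (space M) \<omega> \<partial>M)"
        by (rule nn_integral_Markov_inequality) auto
      also have "(\<integral>\<^sup>+\<omega>. u \<omega> * indicator (space M) \<omega> \<partial>M) = (\<integral>\<^sup>+\<omega>. u \<omega> \<partial>M)"
        by (intro nn_integral_cong) (simp add: indicator_def)
      also have "ennreal (1 / a) * (\<integral>\<^sup>+\<omega>. u \<omega> \<partial>M) \<le> ennreal (1 / a) * ennreal (K * real N)"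
        unfolding u_def by (intro mult_left_mono bound) simp
      also have "\<dots> = ennreal ((1 / a) * (K * real N))" using a K by (intro ennreal_mult[symmetric]) auto
      also have "(1 / a) * (K * real N) = (4 * K / \<eta>\<^sup>2) * (1 / real m ^ 2)"
        using \<eta> N by (simp add: a_def N_def power2_eq_square field_simps)
      finally have "emeasure M (A m) \<le> ennreal ((4 * K / \<eta>\<^sup>2) * (1 / real m ^ 2))" .
      then show ?thesis unfolding emeasure_eq_measure using K \<eta> by (subst (asm) ennreal_le_iff) auto
    qed
    then show ?thesis unfolding eventually_sequentially by blast
  qed
  note ev = this
  have sm: "summable (\<lambda>m. (4 * K / \<eta>\<^sup>2) * (1 / real m ^ 2))"
    by (intro summable_mult) (rule inverse_power_summable[of 2, unfolded inverse_eq_divide], simp)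
  have "summable (\<lambda>m. measure M (A m))"
    by (rule summable_comparison_test_ev[OF _ sm]) (use ev in simp)
  then have "AE \<omega> in M. eventually (\<lambda>m. \<omega> \<in> space M - A m) sequentially"
    by (intro borel_cantelli_AE1) (auto simp: emeasure_eq_measure)
  then show ?thesis
  proof (rule AE_mp, intro AE_I2 impI)
    fix \<omega> assume "eventually (\<lambda>m. \<omega> \<in> space M - A m) sequentially"
    then have "eventually (\<lambda>m. (\<Sum>k=1..m\<^sup>2. \<xi> k \<omega>) \<le> (\<mu> + \<eta>) * real (m\<^sup>2)) sequentially"
      by (rule eventually_mono) (auto simp: A_def not_less)
    then show "eventually (\<lambda>N. (\<Sum>k=1..N. \<xi> k \<omega>) \<le> (\<mu> + \<epsilon>) * real N) sequentially"
      using nonneg \<mu> \<eta> by (intro eventually_sum_le_from_squares[of _ "\<mu> + \<eta>"]) (auto simp: \<eta>_def)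
  qed
qed

section \<open>Averages along the sampled solution\<close>

locale sampled_solution = driven_chain b c C \<sigma> M F W x0
  for b :: "real \<Rightarrow> real" and c C \<sigma> :: real and M :: "'a measure" and F :: "real \<Rightarrow> 'a measure"
    and W :: "real \<Rightarrow> 'a \<Rightarrow> real" and x0 :: real +
  fixes X :: "real \<Rightarrow> 'a \<Rightarrow> real" and h :: real
  assumes solution: "sde_solution M F W b \<sigma> x0 X" and h_pos: "0 < h"
begin

lemma X_measurable [measurable]: "X (real k * h) \<in> borel_measurable M"
  using solution h_pos by (intro F_measurable[of _ "real k * h"]) (auto simp: sde_solution_def adapted_process_def)

lemma AE_euler_convergence:
  "AE \<omega> in M. \<forall>k. (\<lambda>m. euler (h / real (Suc m)) (k * Suc m) \<omega>) \<longlonglongrightarrow> X (real k * h) \<omega>"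
proof -
  have "AE \<omega> in M. continuous_on {0..} (\<lambda>t. X t \<omega>)" "AE \<omega> in M. X 0 \<omega> = x0"
    "AE \<omega> in M. \<forall>t\<ge>0. set_integrable lborel {0..t} (\<lambda>s. b (X s \<omega>)) \<and>
      X t \<omega> = X 0 \<omega> + (LINT s:{0..t}|lborel. b (X s \<omega>)) + \<sigma> * (W t \<omega> - W 0 \<omega>)"
    using solution by (auto simp: sde_solution_def ae_continuous_paths_def)
  then show ?thesis
  proof eventually_elim
    case (elim \<omega>)
    then show ?case
      using euler_path_convergence[of "\<lambda>t. X t \<omega>" \<omega> h] h_pos by blast
  qed
qed

text \<open>The contraction per sampling interval, a bound for \<open>m\<close> steps of size \<open>h / m\<close> for every \<open>m\<close>.\<close>

definition rate :: real where
  "rate = exp (- (c * h / 2))"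

lemma rate: "0 \<le> rate" "rate < 1"
  using c_pos h_pos by (auto simp: rate_def)

lemma step_power_le_rate:
  assumes "c * (h / real (Suc m)) \<le> 1"
  shows "(1 - c * (h / real (Suc m)) / 2) ^ (k * Suc m) \<le> rate ^ k"
proof -
  have "(1 - c * (h / real (Suc m)) / 2) ^ Suc m \<le> exp (- (c * (h / real (Suc m)) / 2)) ^ Suc m"
    using assms exp_ge_add_one_self[of "- (c * (h / real (Suc m)) / 2)"] by (intro power_mono) auto
  also have "\<dots> = exp (real (Suc m) * (- (c * (h / real (Suc m)) / 2)))"
    by (rule exp_of_nat_mult[symmetric])
  also have "\<dots> = rate" unfolding rate_def by (intro arg_cong[where f = exp]) (simp del: of_nat_Suc)
  finally have "((1 - c * (h / real (Suc m)) / 2) ^ Suc m) ^ k \<le> rate ^ k"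
    using assms by (intro power_mono) auto
  then show ?thesis by (simp only: power_mult[symmetric] mult.commute)
qed

text \<open>Only an upper bound on the means is asked for, so that one statement serves both the unbounded
  weight, whose limiting mean stays unidentified, and the functions whose limiting mean is known.  For
  the same reason the second moment is taken of a positive part; being nonnegative and converging along
  almost every path, it passes from the chain to the solution by Fatou's lemma, without any domination.\<close>

lemma AE_eventually_average_le:
  assumes g: "wlip A g" "\<And>x. 0 \<le> g x" and \<mu>: "0 \<le> \<mu>" "0 < \<epsilon>" and B: "0 \<le> B"
    and mean: "\<And>m k. C * (h / real (Suc m)) \<le> 1 \<Longrightarrow> h / real (Suc m) \<le> 1 \<Longrightarrow>
      expectation (\<lambda>\<omega>. g (euler (h / real (Suc m)) (k * Suc m) \<omega>))
        \<le> \<mu> + B * sqrt (h / real (Suc m)) + B * rate ^ k"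
  shows "AE \<omega> in M. eventually (\<lambda>N. (\<Sum>k=1..N. g (X (real k * h) \<omega>)) \<le> (\<mu> + \<epsilon>) * real N) sequentially"
proof -
  note gm [measurable] = wlip_measurable[OF g(1)]
  define G where "G = \<bar>g 0\<bar> + A * (20 / scale)"
  have G: "\<bar>g x\<bar> \<le> G * wt 2 x" for x unfolding G_def by (rule wlip_growth[OF g(1)])
  define D where "D = cov_const A G"
  have D: "0 \<le> D"
    using G[of 0] wlip_nonneg[OF g(1)] scale_pos wt_bound_ge[of 2] wt_bound_ge[of 4]
    by (simp add: D_def cov_const_def)
  define K where "K = 2 * D / (1 - rate)"
  have K: "0 \<le> K" using D rate by (simp add: K_def)
  define E where "E = B / (1 - rate)"
  have E: "0 \<le> E" using B rate by (simp add: E_def)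
  have bound: "(\<integral>\<^sup>+\<omega>. (max 0 ((\<Sum>k=1..N. g (X (real k * h) \<omega>)) - real N * \<mu> - E))\<^sup>2 \<partial>M) \<le> ennreal (K * real N)" for N
  proof -
    define S where "S m \<omega> = (\<Sum>k=1..N. g (euler (h / real (Suc m)) (k * Suc m) \<omega>))" for m \<omega>
    define s where "s m = real N * (\<mu> + B * sqrt (h / real (Suc m))) + E" for m
    \<comment> \<open>\<open>s m\<close> bounds the mean of \<open>S m\<close>; the terms \<open>B * rate ^ k\<close> sum up to at most \<open>E\<close>.\<close>
    define u where "u m \<omega> = (max 0 (S m \<omega> - s m))\<^sup>2" for m \<omega>
    have hm: "0 < h / real (Suc m)" for m using h_pos by simp
    have [measurable]: "u m \<in> borel_measurable M" for m
      unfolding u_def[abs_def] S_def using hm[of m] by measurable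
    have lim0: "(\<lambda>m. h / real (Suc m)) \<longlonglongrightarrow> 0" by (intro LIMSEQ_Suc[OF lim_const_over_n])
    have conv: "AE \<omega> in M. (\<lambda>m. ennreal (u m \<omega>)) \<longlonglongrightarrow>
        ennreal ((max 0 ((\<Sum>k=1..N. g (X (real k * h) \<omega>)) - real N * \<mu> - E))\<^sup>2)"
      using AE_euler_convergence
    proof eventually_elim
      case (elim \<omega>)
      have "(\<lambda>m. S m \<omega>) \<longlonglongrightarrow> (\<Sum>k=1..N. g (X (real k * h) \<omega>))"
        unfolding S_def using elim
        by (intro tendsto_sum continuous_on_tendsto_compose[OF wlip_continuous[OF g(1), of UNIV]]) auto
      moreover have "s \<longlonglongrightarrow> real N * (\<mu> + B * sqrt 0) + E"
        unfolding s_def by (intro tendsto_intros lim0)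
      ultimately have "(\<lambda>m. u m \<omega>) \<longlonglongrightarrow>
          (max 0 ((\<Sum>k=1..N. g (X (real k * h) \<omega>)) - (real N * (\<mu> + B * sqrt 0) + E)))\<^sup>2"
        unfolding u_def by (intro tendsto_intros)
      then show ?case by (intro tendsto_ennrealI) (simp add: diff_diff_add)
    qed
    have ev: "eventually (\<lambda>m. (\<integral>\<^sup>+\<omega>. u m \<omega> \<partial>M) \<le> ennreal (K * real N)) sequentially"
    proof -
      have "eventually (\<lambda>m. h / real (Suc m) < min 1 (1 / C)) sequentially"
        by (rule order_tendstoD[OF lim0]) (use C_pos in auto)
      then show ?thesis
      proof eventually_elim
        case (elim m)
        define \<delta> where "\<delta> = h / real (Suc m)"
        have \<delta>: "0 < \<delta>" "C * \<delta> \<le> 1" "\<delta> \<le> 1"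
          using elim C_pos hm[of m] by (auto simp: \<delta>_def field_simps simp del: of_nat_Suc)
        define mean where "mean j = expectation (\<lambda>\<omega>. g (euler \<delta> j \<omega>))" for j
        define \<xi> where "\<xi> k \<omega> = g (euler \<delta> (k * Suc m) \<omega>) - mean (k * Suc m)" for k \<omega>
        note cov = covariance_decay[OF \<delta>(1,2) g(1) G mean_def]
        have c2: "expectation (\<lambda>\<omega>. \<xi> i \<omega> * \<xi> (i + k) \<omega>) \<le> D * rate ^ k" for i k
        proof -
          have "expectation (\<lambda>\<omega>. \<xi> i \<omega> * \<xi> (i + k) \<omega>) \<le> D * (1 - c * \<delta> / 2) ^ (k * Suc m)"
            using cov(2)[of "i * Suc m" "k * Suc m"] by (simp only: \<xi>_def D_def add_mult_distrib)
          also have "\<dots> \<le> D * rate ^ k"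
            using step_power_le_rate[of m k] c_step_le_1[OF \<delta>(1,2)] D
            by (intro mult_left_mono) (simp_all add: \<delta>_def)
          finally show ?thesis .
        qed
        have c1: "integrable M (\<lambda>\<omega>. \<xi> i \<omega> * \<xi> j \<omega>)" for i j unfolding \<xi>_def by (rule cov(1))
        note sq = sum_square_le[OF c1 c2 D rate, of N]
        have "(\<integral>\<^sup>+\<omega>. u m \<omega> \<partial>M) \<le> (\<integral>\<^sup>+\<omega>. ennreal ((\<Sum>k=1..N. \<xi> k \<omega>)\<^sup>2) \<partial>M)"
        proof (intro nn_integral_mono ennreal_leI)
          fix \<omega>
          have "(\<Sum>k=1..N. mean (k * Suc m)) \<le> (\<Sum>k=1..N. (\<mu> + B * sqrt \<delta>) + B * rate ^ k)"
            unfolding mean_def using mean[of m] \<delta> by (intro sum_mono) (simp add: \<delta>_def)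
          also have "\<dots> = real N * (\<mu> + B * sqrt \<delta>) + B * (\<Sum>k=1..N. rate ^ k)"
            by (simp add: sum.distrib sum_distrib_left)
          also have "(\<Sum>k=1..N. rate ^ k) \<le> 1 / (1 - rate)"
          proof -
            have "(\<Sum>k=1..N. rate ^ k) \<le> (\<Sum>k. rate ^ k)"
              using rate by (intro sum_le_suminf summable_geometric) auto
            then show ?thesis using rate by (simp add: suminf_geometric)
          qed
          then have "real N * (\<mu> + B * sqrt \<delta>) + B * (\<Sum>k=1..N. rate ^ k) \<le> s m"
            using B by (simp add: s_def \<delta>_def E_def) (metis mult_left_mono times_divide_eq_right mult.right_neutral)
          finally have "S m \<omega> - s m \<le> (\<Sum>k=1..N. \<xi> k \<omega>)"
            by (simp add: S_def \<xi>_def \<delta>_def sum_subtractf)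
          then have "max 0 (S m \<omega> - s m) \<le> \<bar>\<Sum>k=1..N. \<xi> k \<omega>\<bar>" by linarith
          then have "(max 0 (S m \<omega> - s m))\<^sup>2 \<le> \<bar>\<Sum>k=1..N. \<xi> k \<omega>\<bar>\<^sup>2" by (intro power_mono) auto
          then show "u m \<omega> \<le> (\<Sum>k=1..N. \<xi> k \<omega>)\<^sup>2" by (simp add: u_def)
        qed
        also have "\<dots> = ennreal (expectation (\<lambda>\<omega>. (\<Sum>k=1..N. \<xi> k \<omega>)\<^sup>2))"
          by (intro nn_integral_eq_integral sq) auto
        also have "\<dots> \<le> ennreal (K * real N)" using sq(2) unfolding K_def by (rule ennreal_leI)
        finally show ?case .
      qed
    qed
    have "(\<integral>\<^sup>+\<omega>. (max 0 ((\<Sum>k=1..N. g (X (real k * h) \<omega>)) - real N * \<mu> - E))\<^sup>2 \<partial>M)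
        = (\<integral>\<^sup>+\<omega>. liminf (\<lambda>m. ennreal (u m \<omega>)) \<partial>M)"
    proof (rule nn_integral_cong_AE)
      show "AE \<omega> in M. ennreal ((max 0 ((\<Sum>k=1..N. g (X (real k * h) \<omega>)) - real N * \<mu> - E))\<^sup>2)
          = liminf (\<lambda>m. ennreal (u m \<omega>))"
        using conv by eventually_elim (simp add: lim_imp_Liminf)
    qed
    also have "\<dots> \<le> liminf (\<lambda>m. \<integral>\<^sup>+\<omega>. u m \<omega> \<partial>M)" by (rule nn_integral_liminf) simp
    also have "\<dots> \<le> liminf (\<lambda>m. ennreal (K * real N))" by (rule Liminf_mono[OF ev])
    also have "\<dots> = ennreal (K * real N)" by (simp add: Liminf_const)
    finally show ?thesis .
  qed
  show ?thesis
  proof (rule AE_eventually_sum_le[OF _ _ \<mu> E K bound])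
    show "(\<lambda>\<omega>. g (X (real k * h) \<omega>)) \<in> borel_measurable M" for k by measurable
  qed (rule g(2))
qed

lemma AE_eventually_weight_le:
  "AE \<omega> in M. eventually (\<lambda>N. (\<Sum>k=1..N. wt 1 (X (real k * h) \<omega>)) \<le> (wt_bound 1 + 1) * real N) sequentially"
proof -
  have mean: "expectation (\<lambda>\<omega>. wt 1 (euler (h / real (Suc m)) (k * Suc m) \<omega>))
      \<le> wt_bound 1 + 0 * sqrt (h / real (Suc m)) + 0 * rate ^ k"
    if "C * (h / real (Suc m)) \<le> 1" for m k
    using wt_euler(2)[of "h / real (Suc m)" 1 "k * Suc m"] h_pos that by simp
  have "0 \<le> wt_bound 1" using wt_bound_ge[of 1] by linarith
  from AE_eventually_average_le[OF wlip_wt wt_nonneg this zero_less_one order_refl mean]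
  show ?thesis .
qed

text \<open>The upper bound is applied to the nonnegative functions \<open>U + v\<close> and \<open>U - v\<close>, where \<open>U\<close> bounds \<open>v\<close>.\<close>

lemma AE_centred_average_tendsto_0:
  assumes B: "\<And>x. (B has_real_derivative 2 * b x / \<sigma>\<^sup>2) (at x)"
    and v: "\<And>x y. \<bar>v x - v y\<bar> \<le> A * \<bar>x - y\<bar>" "\<And>x. R \<le> \<bar>x\<bar> \<Longrightarrow> v x = 0"
    and R: "0 < R" and v0: "(LINT x|lborel. v x * exp (B x)) = 0"
  shows "AE \<omega> in M. (\<lambda>N. (\<Sum>k=1..N. v (X (real k * h) \<omega>)) / real N) \<longlonglongrightarrow> 0"
proof -
  have A0: "0 \<le> A" using v(1)[of 1 0] by simp
  have vw: "wlip A v" by (rule wlip_Lipschitz[OF v(1) A0])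
  obtain U where U: "0 \<le> U" "\<And>x. \<bar>v x\<bar> \<le> U"
    by (rule bounded_if_constant_outside[OF wlip_continuous[OF vw, of "{-R..R}"], of 0 0]) (use v(2) R in auto)
  obtain D where D: "0 \<le> D" "\<forall>\<delta> i. 0 < \<delta> \<longrightarrow> \<delta> \<le> 1 \<longrightarrow> C * \<delta> \<le> 1 \<longrightarrow>
    \<bar>expectation (\<lambda>\<omega>. v (euler \<delta> i \<omega>))\<bar> \<le> D * sqrt \<delta> + D * (1 - c * \<delta> / 2) ^ i"
    using centred_mean_decay[OF B v R v0] by blast
  have mean: "\<bar>expectation (\<lambda>\<omega>. v (euler (h / real (Suc m)) (k * Suc m) \<omega>))\<bar>
      \<le> D * sqrt (h / real (Suc m)) + D * rate ^ k"
    if m: "C * (h / real (Suc m)) \<le> 1" "h / real (Suc m) \<le> 1" for m k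
  proof -
    have hm: "0 < h / real (Suc m)" using h_pos by simp
    have "D * (1 - c * (h / real (Suc m)) / 2) ^ (k * Suc m) \<le> D * rate ^ k"
      using c_step_le_1[OF hm m(1)] by (intro mult_left_mono step_power_le_rate D)
    then show ?thesis using D(2)[rule_format, OF hm m(2,1), of "k * Suc m"] by linarith
  qed
  have int: "integrable M (\<lambda>\<omega>. v (euler (h / real (Suc m)) (k * Suc m) \<omega>))"
    if "C * (h / real (Suc m)) \<le> 1" for m k
    using h_pos that by (intro wlip_euler_integrable[OF _ _ vw]) auto
  have up: "AE \<omega> in M. eventually (\<lambda>N. (\<Sum>k=1..N. U + s * v (X (real k * h) \<omega>)) \<le> (U + \<epsilon>) * real N) sequentially"
    if s: "s \<in> {1, -1}" and \<epsilon>: "0 < \<epsilon>" for s \<epsilon> :: real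
  proof (rule AE_eventually_average_le[where A = A and B = D])
    show "wlip A (\<lambda>x. U + s * v x)"
      using s v A0 by (intro wlip_Lipschitz) (auto simp: abs_minus_commute)
    show "0 \<le> U + s * v x" for x using s U(2)[of x] by auto
    fix m k assume m: "C * (h / real (Suc m)) \<le> 1" "h / real (Suc m) \<le> 1"
    have "expectation (\<lambda>\<omega>. U + s * v (euler (h / real (Suc m)) (k * Suc m) \<omega>))
        = U + s * expectation (\<lambda>\<omega>. v (euler (h / real (Suc m)) (k * Suc m) \<omega>))"
      using int[OF m(1), of k] by (simp add: prob_space)
    also have "\<dots> \<le> U + (D * sqrt (h / real (Suc m)) + D * rate ^ k)"
      using mean[OF m, of k] s by auto
    finally show "expectation (\<lambda>\<omega>. U + s * v (euler (h / real (Suc m)) (k * Suc m) \<omega>))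
        \<le> U + D * sqrt (h / real (Suc m)) + D * rate ^ k" by simp
  qed (use U D \<epsilon> in auto)
  have "AE \<omega> in M. \<forall>i. eventually (\<lambda>N. (\<Sum>k=1..N. U + 1 * v (X (real k * h) \<omega>)) \<le> (U + 1 / real (Suc i)) * real N) sequentially
      \<and> eventually (\<lambda>N. (\<Sum>k=1..N. U + (-1) * v (X (real k * h) \<omega>)) \<le> (U + 1 / real (Suc i)) * real N) sequentially"
    unfolding AE_all_countable by (intro allI AE_conjI up) auto
  then show ?thesis
  proof eventually_elim
    case (elim \<omega>)
    show ?case
    proof (rule LIMSEQ_I)
      fix r :: real assume "0 < r"
      then obtain i where i: "1 / real (Suc i) < r" using nat_approx_posE by blast
      note both = elim[rule_format, of i]
      from both[THEN conjunct1] both[THEN conjunct2] eventually_gt_at_top[of "0::nat"]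
      have "eventually (\<lambda>N. \<bar>(\<Sum>k=1..N. v (X (real k * h) \<omega>)) / real N\<bar> < r) sequentially"
      proof eventually_elim
        case (elim N)
        then have "\<bar>\<Sum>k=1..N. v (X (real k * h) \<omega>)\<bar> \<le> (1 / real (Suc i)) * real N"
          by (simp add: sum.distrib sum_subtractf algebra_simps abs_le_iff)
        then have "\<bar>(\<Sum>k=1..N. v (X (real k * h) \<omega>)) / real N\<bar> \<le> 1 / real (Suc i)"
          using elim by (simp add: field_simps)
        then show ?case using i by linarith
      qed
      then show "\<exists>N0. \<forall>N\<ge>N0. norm ((\<Sum>k=1..N. v (X (real k * h) \<omega>)) / real N - 0) < r"
        unfolding eventually_sequentially by simp
    qed
  qed
qed

end

section \<open>The ergodic theorem for functions dominated by the weight\<close>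

context dissipative_drift
begin

definition cutoff :: "real \<Rightarrow> real \<Rightarrow> real" where
  "cutoff R x = max 0 (min 1 (R + 1 - \<bar>x\<bar>))"

lemma cutoff_Lipschitz: "\<bar>cutoff R x - cutoff R y\<bar> \<le> 1 * \<bar>x - y\<bar>"
  unfolding cutoff_def by (auto simp: max_def min_def abs_if)

lemma cutoff_range: "0 \<le> cutoff R x" "cutoff R x \<le> 1"
  by (auto simp: cutoff_def)

lemma cutoff_eq_0: "R + 1 \<le> \<bar>x\<bar> \<Longrightarrow> cutoff R x = 0"
  by (simp add: cutoff_def)

lemma cutoff_eq_1: "\<bar>x\<bar> \<le> R \<Longrightarrow> cutoff R x = 1"
  by (simp add: cutoff_def)

text \<open>A polynomial is Lipschitz on compact sets and can be made close to \<open>f\<close> there; the cutoff then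
  makes it globally Lipschitz with compact support.\<close>

lemma Lipschitz_approximation:
  fixes f :: "real \<Rightarrow> real"
  assumes f: "continuous_on UNIV f" and \<eta>: "0 < \<eta>" and R: "0 < R"
    and tail: "\<And>x. R \<le> \<bar>x\<bar> \<Longrightarrow> \<bar>f x\<bar> \<le> \<eta> * wt 1 x"
  shows "\<exists>g A. (\<forall>x y. \<bar>g x - g y\<bar> \<le> A * \<bar>x - y\<bar>) \<and> (\<forall>x. R + 1 \<le> \<bar>x\<bar> \<longrightarrow> g x = 0) \<and>
    (\<forall>x. \<bar>f x - g x\<bar> \<le> 2 * \<eta> * wt 1 x)"
proof -
  let ?S = "{- (R + 1)..R + 1}"
  obtain p where p: "real_polynomial_function p" "\<And>x. x \<in> ?S \<Longrightarrow> \<bar>f x - p x\<bar> < \<eta>"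
    using Stone_Weierstrass_real_polynomial_function[of ?S f \<eta>] continuous_on_subset[OF f] \<eta> by auto
  obtain p' where p': "real_polynomial_function p'" "\<And>x. (p has_real_derivative p' x) (at x)"
    using has_real_derivative_polynomial_function[OF p(1)] by blast
  have "bounded (p ` ?S)" "bounded (p' ` ?S)"
    using p(1) p'(1) by (auto intro!: compact_imp_bounded compact_continuous_image continuous_at_imp_continuous_on
        continuous_real_polymonial_function)
  then obtain U K where UK: "\<And>x. x \<in> ?S \<Longrightarrow> \<bar>p x\<bar> \<le> U" "\<And>x. x \<in> ?S \<Longrightarrow> \<bar>p' x\<bar> \<le> K"
    unfolding bounded_iff by (metis image_eqI real_norm_def)
  have nonneg: "0 \<le> U" "0 \<le> K" using UK[of 0] R by auto
  define g where "g x = p x * cutoff R x" for x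
  have "\<bar>g x - g y\<bar> \<le> (K * 1 + U * 1) * \<bar>x - y\<bar>" for x y
    unfolding g_def
  proof (rule Lipschitz_mult_cutoff[of ?S])
    show "\<bar>p x - p y\<bar> \<le> K * \<bar>x - y\<bar>" if "x \<in> ?S" "y \<in> ?S" for x y
      by (rule Lipschitz_if_derivative_bounded[of ?S p p']) (use p'(2) UK that in auto)
    show "cutoff R x = 0" if "x \<notin> ?S" for x using that by (intro cutoff_eq_0) auto
  qed (use UK nonneg cutoff_Lipschitz cutoff_range in auto)
  moreover have "g x = 0" if "R + 1 \<le> \<bar>x\<bar>" for x using cutoff_eq_0[OF that] by (simp add: g_def)
  moreover have "\<bar>f x - g x\<bar> \<le> 2 * \<eta> * wt 1 x" for x
  proof -
    have e: "\<eta> * 1 \<le> \<eta> * wt 1 x" using wt_ge_1[of 1 x] \<eta> by (intro mult_left_mono) auto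
    have 1: "\<bar>(1 - cutoff R x) * f x\<bar> \<le> \<eta> * wt 1 x"
    proof (cases "\<bar>x\<bar> \<le> R")
      case True
      then show ?thesis using cutoff_eq_1[OF True] e \<eta> by simp
    next
      case False
      have "\<bar>1 - cutoff R x\<bar> * \<bar>f x\<bar> \<le> 1 * (\<eta> * wt 1 x)"
        using tail[of x] False cutoff_range[of R x] by (intro mult_mono) auto
      then show ?thesis by (simp add: abs_mult)
    qed
    have 2: "\<bar>cutoff R x * (f x - p x)\<bar> \<le> \<eta> * wt 1 x"
    proof (cases "x \<in> ?S")
      case True
      have "\<bar>cutoff R x\<bar> * \<bar>f x - p x\<bar> \<le> 1 * \<eta>"
        using p(2)[OF True] cutoff_range[of R x] by (intro mult_mono) auto
      then show ?thesis using e by (simp add: abs_mult)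
    next
      case False
      then have "cutoff R x = 0" by (intro cutoff_eq_0) auto
      then show ?thesis using e \<eta> by simp
    qed
    have "f x - g x = (1 - cutoff R x) * f x + cutoff R x * (f x - p x)" by (simp add: g_def algebra_simps)
    then show ?thesis using 1 2 by linarith
  qed
  ultimately show ?thesis by blast
qed

end

context sampled_solution
begin

text \<open>The invariant density is proportional to \<open>exp B\<close>.  Up to a multiple of \<open>\<eta>\<close> times the weight, \<open>f\<close> equals
  a compactly supported Lipschitz function \<open>g\<close>, and \<open>1\<close> equals a cutoff \<open>\<rho>\<close>.  The averages of \<open>g - l \<rho>\<close>
  vanish in the limit once \<open>l\<close> is the ratio of the integrals of \<open>g\<close> and \<open>\<rho>\<close> against \<open>exp B\<close>; hence the
  averages of \<open>f\<close> stay within a multiple of \<open>\<eta>\<close> of \<open>l\<close>, and \<open>l\<close> within a multiple of \<open>\<eta>\<close> of the claimed limit.\<close>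

theorem ergodic_average:
  fixes f :: "real \<Rightarrow> real"
  assumes B: "\<And>x. (B has_real_derivative 2 * b x / \<sigma>\<^sup>2) (at x)"
    and int_wt: "integrable lborel (\<lambda>x. wt 1 x * exp (B x))"
    and f: "continuous_on UNIV f"
    and tail: "\<And>\<eta>. 0 < \<eta> \<Longrightarrow> \<exists>R. \<forall>x. R \<le> \<bar>x\<bar> \<longrightarrow> \<bar>f x\<bar> \<le> \<eta> * wt 1 x"
  shows "AE \<omega> in M. (\<lambda>N. (\<Sum>k=1..N. f (X (real k * h) \<omega>)) / real N)
    \<longlonglongrightarrow> (LINT x|lborel. f x * exp (B x)) / (LINT x|lborel. exp (B x))"
proof -
  have cB: "continuous_on UNIV B"
    by (intro continuous_at_imp_continuous_on ballI DERIV_isCont[OF B])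
  note [measurable] = borel_measurable_continuous_onI[OF cB] borel_measurable_continuous_onI[OF f]
  have dom: "integrable lborel (\<lambda>x. g x * exp (B x))"
    if [measurable]: "g \<in> borel_measurable borel" and g: "\<And>x. \<bar>g x\<bar> \<le> G * wt 1 x" for g G
  proof (rule Bochner_Integration.integrable_bound)
    show "integrable lborel (\<lambda>x. G * (wt 1 x * exp (B x)))" using int_wt by simp
    show "AE x in lborel. norm (g x * exp (B x)) \<le> norm (G * (wt 1 x * exp (B x)))"
    proof (rule AE_I2)
      fix x
      have "\<bar>g x\<bar> * exp (B x) \<le> (G * wt 1 x) * exp (B x)" by (intro mult_right_mono g) simp
      then show "norm (g x * exp (B x)) \<le> norm (G * (wt 1 x * exp (B x)))"
        by (simp add: abs_mult) (metis abs_ge_self abs_mult abs_exp_cancel mult.assoc order_trans)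
    qed
  qed measurable
  define w where "w = (LINT x|lborel. wt 1 x * exp (B x))"
  define Z where "Z = (LINT x|lborel. exp (B x))"
  define I where "I = (LINT x|lborel. f x * exp (B x))"
  have w0: "0 \<le> w" unfolding w_def using wt_nonneg by (intro integral_nonneg_AE) auto
  have int1: "integrable lborel (\<lambda>x. exp (B x))"
    using dom[of "\<lambda>_. 1" 1] wt_ge_1 by simp
  have Z0: "0 < Z"
  proof -
    have "Z \<noteq> 0"
    proof
      assume "Z = 0"
      then have "AE x in lborel. exp (B x) = 0"
        unfolding Z_def using integral_nonneg_eq_0_iff_AE[OF int1] by simp
      then have "AE x::real in lborel. False" by simp
      then show False by (simp add: AE_iff_null null_sets_def)
    qed
    moreover have "0 \<le> Z" unfolding Z_def by (intro integral_nonneg_AE) simp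
    ultimately show ?thesis by simp
  qed
  have intf: "integrable lborel (\<lambda>x. f x * exp (B x))"
  proof -
    obtain R where R: "\<And>x. R \<le> \<bar>x\<bar> \<Longrightarrow> \<bar>f x\<bar> \<le> 1 * wt 1 x" using tail[of 1] by auto
    have "bounded (f ` {-\<bar>R\<bar>..\<bar>R\<bar>})"
      by (intro compact_imp_bounded compact_continuous_image continuous_on_subset[OF f]) auto
    then obtain m where m: "\<And>x. x \<in> {-\<bar>R\<bar>..\<bar>R\<bar>} \<Longrightarrow> \<bar>f x\<bar> \<le> m"
      unfolding bounded_iff by (metis image_eqI real_norm_def)
    have "\<bar>f x\<bar> \<le> (1 + \<bar>m\<bar>) * wt 1 x" for x
    proof (cases "R \<le> \<bar>x\<bar>")
      case True
      moreover have "0 \<le> \<bar>m\<bar> * wt 1 x" using wt_nonneg by simp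
      ultimately show ?thesis using R[of x] unfolding distrib_right by linarith
    next
      case False
      then have "- \<bar>R\<bar> \<le> x" "x \<le> \<bar>R\<bar>" by linarith+
      then have "\<bar>f x\<bar> \<le> \<bar>m\<bar>" using m[of x] by simp
      moreover have "\<bar>m\<bar> * 1 \<le> \<bar>m\<bar> * wt 1 x" using wt_ge_1 by (intro mult_left_mono) auto
      ultimately show ?thesis using wt_nonneg[of 1 x] by (simp add: distrib_right)
    qed
    then show ?thesis by (intro dom) auto
  qed
  have close: "\<bar>(LINT x|lborel. g x * exp (B x)) - (LINT x|lborel. k x * exp (B x))\<bar> \<le> e * w"
    if g: "integrable lborel (\<lambda>x. g x * exp (B x))" and k: "integrable lborel (\<lambda>x. k x * exp (B x))"
      and e: "\<And>x. \<bar>g x - k x\<bar> \<le> e * wt 1 x" for g k e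
  proof -
    have "\<bar>(LINT x|lborel. g x * exp (B x)) - (LINT x|lborel. k x * exp (B x))\<bar>
        = \<bar>LINT x|lborel. (g x - k x) * exp (B x)\<bar>"
      using g k by (simp add: left_diff_distrib)
    also have "\<dots> \<le> (LINT x|lborel. \<bar>(g x - k x) * exp (B x)\<bar>)" by (rule integral_abs_bound)
    also have "\<dots> \<le> (LINT x|lborel. e * (wt 1 x * exp (B x)))"
    proof (rule integral_mono)
      show "integrable lborel (\<lambda>x. \<bar>(g x - k x) * exp (B x)\<bar>)"
        using g k by (simp add: left_diff_distrib)
      show "\<bar>(g x - k x) * exp (B x)\<bar> \<le> e * (wt 1 x * exp (B x))" for x
        using mult_right_mono[OF e[of x], of "exp (B x)"] by (simp add: abs_mult mult_ac)
    qed (use int_wt in simp)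
    finally show ?thesis by (simp add: w_def)
  qed
  define Cw where "Cw = wt_bound 1 + 1"
  define \<Lambda> where "\<Lambda> = 2 * (\<bar>I\<bar> + Z) / Z"
  define K where "K = 2 * Cw + \<Lambda> * Cw + (\<Lambda> + 2) * w / Z"
  have Cw: "0 \<le> Cw" using wt_bound_ge[of 1] by (simp add: Cw_def)
  have \<Lambda>0: "0 \<le> \<Lambda>" using Z0 by (simp add: \<Lambda>_def)
  have K0: "0 \<le> K" using Cw \<Lambda>0 w0 Z0 by (simp add: K_def)
  have approx: "AE \<omega> in M. eventually (\<lambda>N. \<bar>(\<Sum>k=1..N. f (X (real k * h) \<omega>)) / real N - I / Z\<bar> \<le> (K + 1) * \<eta>) sequentially"
    if \<eta>: "0 < \<eta>" and \<eta>w: "\<eta> * w \<le> Z / 2" for \<eta>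
  proof -
    obtain R0 where R0: "\<And>x. R0 \<le> \<bar>x\<bar> \<Longrightarrow> \<bar>f x\<bar> \<le> \<eta> * wt 1 x" using tail[OF \<eta>] by auto
    define R where "R = max 1 (max R0 (1 / (\<eta> * scale)))"
    have R: "0 < R" by (simp add: R_def)
    define \<rho> where "\<rho> = cutoff R"
    obtain g A where g: "\<And>x y. \<bar>g x - g y\<bar> \<le> A * \<bar>x - y\<bar>" "\<And>x. R + 1 \<le> \<bar>x\<bar> \<Longrightarrow> g x = 0"
      "\<And>x. \<bar>f x - g x\<bar> \<le> 2 * \<eta> * wt 1 x"
      using Lipschitz_approximation[OF f \<eta> R] R0 by (auto simp: R_def)
    have \<rho>1: "\<bar>1 - \<rho> x\<bar> \<le> \<eta> * wt 1 x" for x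
    proof (cases "\<bar>x\<bar> \<le> R")
      case True
      then show ?thesis using cutoff_eq_1[OF True] \<eta> wt_nonneg[of 1 x] by (simp add: \<rho>_def)
    next
      case False
      then have "1 / (\<eta> * scale) \<le> \<bar>x\<bar>" by (simp add: R_def)
      also have "\<dots> \<le> (1 / scale) * wt 1 x" by (rule abs_le_wt)
      finally have "1 \<le> \<eta> * wt 1 x" using \<eta> scale_pos by (simp add: field_simps)
      then show ?thesis using cutoff_range[of R x] by (simp add: \<rho>_def)
    qed
    have A0: "0 \<le> A" using g(1)[of 1 0] by simp
    have mg [measurable]: "g \<in> borel_measurable borel" "\<rho> \<in> borel_measurable borel"
      unfolding \<rho>_def using wlip_measurable wlip_Lipschitz[OF g(1) A0] wlip_Lipschitz[OF cutoff_Lipschitz] by auto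
    have int\<rho>: "integrable lborel (\<lambda>x. \<rho> x * exp (B x))"
    proof (rule dom[OF mg(2)])
      show "\<bar>\<rho> x\<bar> \<le> 1 * wt 1 x" for x using cutoff_range[of R x] wt_ge_1[of 1 x] by (simp add: \<rho>_def)
    qed
    have intg: "integrable lborel (\<lambda>x. g x * exp (B x))"
    proof -
      have "integrable lborel (\<lambda>x. (f x - g x) * exp (B x))"
        by (rule dom[OF _ g(3)]) measurable
      from Bochner_Integration.integrable_diff[OF intf this] show ?thesis by (simp add: algebra_simps)
    qed
    define Ig where "Ig = (LINT x|lborel. g x * exp (B x))"
    define I\<rho> where "I\<rho> = (LINT x|lborel. \<rho> x * exp (B x))"
    have Ig: "\<bar>I - Ig\<bar> \<le> 2 * \<eta> * w" unfolding I_def Ig_def by (rule close[OF intf intg g(3)])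
    have I\<rho>: "\<bar>Z - I\<rho>\<bar> \<le> \<eta> * w"
      using close[of "\<lambda>_. 1" \<rho> \<eta>] int1 int\<rho> \<rho>1 unfolding Z_def I\<rho>_def by simp
    have I\<rho>Z: "Z / 2 \<le> I\<rho>" using I\<rho> \<eta>w by linarith
    define l where "l = Ig / I\<rho>"
    have lI: "l * I\<rho> = Ig" using I\<rho>Z Z0 by (simp add: l_def)
    have l: "\<bar>l\<bar> \<le> \<Lambda>"
    proof -
      have "\<bar>Ig\<bar> \<le> \<bar>I\<bar> + Z" using Ig \<eta>w by linarith
      then have "\<bar>l\<bar> \<le> (\<bar>I\<bar> + Z) / (Z / 2)"
        unfolding l_def abs_divide using I\<rho>Z Z0 by (intro frac_le) auto
      then show ?thesis by (simp add: \<Lambda>_def mult.commute)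
    qed
    have lim: "\<bar>l - I / Z\<bar> \<le> (\<Lambda> + 2) * w / Z * \<eta>"
    proof -
      have "\<bar>l * (Z - I\<rho>)\<bar> \<le> \<Lambda> * (\<eta> * w)"
        unfolding abs_mult using l I\<rho> \<Lambda>0 by (intro mult_mono) auto
      moreover have "l * Z - I = l * (Z - I\<rho>) + (Ig - I)" using lI by (simp add: algebra_simps)
      ultimately have "\<bar>l * Z - I\<bar> \<le> \<Lambda> * (\<eta> * w) + 2 * \<eta> * w" using Ig by linarith
      then have "\<bar>l * Z - I\<bar> / Z \<le> (\<Lambda> * (\<eta> * w) + 2 * \<eta> * w) / Z"
        using Z0 by (intro divide_right_mono) auto
      moreover have "\<bar>l - I / Z\<bar> = \<bar>l * Z - I\<bar> / Z"
      proof -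
        have "l - I / Z = (l * Z - I) / Z" using Z0 by (simp add: field_simps)
        then show ?thesis unfolding abs_divide using Z0 by simp
      qed
      moreover have "(\<Lambda> * (\<eta> * w) + 2 * \<eta> * w) / Z = (\<Lambda> + 2) * w / Z * \<eta>"
        using Z0 by (simp add: field_simps)
      ultimately show ?thesis by simp
    qed
    define v where "v x = g x - l * \<rho> x" for x
    have "\<bar>v x - v y\<bar> \<le> (A + \<bar>l\<bar>) * \<bar>x - y\<bar>" for x y
    proof -
      have "\<bar>l * (\<rho> x - \<rho> y)\<bar> \<le> \<bar>l\<bar> * \<bar>x - y\<bar>"
        unfolding abs_mult \<rho>_def using cutoff_Lipschitz[of R x y] by (intro mult_left_mono) auto
      moreover have "v x - v y = (g x - g y) - l * (\<rho> x - \<rho> y)" by (simp add: v_def algebra_simps)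
      ultimately show ?thesis using g(1)[of x y] by (simp add: distrib_right)
    qed
    moreover have "v x = 0" if "R + 1 \<le> \<bar>x\<bar>" for x
      using g(2)[OF that] cutoff_eq_0[OF that] by (simp add: v_def \<rho>_def)
    moreover have "(LINT x|lborel. v x * exp (B x)) = 0"
    proof -
      have "(LINT x|lborel. v x * exp (B x)) = (LINT x|lborel. g x * exp (B x) - l * (\<rho> x * exp (B x)))"
        by (simp add: v_def algebra_simps)
      also have "\<dots> = Ig - l * I\<rho>" using intg int\<rho> by (simp add: Ig_def I\<rho>_def)
      finally show ?thesis using lI by simp
    qed
    ultimately have "AE \<omega> in M. (\<lambda>N. (\<Sum>k=1..N. v (X (real k * h) \<omega>)) / real N) \<longlonglongrightarrow> 0"
      using R by (intro AE_centred_average_tendsto_0[OF B, of v "A + \<bar>l\<bar>" "R + 1"]) auto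
    from this AE_eventually_weight_le show ?thesis
    proof eventually_elim
      case (elim \<omega>)
      have "eventually (\<lambda>N. \<bar>(\<Sum>k=1..N. v (X (real k * h) \<omega>)) / real N\<bar> < \<eta>) sequentially"
        using tendstoD[OF elim(1) \<eta>] by (simp add: dist_real_def)
      from this elim(2) eventually_gt_at_top[of "0::nat"] show ?case
      proof eventually_elim
        case (elim N)
        define avg where "avg g = (\<Sum>k=1..N. g (X (real k * h) \<omega>)) / real N" for g :: "real \<Rightarrow> real"
        have N: "0 < real N" using elim by simp
        have avg_wt: "avg (wt 1) \<le> Cw"
          unfolding avg_def Cw_def using elim(2) N by (simp add: pos_divide_le_eq)
        have avg_close: "\<bar>avg p - avg q\<bar> \<le> e * Cw" if e: "0 \<le> e" "\<And>x. \<bar>p x - q x\<bar> \<le> e * wt 1 x" for p q e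
        proof -
          have "\<bar>avg p - avg q\<bar> = \<bar>\<Sum>k=1..N. p (X (real k * h) \<omega>) - q (X (real k * h) \<omega>)\<bar> / real N"
            by (simp add: avg_def sum_subtractf diff_divide_distrib[symmetric])
          also have "\<dots> \<le> (\<Sum>k=1..N. e * wt 1 (X (real k * h) \<omega>)) / real N"
            using e by (intro divide_right_mono order_trans[OF sum_abs] sum_mono) auto
          also have "\<dots> = e * avg (wt 1)" by (simp add: avg_def sum_distrib_left)
          also have "\<dots> \<le> e * Cw" using avg_wt e by (intro mult_left_mono)
          finally show ?thesis .
        qed
        have 1: "\<bar>avg f - avg g\<bar> \<le> 2 * \<eta> * Cw" using \<eta> g(3) by (intro avg_close) auto
        have "\<bar>avg (\<lambda>_. 1) - avg \<rho>\<bar> \<le> \<eta> * Cw" using \<eta> \<rho>1 by (intro avg_close) auto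
        then have "\<bar>1 - avg \<rho>\<bar> \<le> \<eta> * Cw" using N by (simp add: avg_def)
        then have "\<bar>l\<bar> * \<bar>1 - avg \<rho>\<bar> \<le> \<Lambda> * (\<eta> * Cw)" using l \<Lambda>0 by (intro mult_mono) auto
        then have 2: "\<bar>l * (1 - avg \<rho>)\<bar> \<le> \<Lambda> * (\<eta> * Cw)" by (simp add: abs_mult)
        have 3: "avg v = avg g - l * avg \<rho>"
          by (simp add: avg_def v_def sum_subtractf sum_distrib_left diff_divide_distrib)
        have "avg f - I / Z = (avg f - avg g) + avg v - l * (1 - avg \<rho>) + (l - I / Z)"
          unfolding 3 by (simp add: algebra_simps)
        then have "\<bar>avg f - I / Z\<bar> \<le> 2 * \<eta> * Cw + \<eta> + \<Lambda> * (\<eta> * Cw) + (\<Lambda> + 2) * w / Z * \<eta>"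
          using 1 2 lim elim(1) unfolding avg_def[of v, symmetric] by linarith
        also have "\<dots> = (K + 1) * \<eta>" by (simp add: K_def algebra_simps)
        finally show ?case by (simp add: avg_def)
      qed
    qed
  qed
  \<comment> \<open>The condition \<open>\<eta> w \<le> Z / 2\<close> keeps the integral of the cutoff away from \<open>0\<close>.\<close>
  define \<eta>0 where "\<eta>0 = Z / (2 * (w + 1))"
  have \<eta>0: "0 < \<eta>0" "\<eta>0 * w \<le> Z / 2"
    using Z0 w0 by (auto simp: \<eta>0_def field_simps)
  have "AE \<omega> in M. \<forall>i. eventually (\<lambda>N. \<bar>(\<Sum>k=1..N. f (X (real k * h) \<omega>)) / real N - I / Z\<bar>
      \<le> (K + 1) * (\<eta>0 / real (Suc i))) sequentially"
    unfolding AE_all_countable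
  proof (intro allI approx)
    fix i
    show "0 < \<eta>0 / real (Suc i)" using \<eta>0 by simp
    have "\<eta>0 / real (Suc i) \<le> \<eta>0" using \<eta>0(1) by (simp add: field_simps)
    then have "\<eta>0 / real (Suc i) * w \<le> \<eta>0 * w" using w0 by (intro mult_right_mono)
    then show "\<eta>0 / real (Suc i) * w \<le> Z / 2" using \<eta>0 by linarith
  qed
  then show ?thesis unfolding I_def[symmetric] Z_def[symmetric]
  proof eventually_elim
    case (elim \<omega>)
    show ?case
    proof (rule tendstoI)
      fix r :: real assume r: "0 < r"
      have "0 < r / ((K + 1) * \<eta>0)" using r K0 \<eta>0 by simp
      then obtain i where i: "1 / real (Suc i) < r / ((K + 1) * \<eta>0)" using nat_approx_posE by blast
      have "0 < (K + 1) * \<eta>0" using K0 \<eta>0 by simp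
      then have "(1 / real (Suc i)) * ((K + 1) * \<eta>0) < r"
        using i by (subst (asm) pos_less_divide_eq) auto
      then have "(K + 1) * (\<eta>0 / real (Suc i)) < r" by (simp del: of_nat_Suc)
      with elim[rule_format, of i]
      show "eventually (\<lambda>N. dist ((\<Sum>k=1..N. f (X (real k * h) \<omega>)) / real N) (I / Z) < r) sequentially"
        by (elim eventually_mono) (simp add: dist_real_def)
    qed
  qed
qed

end

section \<open>Gaussian moments of real order on the half-line\<close>

text \<open>The integral of \<open>x powr n * exp (- \<beta> x\<^sup>2)\<close> over the positive half-line.\<close>

definition half_moment :: "real \<Rightarrow> real \<Rightarrow> real" where
  "half_moment \<beta> n = Gamma ((n + 1) / 2) / (2 * \<beta> powr ((n + 1) / 2))"

lemma half_moment_pos: "0 < \<beta> \<Longrightarrow> 0 \<le> n \<Longrightarrow> 0 < half_moment \<beta> n"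
  by (simp add: half_moment_def Gamma_real_pos)

text \<open>The substitution \<open>t = \<beta> x\<^sup>2\<close> in Euler's integral for \<open>Gamma ((n + 1) / 2)\<close>.\<close>

lemma has_integral_half_moment:
  assumes \<beta>: "0 < \<beta>" and n: "0 \<le> n"
  shows "has_bochner_integral lborel (\<lambda>x. indicator {0<..} x * (x powr n * exp (- (\<beta> * x\<^sup>2)))) (half_moment \<beta> n)"
proof -
  define z where "z = (n + 1) / 2"
  have z: "0 < z" using n by (simp add: z_def)
  define f where "f t = t powr (z - 1) / exp t" for t :: real
  define g where "g x = \<beta> * x\<^sup>2" for x :: real
  have "(f has_integral Gamma z) {0..}" unfolding f_def by (rule Gamma_integral_real[OF z])
  then have f: "(f has_integral Gamma z) {0<..}"
    by (subst (asm) has_integral_spike_set_eq[where T = "{0<..}"]) (auto intro: negligible_subset[of "{0}"])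
  have "f absolutely_integrable_on {0<..}"
    using f by (intro nonnegative_absolutely_integrable_1) (auto simp: f_def)
  moreover have "integral {0<..} f = Gamma z" using f by (rule integral_unique)
  moreover have "g ` {0<..} = {0<..}"
  proof
    show "{0<..} \<subseteq> g ` {0<..}"
    proof
      fix t :: real assume "t \<in> {0<..}"
      then have "g (sqrt (t / \<beta>)) = t" "sqrt (t / \<beta>) \<in> {0<..}" using \<beta> by (auto simp: g_def)
      then show "t \<in> g ` {0<..}" by (metis image_eqI)
    qed
  qed (use \<beta> in \<open>auto simp: g_def\<close>)
  moreover have "(\<lambda>x. \<bar>2 * \<beta> * x\<bar> * f (g x)) absolutely_integrable_on {0<..} \<and>
      integral {0<..} (\<lambda>x. \<bar>2 * \<beta> * x\<bar> * f (g x)) = Gamma z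
    \<longleftrightarrow> f absolutely_integrable_on (g ` {0<..}) \<and> integral (g ` {0<..}) f = Gamma z"
  proof (rule has_absolute_integral_change_of_variables_1')
    show "(g has_field_derivative 2 * \<beta> * x) (at x within {0<..})" for x
      unfolding g_def[abs_def] by (auto intro!: derivative_eq_intros)
    show "inj_on g {0<..}" using \<beta> by (auto simp: g_def inj_on_def)
  qed simp
  ultimately have *: "(\<lambda>x. \<bar>2 * \<beta> * x\<bar> * f (g x)) absolutely_integrable_on {0<..}"
    "integral {0<..} (\<lambda>x. \<bar>2 * \<beta> * x\<bar> * f (g x)) = Gamma z" by auto
  define k where "k x = indicator {0<..} x * (x powr n * exp (- (\<beta> * x\<^sup>2)))" for x :: real
  have k: "indicator {0<..} x *\<^sub>R (\<bar>2 * \<beta> * x\<bar> * f (g x)) = (2 * \<beta> powr z) * k x" for x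
  proof (cases "0 < x")
    case True
    have "(\<beta> * x\<^sup>2) powr (z - 1) = \<beta> powr (z - 1) * x powr (2 * (z - 1))"
    proof -
      have "(\<beta> * x\<^sup>2) powr (z - 1) = \<beta> powr (z - 1) * (x powr 2) powr (z - 1)"
        using \<beta> True by (simp add: powr_mult)
      then show ?thesis by (simp only: powr_powr)
    qed
    moreover have "\<beta> powr z = \<beta> powr (z - 1) * \<beta>" using \<beta> by (simp add: powr_diff)
    moreover have "x powr n = x powr (2 * (z - 1)) * x"
    proof -
      have "n = 2 * (z - 1) + 1" by (simp add: z_def field_simps)
      then have "x powr n = x powr (2 * (z - 1) + 1)" by simp
      also have "\<dots> = x powr (2 * (z - 1)) * x" unfolding powr_add using True by simp
      finally show ?thesis .
    qed
    ultimately show ?thesis using True \<beta> by (simp add: k_def f_def g_def exp_minus field_simps)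
  qed (simp add: k_def)
  have [measurable]: "k \<in> borel_measurable borel" unfolding k_def[abs_def] by measurable
  have "integrable lebesgue (\<lambda>x. (2 * \<beta> powr z) * k x)"
    using *(1) unfolding set_integrable_def k .
  then have "integrable lborel (\<lambda>x. (2 * \<beta> powr z) * k x)"
    by (subst (asm) integrable_completion) auto
  then have int: "integrable lborel k" using \<beta> by simp
  have "(2 * \<beta> powr z) * integral\<^sup>L lborel k = integral\<^sup>L lebesgue (\<lambda>x. (2 * \<beta> powr z) * k x)"
    by (subst integral_completion) auto
  also have "\<dots> = Gamma z"
    using set_lebesgue_integral_eq_integral(2)[OF *(1)] *(2)
    unfolding set_lebesgue_integral_def k by simp
  finally have "integral\<^sup>L lborel k = half_moment \<beta> n"
    using \<beta> by (simp add: half_moment_def z_def field_simps)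
  then show ?thesis using int unfolding has_bochner_integral_iff k_def[abs_def] by simp
qed

lemma has_integral_half_moment_left:
  assumes \<beta>: "0 < \<beta>" and n: "0 \<le> n"
  shows "has_bochner_integral lborel (\<lambda>x. indicator {..<0} x * ((- x) powr n * exp (- (\<beta> * x\<^sup>2)))) (half_moment \<beta> n)"
proof -
  have "has_bochner_integral lborel (\<lambda>x. indicator {0<..} (0 + (-1) * x) * ((0 + (-1) * x) powr n * exp (- (\<beta> * (0 + (-1) * x)\<^sup>2))))
     (half_moment \<beta> n /\<^sub>R \<bar>-1\<bar>)"
    by (subst lborel_has_bochner_integral_real_affine_iff[symmetric]) (auto intro: has_integral_half_moment assms)
  moreover have "(\<lambda>x::real. indicator {0<..} (0 + (-1) * x) * ((0 + (-1) * x) powr n * exp (- (\<beta> * (0 + (-1) * x)\<^sup>2))))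
      = (\<lambda>x. indicator {..<0} x * ((- x) powr n * exp (- (\<beta> * x\<^sup>2))))"
    by (auto simp: fun_eq_iff indicator_def)
  ultimately show ?thesis by simp
qed

section \<open>The threshold drift\<close>

lemma threshold_drift_eq: "threshold_drift \<alpha>1 \<alpha>2 x = - (if x \<le> 0 then \<alpha>1 else \<alpha>2) * x"
  by (simp add: threshold_drift_def)

lemma dissipative_threshold_drift:
  assumes "0 < \<sigma>" "0 < \<alpha>1" "0 < \<alpha>2"
  shows "dissipative_drift (threshold_drift \<alpha>1 \<alpha>2) (min \<alpha>1 \<alpha>2) (max \<alpha>1 \<alpha>2) \<sigma>"
proof
  fix x y :: real assume yx: "y \<le> x"
  define c where "c = min \<alpha>1 \<alpha>2"
  define C where "C = max \<alpha>1 \<alpha>2"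
  have c: "c \<le> \<alpha>1" "c \<le> \<alpha>2" "\<alpha>1 \<le> C" "\<alpha>2 \<le> C" by (auto simp: c_def C_def)
  have m: "c * d \<le> \<alpha>1 * d" "c * d \<le> \<alpha>2 * d" "\<alpha>1 * d \<le> C * d" "\<alpha>2 * d \<le> C * d" if "0 \<le> d" for d
    using c that by (auto intro!: mult_right_mono)
  consider "x \<le> 0" | "y \<le> 0" "0 < x" | "0 < y" using yx by linarith
  then have "threshold_drift \<alpha>1 \<alpha>2 x - threshold_drift \<alpha>1 \<alpha>2 y \<le> - c * (x - y) \<and>
      - C * (x - y) \<le> threshold_drift \<alpha>1 \<alpha>2 x - threshold_drift \<alpha>1 \<alpha>2 y"
  proof cases
    case 1
    then show ?thesis using m[of "x - y"] yx by (simp add: threshold_drift_eq algebra_simps)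
  next
    case 2
    then have "0 \<le> x" "0 \<le> - y" by auto
    note m2 = m(2,4)[OF this(1)] m(1,3)[OF this(2)]
    have "threshold_drift \<alpha>1 \<alpha>2 x - threshold_drift \<alpha>1 \<alpha>2 y = - (\<alpha>2 * x) - \<alpha>1 * (- y)"
      using 2 by (simp add: threshold_drift_eq)
    moreover have "- d * (x - y) = - (d * x) - d * (- y)" for d by (simp add: algebra_simps)
    ultimately show ?thesis using m2 by (simp only:) linarith
  next
    case 3
    then show ?thesis using m[of "x - y"] yx by (simp add: threshold_drift_eq algebra_simps)
  qed
  then show "threshold_drift \<alpha>1 \<alpha>2 x - threshold_drift \<alpha>1 \<alpha>2 y \<le> - min \<alpha>1 \<alpha>2 * (x - y)"
    "- max \<alpha>1 \<alpha>2 * (x - y) \<le> threshold_drift \<alpha>1 \<alpha>2 x - threshold_drift \<alpha>1 \<alpha>2 y"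
    by (simp_all add: c_def C_def)
qed (use assms in \<open>auto simp: threshold_drift_eq\<close>)

text \<open>The exponential of this function is the unnormalised invariant density.\<close>

definition threshold_potential :: "real \<Rightarrow> real \<Rightarrow> real \<Rightarrow> real \<Rightarrow> real" where
  "threshold_potential \<alpha>1 \<alpha>2 \<sigma> x = - ((if x \<le> 0 then \<alpha>1 else \<alpha>2) / \<sigma>\<^sup>2 * x\<^sup>2)"

lemma threshold_potential_derivative:
  "(threshold_potential \<alpha>1 \<alpha>2 \<sigma> has_real_derivative 2 * threshold_drift \<alpha>1 \<alpha>2 x / \<sigma>\<^sup>2) (at x)"
proof -
  have quadratic: "((\<lambda>x. - (\<alpha> / \<sigma>\<^sup>2 * x\<^sup>2)) has_real_derivative 2 * (- \<alpha> * x) / \<sigma>\<^sup>2) (at x)" for \<alpha>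
  proof -
    have k: "((\<lambda>x. - (k * x\<^sup>2)) has_real_derivative - (2 * k * x)) (at x)" for k
      by (auto intro!: derivative_eq_intros)
    show ?thesis by (rule DERIV_cong[OF k]) simp
  qed
  consider "x < 0" | "x = 0" | "0 < x" by linarith
  then show ?thesis
  proof cases
    case 1
    have "(threshold_potential \<alpha>1 \<alpha>2 \<sigma> has_real_derivative 2 * (- \<alpha>1 * x) / \<sigma>\<^sup>2) (at x)"
      by (rule has_field_derivative_transform_within_open[OF quadratic, of "{..<0}"])
        (use 1 in \<open>auto simp: threshold_potential_def\<close>)
    then show ?thesis using 1 by (simp add: threshold_drift_eq)
  next
    case 2
    define m where "m = (\<bar>\<alpha>1\<bar> + \<bar>\<alpha>2\<bar>) / \<sigma>\<^sup>2"
    have lim: "((\<lambda>t. m * \<bar>t\<bar>) \<longlongrightarrow> 0) (at 0)" by (auto intro!: tendsto_eq_intros)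
    have "((\<lambda>t. (threshold_potential \<alpha>1 \<alpha>2 \<sigma> (0 + t) - threshold_potential \<alpha>1 \<alpha>2 \<sigma> 0) / t) \<longlongrightarrow> 0) (at 0)"
    proof (rule Lim_null_comparison[OF _ lim], rule always_eventually, rule allI)
      fix t :: real
      let ?\<alpha> = "if t \<le> 0 then \<alpha>1 else \<alpha>2"
      have "norm ((threshold_potential \<alpha>1 \<alpha>2 \<sigma> (0 + t) - threshold_potential \<alpha>1 \<alpha>2 \<sigma> 0) / t)
          = \<bar>?\<alpha>\<bar> / \<sigma>\<^sup>2 * \<bar>t\<bar>"
        by (cases "t = 0") (auto simp: threshold_potential_def power2_eq_square abs_mult)
      also have "\<dots> \<le> m * \<bar>t\<bar>"
        unfolding m_def by (intro mult_right_mono divide_right_mono) auto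
      finally show "norm ((threshold_potential \<alpha>1 \<alpha>2 \<sigma> (0 + t) - threshold_potential \<alpha>1 \<alpha>2 \<sigma> 0) / t) \<le> m * \<bar>t\<bar>" .
    qed
    then show ?thesis using 2 by (simp add: DERIV_def threshold_drift_eq)
  next
    case 3
    have "(threshold_potential \<alpha>1 \<alpha>2 \<sigma> has_real_derivative 2 * (- \<alpha>2 * x) / \<sigma>\<^sup>2) (at x)"
      by (rule has_field_derivative_transform_within_open[OF quadratic, of "{0<..}"])
        (use 3 in \<open>auto simp: threshold_potential_def\<close>)
    then show ?thesis using 3 by (simp add: threshold_drift_eq)
  qed
qed

text \<open>On each half-line the density is a Gaussian, so the three integrals split at \<open>0\<close>.\<close>

lemma threshold_integrals:
  assumes "0 < \<sigma>" "0 < \<alpha>1" "0 < \<alpha>2" "0 < n"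
  shows "(LINT x|lborel. (max 0 (- x)) powr n * exp (threshold_potential \<alpha>1 \<alpha>2 \<sigma> x)) = half_moment (\<alpha>1 / \<sigma>\<^sup>2) n"
    and "(LINT x|lborel. (max 0 x) powr n * exp (threshold_potential \<alpha>1 \<alpha>2 \<sigma> x)) = half_moment (\<alpha>2 / \<sigma>\<^sup>2) n"
    and "(LINT x|lborel. exp (threshold_potential \<alpha>1 \<alpha>2 \<sigma> x))
      = half_moment (\<alpha>1 / \<sigma>\<^sup>2) 0 + half_moment (\<alpha>2 / \<sigma>\<^sup>2) 0"
proof -
  have \<beta>: "0 < \<alpha>1 / \<sigma>\<^sup>2" "0 < \<alpha>2 / \<sigma>\<^sup>2" using assms by auto
  have "(LINT x|lborel. (max 0 (- x)) powr n * exp (threshold_potential \<alpha>1 \<alpha>2 \<sigma> x))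
      = (LINT x|lborel. indicator {..<0} x * ((- x) powr n * exp (- (\<alpha>1 / \<sigma>\<^sup>2 * x\<^sup>2))))"
    using assms by (intro Bochner_Integration.integral_cong) (auto simp: threshold_potential_def indicator_def max_def)
  then show "(LINT x|lborel. (max 0 (- x)) powr n * exp (threshold_potential \<alpha>1 \<alpha>2 \<sigma> x)) = half_moment (\<alpha>1 / \<sigma>\<^sup>2) n"
    using has_integral_half_moment_left[OF \<beta>(1), of n] assms by (simp add: has_bochner_integral_iff)
  have "(LINT x|lborel. (max 0 x) powr n * exp (threshold_potential \<alpha>1 \<alpha>2 \<sigma> x))
      = (LINT x|lborel. indicator {0<..} x * (x powr n * exp (- (\<alpha>2 / \<sigma>\<^sup>2 * x\<^sup>2))))"
    using assms by (intro Bochner_Integration.integral_cong) (auto simp: threshold_potential_def indicator_def max_def)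
  then show "(LINT x|lborel. (max 0 x) powr n * exp (threshold_potential \<alpha>1 \<alpha>2 \<sigma> x)) = half_moment (\<alpha>2 / \<sigma>\<^sup>2) n"
    using has_integral_half_moment[OF \<beta>(2), of n] assms by (simp add: has_bochner_integral_iff)
  have sum: "has_bochner_integral lborel (\<lambda>x. indicator {..<0} x * ((- x) powr 0 * exp (- (\<alpha>1 / \<sigma>\<^sup>2 * x\<^sup>2)))
      + indicator {0<..} x * (x powr 0 * exp (- (\<alpha>2 / \<sigma>\<^sup>2 * x\<^sup>2)))) (half_moment (\<alpha>1 / \<sigma>\<^sup>2) 0 + half_moment (\<alpha>2 / \<sigma>\<^sup>2) 0)"
    by (intro has_bochner_integral_add has_integral_half_moment has_integral_half_moment_left \<beta>) auto
  have "(LINT x|lborel. exp (threshold_potential \<alpha>1 \<alpha>2 \<sigma> x))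
      = (LINT x|lborel. indicator {..<0} x * ((- x) powr 0 * exp (- (\<alpha>1 / \<sigma>\<^sup>2 * x\<^sup>2)))
        + indicator {0<..} x * (x powr 0 * exp (- (\<alpha>2 / \<sigma>\<^sup>2 * x\<^sup>2))))"
  proof (rule integral_cong_AE)
    show "AE x in lborel. exp (threshold_potential \<alpha>1 \<alpha>2 \<sigma> x) = indicator {..<0} x * ((- x) powr 0 * exp (- (\<alpha>1 / \<sigma>\<^sup>2 * x\<^sup>2)))
        + indicator {0<..} x * (x powr 0 * exp (- (\<alpha>2 / \<sigma>\<^sup>2 * x\<^sup>2)))"
      using AE_lborel_singleton[of 0] by eventually_elim (auto simp: threshold_potential_def indicator_def)
  qed (unfold threshold_potential_def[abs_def], measurable)
  then show "(LINT x|lborel. exp (threshold_potential \<alpha>1 \<alpha>2 \<sigma> x))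
      = half_moment (\<alpha>1 / \<sigma>\<^sup>2) 0 + half_moment (\<alpha>2 / \<sigma>\<^sup>2) 0"
    using sum by (simp add: has_bochner_integral_iff)
qed

context dissipative_drift
begin

lemma powr_eventually_le_wt:
  assumes "0 < \<eta>"
  shows "\<exists>R. \<forall>x. R \<le> \<bar>x\<bar> \<longrightarrow> \<bar>x\<bar> powr n \<le> \<eta> * wt 1 x"
proof -
  have "((\<lambda>t. t powr n / exp (scale * t)) \<longlongrightarrow> 0) at_top"
    using scale_pos by real_asymp
  then have "eventually (\<lambda>t. t powr n / exp (scale * t) < \<eta> / 2) at_top"
    using assms by (intro order_tendstoD) auto
  then obtain R where R: "\<And>t. R \<le> t \<Longrightarrow> t powr n / exp (scale * t) < \<eta> / 2"
    unfolding eventually_at_top_linorder by blast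
  show ?thesis
  proof (intro exI allI impI)
    fix x assume "R \<le> \<bar>x\<bar>"
    from R[OF this] have "\<bar>x\<bar> powr n \<le> \<eta> * (exp (scale * \<bar>x\<bar>) / 2)" by (simp add: field_simps)
    also have "\<dots> \<le> \<eta> * wt 1 x"
    proof (intro mult_left_mono)
      have "scale * \<bar>x\<bar> = \<bar>scale * x\<bar>" using scale_pos by (simp add: abs_mult)
      then have "wt 1 x = cosh (scale * \<bar>x\<bar>)" by (simp add: wt_def)
      also have "\<dots> \<ge> exp (scale * \<bar>x\<bar>) / 2" by (simp add: cosh_field_def)
      finally show "exp (scale * \<bar>x\<bar>) / 2 \<le> wt 1 x" .
    qed (use assms in simp)
    finally show "\<bar>x\<bar> powr n \<le> \<eta> * wt 1 x" .
  qed
qed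

lemma integrable_wt_mult_exp:
  assumes [measurable]: "B \<in> borel_measurable borel" and B: "\<And>x. B x \<le> - (c / \<sigma>\<^sup>2 * x\<^sup>2)"
  shows "integrable lborel (\<lambda>x. wt 1 x * exp (B x))"
proof -
  define \<delta> where "\<delta> = \<sigma>\<^sup>2 / (2 * c)"
  have \<delta>: "0 < \<delta>" using c_pos sigma_pos by (simp add: \<delta>_def)
  have "integrable (gauss \<delta>) (\<lambda>z. cosh (0 + scale * z))" by (rule gauss_cosh(1)[OF \<delta>])
  then have int: "integrable lborel (\<lambda>z. normal_density 0 (sqrt \<delta>) z * wt 1 z)"
    by (subst (asm) gauss_integrable_iff)
      (auto simp: wt_def intro!: borel_measurable_continuous_onI continuous_intros)
  have nd: "normal_density 0 (sqrt \<delta>) z = exp (- (c / \<sigma>\<^sup>2 * z\<^sup>2)) / sqrt (2 * pi * \<delta>)" for z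
  proof -
    have "- (z - 0)\<^sup>2 / (2 * (sqrt \<delta>)\<^sup>2) = - (c / \<sigma>\<^sup>2 * z\<^sup>2)"
      using \<delta> c_pos sigma_pos by (simp add: \<delta>_def)
    then show ?thesis unfolding normal_density_def using \<delta> by simp
  qed
  show ?thesis
  proof (rule Bochner_Integration.integrable_bound)
    show "integrable lborel (\<lambda>z. sqrt (2 * pi * \<delta>) * (normal_density 0 (sqrt \<delta>) z * wt 1 z))" using int by simp
    show "AE x in lborel. norm (wt 1 x * exp (B x)) \<le> norm (sqrt (2 * pi * \<delta>) * (normal_density 0 (sqrt \<delta>) x * wt 1 x))"
    proof (rule AE_I2)
      fix x
      have eq: "sqrt (2 * pi * \<delta>) * (normal_density 0 (sqrt \<delta>) x * wt 1 x) = exp (- (c / \<sigma>\<^sup>2 * x\<^sup>2)) * wt 1 x"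
        unfolding nd using \<delta> by simp
      have "exp (B x) * wt 1 x \<le> exp (- (c / \<sigma>\<^sup>2 * x\<^sup>2)) * wt 1 x"
        using B[of x] wt_nonneg by (intro mult_right_mono) auto
      then show "norm (wt 1 x * exp (B x)) \<le> norm (sqrt (2 * pi * \<delta>) * (normal_density 0 (sqrt \<delta>) x * wt 1 x))"
        unfolding eq using wt_nonneg[of 1 x] by (simp add: abs_mult mult.commute)
    qed
  qed measurable
qed

end

section \<open>Consistency of the estimators\<close>

text \<open>Put \<open>\<beta>1 = \<alpha>1 / \<sigma>\<^sup>2\<close> and \<open>\<beta>2 = \<alpha>2 / \<sigma>\<^sup>2\<close>.  The ratio of the two limits is \<open>(\<beta>1 / \<beta>2) powr ((n + 1) / 2)\<close>, so the root
  in the estimator extracts \<open>sqrt (\<beta>1 / \<beta>2)\<close>, and the bracket cancels the normalising constant \<open>Z\<close>, which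
  is proportional to \<open>1 / sqrt \<beta>1 + 1 / sqrt \<beta>2\<close>.  What is left is \<open>\<sigma> powr n * \<beta>1 powr (n / 2)\<close>, the
  power \<open>n / 2\<close> of \<open>\<alpha>1\<close>.  As \<open>Z\<close> is symmetric, exchanging the two sides gives the second estimator.\<close>

lemma estimator_tendsto:
  fixes L R :: "nat \<Rightarrow> real"
  assumes pos: "0 < \<sigma>" "0 < \<alpha>1" "0 < \<alpha>2" "0 < n"
    and Z: "Z = half_moment (\<alpha>1 / \<sigma>\<^sup>2) 0 + half_moment (\<alpha>2 / \<sigma>\<^sup>2) 0"
    and L: "L \<longlonglongrightarrow> half_moment (\<alpha>1 / \<sigma>\<^sup>2) n / Z" and R: "R \<longlonglongrightarrow> half_moment (\<alpha>2 / \<sigma>\<^sup>2) n / Z"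
  shows "(\<lambda>N. (\<sigma> powr n * Gamma ((n + 1) / 2) /
    (sqrt pi * L N * ((R N / L N) powr (1 / (n + 1)) + 1))) powr (2 / n)) \<longlonglongrightarrow> \<alpha>1"
proof -
  define \<beta>1 where "\<beta>1 = \<alpha>1 / \<sigma>\<^sup>2"
  define \<beta>2 where "\<beta>2 = \<alpha>2 / \<sigma>\<^sup>2"
  have \<beta>: "0 < \<beta>1" "0 < \<beta>2" using pos by (auto simp: \<beta>1_def \<beta>2_def)
  define G where "G = Gamma ((n + 1) / 2)"
  have G: "0 < G" using pos by (simp add: G_def Gamma_real_pos)
  define l where "l = half_moment \<beta>1 n / Z"
  define r where "r = half_moment \<beta>2 n / Z"
  have Zp: "0 < Z" unfolding Z using \<beta> by (auto simp: \<beta>1_def \<beta>2_def intro!: add_pos_pos half_moment_pos)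
  have lr: "0 < l" "0 < r" using Zp \<beta> pos by (auto simp: l_def r_def intro!: divide_pos_pos half_moment_pos)
  have Z': "Z = sqrt pi / 2 * (1 / sqrt \<beta>1 + 1 / sqrt \<beta>2)"
    unfolding Z half_moment_def using \<beta> by (simp add: \<beta>1_def[symmetric] \<beta>2_def[symmetric] Gamma_one_half_real powr_half_sqrt field_simps)
  have "r / l = half_moment \<beta>2 n / half_moment \<beta>1 n" using Zp by (simp add: l_def r_def)
  also have "\<dots> = \<beta>1 powr ((n + 1) / 2) / \<beta>2 powr ((n + 1) / 2)"
    using G \<beta> by (simp add: half_moment_def G_def[symmetric])
  also have "\<dots> = (\<beta>1 / \<beta>2) powr ((n + 1) / 2)" using \<beta> by (simp add: powr_divide)
  finally have "(r / l) powr (1 / (n + 1)) = (\<beta>1 / \<beta>2) powr ((n + 1) / 2 * (1 / (n + 1)))"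
    by (simp only: powr_powr)
  also have "(n + 1) / 2 * (1 / (n + 1)) = 1 / 2" using pos by (simp add: field_simps)
  finally have "(r / l) powr (1 / (n + 1)) = (\<beta>1 / \<beta>2) powr (1 / 2)" .
  then have ratio: "(r / l) powr (1 / (n + 1)) = sqrt \<beta>1 / sqrt \<beta>2"
    using \<beta> by (simp add: powr_half_sqrt real_sqrt_divide)
  have split: "\<beta>1 powr ((n + 1) / 2) = \<beta>1 powr (n / 2) * sqrt \<beta>1"
    using \<beta> by (simp add: add_divide_distrib powr_add powr_half_sqrt)
  have "l = G / (\<beta>1 powr (n / 2) * sqrt \<beta>1 * (sqrt pi * (1 / sqrt \<beta>1 + 1 / sqrt \<beta>2)))"
    unfolding l_def half_moment_def G_def[symmetric] split Z' by simp
  also have "sqrt pi * \<dots> * (sqrt \<beta>1 / sqrt \<beta>2 + 1) = G / \<beta>1 powr (n / 2)"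
  proof -
    have e: "sqrt \<beta>1 / sqrt \<beta>2 + 1 = sqrt \<beta>1 * (1 / sqrt \<beta>1 + 1 / sqrt \<beta>2)" using \<beta> by (simp add: field_simps)
    have "0 < 1 / sqrt \<beta>1 + 1 / sqrt \<beta>2" using \<beta> by (intro add_pos_pos) auto
    then show ?thesis unfolding e using \<beta> by simp
  qed
  finally have denom: "sqrt pi * l * ((r / l) powr (1 / (n + 1)) + 1) = G / \<beta>1 powr (n / 2)"
    unfolding ratio .
  have "(\<sigma> powr n * G / (G / \<beta>1 powr (n / 2))) powr (2 / n) = (\<sigma> powr n * \<beta>1 powr (n / 2)) powr (2 / n)"
    using G \<beta> by simp
  also have "\<dots> = \<sigma> powr 2 * \<beta>1 powr 1" using pos \<beta> by (simp add: powr_mult powr_powr)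
  also have "\<dots> = \<alpha>1" using pos \<beta> by (simp add: \<beta>1_def)
  finally have limit: "(\<sigma> powr n * G / (sqrt pi * l * ((r / l) powr (1 / (n + 1)) + 1))) powr (2 / n) = \<alpha>1"
    unfolding denom .
  have d0: "sqrt pi * l * ((r / l) powr (1 / (n + 1)) + 1) \<noteq> 0" unfolding denom using G \<beta> by simp
  have "(\<lambda>N. (\<sigma> powr n * G / (sqrt pi * L N * ((R N / L N) powr (1 / (n + 1)) + 1))) powr (2 / n))
      \<longlonglongrightarrow> (\<sigma> powr n * G / (sqrt pi * l * ((r / l) powr (1 / (n + 1)) + 1))) powr (2 / n)"
  proof -
    have Ll: "L \<longlonglongrightarrow> l" and Rr: "R \<longlonglongrightarrow> r"
      using L R by (simp_all add: l_def r_def \<beta>1_def \<beta>2_def)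
    have "(\<lambda>N. (R N / L N) powr (1 / (n + 1))) \<longlonglongrightarrow> (r / l) powr (1 / (n + 1))"
      by (intro tendsto_powr tendsto_divide Ll Rr tendsto_const) (use lr in auto)
    then have d: "(\<lambda>N. sqrt pi * L N * ((R N / L N) powr (1 / (n + 1)) + 1))
        \<longlonglongrightarrow> sqrt pi * l * ((r / l) powr (1 / (n + 1)) + 1)"
      by (intro tendsto_mult tendsto_add tendsto_const Ll)
    have "\<sigma> powr n * G / (sqrt pi * l * ((r / l) powr (1 / (n + 1)) + 1)) \<noteq> 0"
      unfolding denom using G \<beta> pos by simp
    then show ?thesis by (intro tendsto_powr tendsto_divide d tendsto_const d0)
  qed
  then show ?thesis unfolding limit unfolding G_def .
qed

theorem theorem3p4:
  fixes M :: "'a measure" and F :: "real \<Rightarrow> 'a measure"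
    and W X :: "real \<Rightarrow> 'a \<Rightarrow> real"
    and \<sigma> \<alpha>1 \<alpha>2 x0 n h :: real
  assumes "filtered_prob_space M F"
    and "standard_brownian_motion M F W"
    and "\<sigma> > 0" and "\<alpha>1 > 0" and "\<alpha>2 > 0"
    and "sde_solution M F W (threshold_drift \<alpha>1 \<alpha>2) \<sigma> x0 X"
    and "n > 0" and "h > 0"
  shows "(AE \<omega> in M. (\<lambda>N. alpha1_hat \<sigma> n h X N \<omega>) \<longlonglongrightarrow> \<alpha>1) \<and>
         (AE \<omega> in M. (\<lambda>N. alpha2_hat \<sigma> n h X N \<omega>) \<longlonglongrightarrow> \<alpha>2)"
proof -
  interpret filtered_prob_space M F by fact
  interpret dissipative_drift "threshold_drift \<alpha>1 \<alpha>2" "min \<alpha>1 \<alpha>2" "max \<alpha>1 \<alpha>2" \<sigma>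
    using assms by (intro dissipative_threshold_drift)
  interpret sampled_solution "threshold_drift \<alpha>1 \<alpha>2" "min \<alpha>1 \<alpha>2" "max \<alpha>1 \<alpha>2" \<sigma> M F W x0 X h
    by unfold_locales (use assms in auto)
  let ?B = "threshold_potential \<alpha>1 \<alpha>2 \<sigma>"
  define Z where "Z = half_moment (\<alpha>1 / \<sigma>\<^sup>2) 0 + half_moment (\<alpha>2 / \<sigma>\<^sup>2) 0"
  have int: "integrable lborel (\<lambda>x. wt 1 x * exp (?B x))"
  proof (rule integrable_wt_mult_exp)
    show "?B \<in> borel_measurable borel" unfolding threshold_potential_def[abs_def] by measurable
    show "?B x \<le> - (min \<alpha>1 \<alpha>2 / \<sigma>\<^sup>2 * x\<^sup>2)" for x
      unfolding threshold_potential_def by (auto intro!: mult_right_mono divide_right_mono)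
  qed
  have tail: "\<exists>R. \<forall>x. R \<le> \<bar>x\<bar> \<longrightarrow> \<bar>(max 0 (s * x)) powr n\<bar> \<le> \<eta> * wt 1 x" if "s \<in> {1, -1}" "0 < \<eta>" for s \<eta> :: real
  proof -
    have "\<bar>(max 0 (s * x)) powr n\<bar> \<le> \<bar>x\<bar> powr n" for x
      using that assms by (auto intro!: powr_mono2)
    then show ?thesis using powr_eventually_le_wt[OF that(2), of n] by (meson order_trans)
  qed
  have cont: "continuous_on UNIV (\<lambda>x::real. (max 0 (s * x)) powr n)" for s
    using assms by (intro continuous_on_powr' continuous_intros) auto
  have L: "AE \<omega> in M. (\<lambda>N. L_hat n h X N \<omega>) \<longlonglongrightarrow> half_moment (\<alpha>1 / \<sigma>\<^sup>2) n / Z"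
  proof -
    have "(- y) powr n * indicator {..0} y = (max 0 ((-1) * y)) powr n" for y :: real
      by (auto simp: indicator_def max_def)
    then have "L_hat n h X N \<omega> = (\<Sum>k=1..N. (max 0 ((-1) * X (real k * h) \<omega>)) powr n) / real N" for N \<omega>
      by (simp add: L_hat_def)
    then show ?thesis
      using ergodic_average[OF threshold_potential_derivative int cont[of "-1"] tail[of "-1"]]
        threshold_integrals[OF assms(3-5,7)] by (simp add: Z_def)
  qed
  have R: "AE \<omega> in M. (\<lambda>N. R_hat n h X N \<omega>) \<longlonglongrightarrow> half_moment (\<alpha>2 / \<sigma>\<^sup>2) n / Z"
  proof -
    have "y powr n * indicator {0<..} y = (max 0 (1 * y)) powr n" for y :: real
      by (auto simp: indicator_def max_def)
    then have "R_hat n h X N \<omega> = (\<Sum>k=1..N. (max 0 (1 * X (real k * h) \<omega>)) powr n) / real N" for N \<omega>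
      by (simp add: R_hat_def)
    then show ?thesis
      using ergodic_average[OF threshold_potential_derivative int cont[of 1] tail[of 1]]
        threshold_integrals[OF assms(3-5,7)] by (simp add: Z_def)
  qed
  show ?thesis
  proof
    from L R show "AE \<omega> in M. (\<lambda>N. alpha1_hat \<sigma> n h X N \<omega>) \<longlonglongrightarrow> \<alpha>1"
      unfolding alpha1_hat_def by eventually_elim (rule estimator_tendsto[OF assms(3-5,7) Z_def])
    have Z2: "Z = half_moment (\<alpha>2 / \<sigma>\<^sup>2) 0 + half_moment (\<alpha>1 / \<sigma>\<^sup>2) 0" by (simp add: Z_def)
    from L R show "AE \<omega> in M. (\<lambda>N. alpha2_hat \<sigma> n h X N \<omega>) \<longlonglongrightarrow> \<alpha>2"
      unfolding alpha2_hat_def by eventually_elim (rule estimator_tendsto[OF assms(3,5,4,7) Z2])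
  qed
qed

end
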